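(* Let $A$ be a Lie algebroid and let $\pi,\pi'\in\Gamma(\wedge^2A)$ be bivectors. (i) $\pi$ and $\pi'$ constitute a Poisson pair if and only if their graphs $(\overline{\mathrm{graph}\,\pi},\overline{\mathrm{graph}\,\pi'})$ constitute a Dirac pair. (ii) If $(\pi,\pi')$ is a Hamiltonian pair, then $(\overline{\mathrm{graph}\,\pi},\overline{\mathrm{graph}\,\pi'})$ is a Dirac pair. (iii) Conversely, if $(\overline{\mathrm{graph}\,\pi},\overline{\mathrm{graph}\,\pi'})$ is a Dirac pair and if $\pi$ and $\pi'$ are non-degenerate bivectors, then $(\pi,\pi')$ is a Hamiltonian pair.
   Context: $[~,~]$ denotes the Lie algebroid bracket on $\Gamma A$, and also the Schouten--Nijenhuis bracket on $\Gamma(\wedge^\bullet A)$. A bivector $\pi\in\Gamma(\wedge^2A)$ is identified with the map $\pi:A^*\to A$, $\pi\xi=i_\xi\pi$, i.e. $\langle\eta,\pi\xi\rangle=\pi(\xi,\eta)$, and with the induced map on sections; it is non-degenerate if this bundle map is invertible. Its graph, viewed in $A\oplus A^*$, is $\overline{\mathrm{graph}\,\pi}=\{(\pi\xi,\xi)\mid\xi\in A^*\}$. $\pi$ is a Poisson structure if $[\pi,\pi]=0$. A Hamiltonian pair is a pair of Poisson structures $(\pi,\pi')$ such that $\pi+\pi'$ is also a Poisson structure. A Dirac structure on $A$ is a maximally isotropic subbundle of $A\oplus A^*$ (for the pairing $\langle X+\xi,Y+\eta\rangle=\langle\xi,Y\rangle+\langle\eta,X\rangle$) whose space of sections is closed under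 the Dorfman bracket $[X+\xi,Y+\eta]=[X,Y]+\mathcal L_X\eta-i_Y(\mathrm d\xi)$, where $\mathrm d$ is the Lie algebroid differential and $\mathcal L_X=[i_X,\mathrm d]$. A bivector is Poisson if and only if its graph is a Dirac structure (known fact). Relations are taken at the level of sections. For a relation $\mathbf N\subset\Gamma A\times\Gamma A$, the dual relation is $\mathbf N^*=\{(\beta,\alpha)\in\Gamma(A^* )\times\Gamma(A^* )\mid\langle\alpha,u\rangle=\langle\beta,v\rangle\ \forall(u,v)\in\mathbf N\}$. $\mathbf N$ is a Nijenhuis relation if $\langle\alpha,[v_1,v_2]\rangle-\langle\alpha',[v_1,u_2]+[u_1,v_2]\rangle+\langle\alpha'',[u_1,u_2]\rangle=0$ for all $(u_1,v_1),(u_2,v_2)\in\mathbf N$ and all $(\alpha,\alpha'),(\alpha',\alpha'')\in\mathbf N^*$. A Poisson pair is a pair $(\pi,\pi')$ of Poisson bivectors such that $\mathbf N(\pi,\pi')=\{(\pi'\xi,\pi\xi)\mid\xi\in\Gamma(A^* )\}$ is a Nijenhuis relation. A Dirac pair is a pair $(L,L')$ of Dirac structures on $A$ such that $\mathbf N_{L,L'}=\{(x,y)\in\Gamma A\times\Gamma A\mid\exists\,\xi\in\Gamma(A^* ),\ (x,\xi)\in\Gamma L',\ (y,\xi)\in\Gamma L\}$ is a Nijenhuis relation. *)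

theory Defs
  imports "HOL-Analysis.Analysis"
begin

section \<open>Smooth functions and manifolds\<close>

text \<open>The model space of a manifold is a linear subspace \<open>H\<close> of a Euclidean space rather
  than a whole Euclidean type, so that dimension 0 (hence Lie algebras, as Lie algebroids over a
  point) is covered. For \<open>S\<close> open in \<open>H\<close>, the derivative within \<open>S\<close> is determined
  along \<open>H\<close> only, and only its values along \<open>H\<close> are used.\<close>

primrec Ck_on :: "nat \<Rightarrow> 'e::euclidean_space set \<Rightarrow> 'e set \<Rightarrow> ('e \<Rightarrow> 'f::real_normed_vector) \<Rightarrow> bool"
  where
    "Ck_on 0 H S f = continuous_on S f"
  | "Ck_on (Suc k) H S f =
       (\<exists>f'. (\<forall>x\<in>S. (f has_derivative f' x) (at x within S)) \<and>
             (\<forall>v\<in>H. Ck_on k H S (\<lambda>x. f' x v)))"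

definition smooth_on :: "'e::euclidean_space set \<Rightarrow> 'e set \<Rightarrow> ('e \<Rightarrow> 'f::real_normed_vector) \<Rightarrow> bool"
  where "smooth_on H S f \<longleftrightarrow> (\<forall>k. Ck_on k H S f)"

text \<open>The underlying space of a manifold is the whole topological type \<open>'m\<close>, which is required
  to be Hausdorff and second countable.\<close>

record ('m, 'e) manifold =
  model_space :: "'e set"
  atlas :: "('m set \<times> ('m \<Rightarrow> 'e)) set"

definition smooth_manifold ::
    "('m::{t2_space,second_countable_topology}, 'e::euclidean_space, 'z) manifold_scheme \<Rightarrow> bool"
  where "smooth_manifold M \<longleftrightarrow>
    subspace (model_space M) \<and>
    \<Union>(fst ` atlas M) = UNIV \<and>
    (\<forall>(U, \<phi>)\<in>atlas M. open U \<and> openin (top_of_set (model_space M)) (\<phi> ` U) \<and>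
       homeomorphism U (\<phi> ` U) \<phi> (inv_into U \<phi>)) \<and>
    (\<forall>(U, \<phi>)\<in>atlas M. \<forall>(V, \<psi>)\<in>atlas M.
       smooth_on (model_space M) (\<phi> ` (U \<inter> V)) (\<psi> \<circ> inv_into U \<phi>))"

definition smooth_fun_on ::
    "('m::{t2_space,second_countable_topology}, 'e::euclidean_space, 'z) manifold_scheme
      \<Rightarrow> 'm set \<Rightarrow> ('m \<Rightarrow> real) \<Rightarrow> bool"
  where "smooth_fun_on M W f \<longleftrightarrow>
    (\<forall>(U, \<phi>)\<in>atlas M. smooth_on (model_space M) (\<phi> ` (U \<inter> W)) (f \<circ> inv_into U \<phi>))"

definition smooth_funs ::
    "('m::{t2_space,second_countable_topology}, 'e::euclidean_space, 'z) manifold_scheme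
      \<Rightarrow> ('m \<Rightarrow> real) set"
  where "smooth_funs M = {f. smooth_fun_on M UNIV f}"

text \<open>Tangent vectors at \<open>x\<close>, as derivations at \<open>x\<close> of the algebra of smooth functions; their
  values on non-smooth functions are irrelevant.\<close>

definition tangent_space ::
    "('m::{t2_space,second_countable_topology}, 'e::euclidean_space, 'z) manifold_scheme
      \<Rightarrow> 'm \<Rightarrow> (('m \<Rightarrow> real) \<Rightarrow> real) set"
  where "tangent_space M x = {D.
    (\<forall>f\<in>smooth_funs M. \<forall>g\<in>smooth_funs M.
       D (\<lambda>y. f y + g y) = D f + D g \<and>
       D (\<lambda>y. f y * g y) = D f * g x + f x * D g) \<and>
    (\<forall>c. \<forall>f\<in>smooth_funs M. D (\<lambda>y. c * f y) = c * D f)}"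


section \<open>Vector bundles\<close>

text \<open>The fibres are finite-dimensional subspaces of one real vector space \<open>'v\<close>. This is no
  restriction: any family of vector spaces embeds into its direct sum, and nothing relates the
  linear structure of \<open>'v\<close> to the smooth structure, which is carried by local frames (that is,
  local trivialisations) with smooth transition functions.\<close>

record ('m, 'e, 'v) vbundle = "('m, 'e) manifold" +
  fibre_dim :: nat
  fibre :: "'m \<Rightarrow> 'v set"
  local_frames :: "('m set \<times> (nat \<Rightarrow> 'm \<Rightarrow> 'v)) set"

definition is_basis :: "nat \<Rightarrow> (nat \<Rightarrow> 'v::real_vector) \<Rightarrow> 'v set \<Rightarrow> bool"
  where "is_basis r b W \<longleftrightarrow>
    inj_on b {..<r} \<and> independent (b ` {..<r}) \<and> span (b ` {..<r}) = W"

definition vector_bundle ::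
    "('m::{t2_space,second_countable_topology}, 'e::euclidean_space, 'v::real_vector, 'z)
      vbundle_scheme \<Rightarrow> bool"
  where "vector_bundle A \<longleftrightarrow>
    smooth_manifold A \<and>
    \<Union>(fst ` local_frames A) = UNIV \<and>
    (\<forall>(U, e)\<in>local_frames A. open U \<and>
       (\<forall>x\<in>U. is_basis (fibre_dim A) (\<lambda>i. e i x) (fibre A x))) \<and>
    (\<forall>(U, e)\<in>local_frames A. \<forall>(V, f)\<in>local_frames A. \<exists>g.
       (\<forall>i<fibre_dim A. \<forall>j<fibre_dim A. smooth_fun_on A (U \<inter> V) (g i j)) \<and>
       (\<forall>x\<in>U \<inter> V. \<forall>j<fibre_dim A. f j x = (\<Sum>i<fibre_dim A. g i j x *\<^sub>R e i x)))"

definition sections_on ::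
    "('m::{t2_space,second_countable_topology}, 'e::euclidean_space, 'v::real_vector, 'z)
      vbundle_scheme \<Rightarrow> 'm set \<Rightarrow> ('m \<Rightarrow> 'v) set"
  where "sections_on A W = {X. (\<forall>x\<in>W. X x \<in> fibre A x) \<and>
    (\<forall>(U, e)\<in>local_frames A. \<exists>c.
       (\<forall>i<fibre_dim A. smooth_fun_on A (U \<inter> W) (c i)) \<and>
       (\<forall>x\<in>U \<inter> W. X x = (\<Sum>i<fibre_dim A. c i x *\<^sub>R e i x)))}"

abbreviation sections where "sections A \<equiv> sections_on A UNIV"

text \<open>A covector at \<open>x\<close> is a linear functional on the fibre at \<open>x\<close>, extended by 0 outside the
  fibre so that equality of covectors is equality of functions.\<close>

definition dual_fibre ::
    "('m, 'e, 'v::real_vector, 'z) vbundle_scheme \<Rightarrow> 'm \<Rightarrow> ('v \<Rightarrow> real) set"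
  where "dual_fibre A x = {\<xi>.
    (\<forall>u\<in>fibre A x. \<forall>v\<in>fibre A x. \<xi> (u + v) = \<xi> u + \<xi> v) \<and>
    (\<forall>c. \<forall>v\<in>fibre A x. \<xi> (c *\<^sub>R v) = c * \<xi> v) \<and>
    (\<forall>v. v \<notin> fibre A x \<longrightarrow> \<xi> v = 0)}"

definition dual_sections_on ::
    "('m::{t2_space,second_countable_topology}, 'e::euclidean_space, 'v::real_vector, 'z)
      vbundle_scheme \<Rightarrow> 'm set \<Rightarrow> ('m \<Rightarrow> 'v \<Rightarrow> real) set"
  where "dual_sections_on A W = {\<xi>. (\<forall>x\<in>W. \<xi> x \<in> dual_fibre A x) \<and>
    (\<forall>(U, e)\<in>local_frames A. \<forall>i<fibre_dim A. smooth_fun_on A (U \<inter> W) (\<lambda>x. \<xi> x (e i x)))}"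

abbreviation dual_sections where "dual_sections A \<equiv> dual_sections_on A UNIV"

definition pairing :: "('m \<Rightarrow> 'v \<Rightarrow> real) \<Rightarrow> ('m \<Rightarrow> 'v) \<Rightarrow> 'm \<Rightarrow> real"
  where "pairing \<xi> X = (\<lambda>x. \<xi> x (X x))"

text \<open>The section of the dual bundle corresponding to a function-linear map \<open>F\<close> from sections to
  smooth functions.\<close>

definition dual_section_of ::
    "('m::{t2_space,second_countable_topology}, 'e::euclidean_space, 'v::real_vector, 'z)
      vbundle_scheme \<Rightarrow> (('m \<Rightarrow> 'v) \<Rightarrow> 'm \<Rightarrow> real) \<Rightarrow> 'm \<Rightarrow> 'v \<Rightarrow> real"
  where "dual_section_of A F = (\<lambda>x v.
    if v \<in> fibre A x then THE c. \<forall>V\<in>sections A. V x = v \<longrightarrow> F V x = c else 0)"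


section \<open>Lie algebroids\<close>

record ('m, 'e, 'v) algebroid = "('m, 'e, 'v) vbundle" +
  bracket :: "('m \<Rightarrow> 'v) \<Rightarrow> ('m \<Rightarrow> 'v) \<Rightarrow> 'm \<Rightarrow> 'v"
  anchor :: "'m \<Rightarrow> 'v \<Rightarrow> ('m \<Rightarrow> real) \<Rightarrow> real"

text \<open>\<open>anchor A x a f\<close> is the derivative of \<open>f\<close> along the tangent vector at \<open>x\<close> that is the image
  of \<open>a\<close> under the anchor.\<close>

definition anchor_action ::
    "('m, 'e, 'v) algebroid \<Rightarrow> ('m \<Rightarrow> 'v) \<Rightarrow> ('m \<Rightarrow> real) \<Rightarrow> 'm \<Rightarrow> real"
  where "anchor_action A X f = (\<lambda>x. anchor A x (X x) f)"

definition lie_algebroid ::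
    "('m::{t2_space,second_countable_topology}, 'e::euclidean_space, 'v::real_vector) algebroid
      \<Rightarrow> bool"
  where "lie_algebroid A \<longleftrightarrow>
    vector_bundle A \<and>
    \<comment> \<open>the anchor is a smooth bundle map to the tangent bundle\<close>
    (\<forall>x. \<forall>a\<in>fibre A x. anchor A x a \<in> tangent_space A x) \<and>
    (\<forall>x. \<forall>a\<in>fibre A x. \<forall>b\<in>fibre A x. \<forall>c. \<forall>f\<in>smooth_funs A.
       anchor A x (a + b) f = anchor A x a f + anchor A x b f \<and>
       anchor A x (c *\<^sub>R a) f = c * anchor A x a f) \<and>
    (\<forall>X\<in>sections A. \<forall>f\<in>smooth_funs A. anchor_action A X f \<in> smooth_funs A) \<and>
    \<comment> \<open>the bracket is a real Lie bracket on sections\<close>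
    (\<forall>X\<in>sections A. \<forall>Y\<in>sections A. bracket A X Y \<in> sections A) \<and>
    (\<forall>X\<in>sections A. \<forall>Y\<in>sections A. \<forall>Z\<in>sections A. \<forall>c.
       bracket A (\<lambda>x. X x + Y x) Z = (\<lambda>x. bracket A X Z x + bracket A Y Z x) \<and>
       bracket A (\<lambda>x. c *\<^sub>R X x) Z = (\<lambda>x. c *\<^sub>R bracket A X Z x)) \<and>
    (\<forall>X\<in>sections A. \<forall>Y\<in>sections A. bracket A X Y = (\<lambda>x. - bracket A Y X x)) \<and>
    (\<forall>X\<in>sections A. \<forall>Y\<in>sections A. \<forall>Z\<in>sections A. \<forall>x.
       bracket A X (bracket A Y Z) x + bracket A Y (bracket A Z X) x
         + bracket A Z (bracket A X Y) x = 0) \<and>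
    \<comment> \<open>Leibniz rule\<close>
    (\<forall>X\<in>sections A. \<forall>Y\<in>sections A. \<forall>f\<in>smooth_funs A.
       bracket A X (\<lambda>x. f x *\<^sub>R Y x) =
         (\<lambda>x. f x *\<^sub>R bracket A X Y x + anchor_action A X f x *\<^sub>R Y x))"

definition d_form :: "('m, 'e, 'v) algebroid \<Rightarrow> ('m \<Rightarrow> 'v \<Rightarrow> real)
    \<Rightarrow> ('m \<Rightarrow> 'v) \<Rightarrow> ('m \<Rightarrow> 'v) \<Rightarrow> 'm \<Rightarrow> real"
  where "d_form A \<xi> X Y = (\<lambda>x.
    anchor_action A X (pairing \<xi> Y) x - anchor_action A Y (pairing \<xi> X) x
      - pairing \<xi> (bracket A X Y) x)"

definition i_d_form ::
    "('m::{t2_space,second_countable_topology}, 'e::euclidean_space, 'v::real_vector) algebroid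
      \<Rightarrow> ('m \<Rightarrow> 'v) \<Rightarrow> ('m \<Rightarrow> 'v \<Rightarrow> real) \<Rightarrow> 'm \<Rightarrow> 'v \<Rightarrow> real"
  where "i_d_form A X \<xi> = dual_section_of A (\<lambda>V. d_form A \<xi> X V)"

text \<open>The differential of a function \<open>f\<close> is \<open>V \<mapsto> anchor_action A V f\<close>.\<close>

definition d_fun ::
    "('m::{t2_space,second_countable_topology}, 'e::euclidean_space, 'v::real_vector) algebroid
      \<Rightarrow> ('m \<Rightarrow> real) \<Rightarrow> 'm \<Rightarrow> 'v \<Rightarrow> real"
  where "d_fun A f = dual_section_of A (\<lambda>V. anchor_action A V f)"

text \<open>The graded commutator of the contraction with \<open>X\<close> and the differential, on 1-forms.\<close>

definition lie_derivative ::
    "('m::{t2_space,second_countable_topology}, 'e::euclidean_space, 'v::real_vector) algebroid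
      \<Rightarrow> ('m \<Rightarrow> 'v) \<Rightarrow> ('m \<Rightarrow> 'v \<Rightarrow> real) \<Rightarrow> 'm \<Rightarrow> 'v \<Rightarrow> real"
  where "lie_derivative A X \<eta> = (\<lambda>x v. i_d_form A X \<eta> x v + d_fun A (pairing \<eta> X) x v)"


section \<open>Bivectors and Poisson structures\<close>

text \<open>A section of the second exterior power, as a smooth field of alternating bilinear forms on
  the dual fibres. Values at arguments outside the dual fibres are irrelevant.\<close>

definition bivector ::
    "('m::{t2_space,second_countable_topology}, 'e::euclidean_space, 'v::real_vector) algebroid
      \<Rightarrow> ('m \<Rightarrow> ('v \<Rightarrow> real) \<Rightarrow> ('v \<Rightarrow> real) \<Rightarrow> real) \<Rightarrow> bool"
  where "bivector A \<pi> \<longleftrightarrow>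
    (\<forall>x. \<forall>\<xi>\<in>dual_fibre A x. \<forall>\<xi>'\<in>dual_fibre A x. \<forall>\<eta>\<in>dual_fibre A x. \<forall>c.
       \<pi> x (\<lambda>v. \<xi> v + \<xi>' v) \<eta> = \<pi> x \<xi> \<eta> + \<pi> x \<xi>' \<eta> \<and>
       \<pi> x (\<lambda>v. c * \<xi> v) \<eta> = c * \<pi> x \<xi> \<eta> \<and>
       \<pi> x \<xi> \<eta> = - \<pi> x \<eta> \<xi>) \<and>
    (\<forall>\<xi>\<in>dual_sections A. \<forall>\<eta>\<in>dual_sections A. (\<lambda>x. \<pi> x (\<xi> x) (\<eta> x)) \<in> smooth_funs A)"

definition sharp :: "('m, 'e, 'v::real_vector) algebroid
    \<Rightarrow> ('m \<Rightarrow> ('v \<Rightarrow> real) \<Rightarrow> ('v \<Rightarrow> real) \<Rightarrow> real) \<Rightarrow> 'm \<Rightarrow> ('v \<Rightarrow> real) \<Rightarrow> 'v"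
  where "sharp A \<pi> x \<xi> =
    (THE a. a \<in> fibre A x \<and> (\<forall>\<eta>\<in>dual_fibre A x. \<eta> a = \<pi> x \<xi> \<eta>))"

definition sharp_section :: "('m, 'e, 'v::real_vector) algebroid
    \<Rightarrow> ('m \<Rightarrow> ('v \<Rightarrow> real) \<Rightarrow> ('v \<Rightarrow> real) \<Rightarrow> real) \<Rightarrow> ('m \<Rightarrow> 'v \<Rightarrow> real) \<Rightarrow> 'm \<Rightarrow> 'v"
  where "sharp_section A \<pi> \<xi> = (\<lambda>x. sharp A \<pi> x (\<xi> x))"

definition non_degenerate :: "('m, 'e, 'v::real_vector) algebroid
    \<Rightarrow> ('m \<Rightarrow> ('v \<Rightarrow> real) \<Rightarrow> ('v \<Rightarrow> real) \<Rightarrow> real) \<Rightarrow> bool"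
  where "non_degenerate A \<pi> \<longleftrightarrow> (\<forall>x. bij_betw (sharp A \<pi> x) (dual_fibre A x) (fibre A x))"

definition wedge2 :: "'v \<Rightarrow> 'v \<Rightarrow> ('v \<Rightarrow> real) \<Rightarrow> ('v \<Rightarrow> real) \<Rightarrow> real"
  where "wedge2 a b \<xi> \<eta> = \<xi> a * \<eta> b - \<xi> b * \<eta> a"

definition wedge3 :: "'v \<Rightarrow> 'v \<Rightarrow> 'v \<Rightarrow> ('v \<Rightarrow> real) \<Rightarrow> ('v \<Rightarrow> real) \<Rightarrow> ('v \<Rightarrow> real) \<Rightarrow> real"
  where "wedge3 a b c \<xi> \<eta> \<zeta> =
    \<xi> a * wedge2 b c \<eta> \<zeta> - \<eta> a * wedge2 b c \<xi> \<zeta> + \<zeta> a * wedge2 b c \<xi> \<eta>"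

text \<open>The Schouten-Nijenhuis bracket of two bivectors. On decomposable bivectors it is given by
    \[ [X_1 \wedge X_2, Y_1 \wedge Y_2] =
       \sum_{i,j} (-1)^{i+j} [X_i, Y_j] \wedge X_{3-i} \wedge Y_{3-j}, \]
  and it extends to all bivectors by additivity and locality, since near any point a bivector is a
  finite sum of decomposable ones.\<close>

definition schouten_decomposable ::
    "('m, 'e, 'v) algebroid \<Rightarrow> ('m \<Rightarrow> 'v) \<times> ('m \<Rightarrow> 'v) \<Rightarrow> ('m \<Rightarrow> 'v) \<times> ('m \<Rightarrow> 'v)
      \<Rightarrow> 'm \<Rightarrow> ('v \<Rightarrow> real) \<Rightarrow> ('v \<Rightarrow> real) \<Rightarrow> ('v \<Rightarrow> real) \<Rightarrow> real"
  where "schouten_decomposable A P Q x \<xi> \<eta> \<zeta> =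
    (case (P, Q) of ((X1, X2), (Y1, Y2)) \<Rightarrow>
         wedge3 (bracket A X1 Y1 x) (X2 x) (Y2 x) \<xi> \<eta> \<zeta>
       - wedge3 (bracket A X1 Y2 x) (X2 x) (Y1 x) \<xi> \<eta> \<zeta>
       - wedge3 (bracket A X2 Y1 x) (X1 x) (Y2 x) \<xi> \<eta> \<zeta>
       + wedge3 (bracket A X2 Y2 x) (X1 x) (Y1 x) \<xi> \<eta> \<zeta>)"

definition decomposes_on ::
    "('m::{t2_space,second_countable_topology}, 'e::euclidean_space, 'v::real_vector) algebroid
      \<Rightarrow> 'm set \<Rightarrow> ('m \<Rightarrow> ('v \<Rightarrow> real) \<Rightarrow> ('v \<Rightarrow> real) \<Rightarrow> real)
      \<Rightarrow> (('m \<Rightarrow> 'v) \<times> ('m \<Rightarrow> 'v)) list \<Rightarrow> bool"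
  where "decomposes_on A U \<pi> ps \<longleftrightarrow>
    set ps \<subseteq> sections A \<times> sections A \<and>
    (\<forall>x\<in>U. \<forall>\<xi>\<in>dual_fibre A x. \<forall>\<eta>\<in>dual_fibre A x.
       \<pi> x \<xi> \<eta> = (\<Sum>(X, Y)\<leftarrow>ps. wedge2 (X x) (Y x) \<xi> \<eta>))"

definition schouten ::
    "('m::{t2_space,second_countable_topology}, 'e::euclidean_space, 'v::real_vector) algebroid
      \<Rightarrow> ('m \<Rightarrow> ('v \<Rightarrow> real) \<Rightarrow> ('v \<Rightarrow> real) \<Rightarrow> real)
      \<Rightarrow> ('m \<Rightarrow> ('v \<Rightarrow> real) \<Rightarrow> ('v \<Rightarrow> real) \<Rightarrow> real)
      \<Rightarrow> 'm \<Rightarrow> ('v \<Rightarrow> real) \<Rightarrow> ('v \<Rightarrow> real) \<Rightarrow> ('v \<Rightarrow> real) \<Rightarrow> real"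
  where "schouten A \<pi> \<pi>' x \<xi> \<eta> \<zeta> =
    (THE s. \<exists>U ps qs. open U \<and> x \<in> U \<and> decomposes_on A U \<pi> ps \<and> decomposes_on A U \<pi>' qs \<and>
       s = (\<Sum>P\<leftarrow>ps. \<Sum>Q\<leftarrow>qs. schouten_decomposable A P Q x \<xi> \<eta> \<zeta>))"

definition poisson ::
    "('m::{t2_space,second_countable_topology}, 'e::euclidean_space, 'v::real_vector) algebroid
      \<Rightarrow> ('m \<Rightarrow> ('v \<Rightarrow> real) \<Rightarrow> ('v \<Rightarrow> real) \<Rightarrow> real) \<Rightarrow> bool"
  where "poisson A \<pi> \<longleftrightarrow> bivector A \<pi> \<and>
    (\<forall>x. \<forall>\<xi>\<in>dual_fibre A x. \<forall>\<eta>\<in>dual_fibre A x. \<forall>\<zeta>\<in>dual_fibre A x.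
       schouten A \<pi> \<pi> x \<xi> \<eta> \<zeta> = 0)"

definition hamiltonian_pair ::
    "('m::{t2_space,second_countable_topology}, 'e::euclidean_space, 'v::real_vector) algebroid
      \<Rightarrow> ('m \<Rightarrow> ('v \<Rightarrow> real) \<Rightarrow> ('v \<Rightarrow> real) \<Rightarrow> real)
      \<Rightarrow> ('m \<Rightarrow> ('v \<Rightarrow> real) \<Rightarrow> ('v \<Rightarrow> real) \<Rightarrow> real) \<Rightarrow> bool"
  where "hamiltonian_pair A \<pi> \<pi>' \<longleftrightarrow>
    poisson A \<pi> \<and> poisson A \<pi>' \<and> poisson A (\<lambda>x \<xi> \<eta>. \<pi> x \<xi> \<eta> + \<pi>' x \<xi> \<eta>)"


section \<open>Dirac structures\<close>

definition bivector_graph :: "('m, 'e, 'v::real_vector) algebroid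
    \<Rightarrow> ('m \<Rightarrow> ('v \<Rightarrow> real) \<Rightarrow> ('v \<Rightarrow> real) \<Rightarrow> real) \<Rightarrow> 'm \<Rightarrow> ('v \<times> ('v \<Rightarrow> real)) set"
  where "bivector_graph A \<pi> x = {(sharp A \<pi> x \<xi>, \<xi>) |\<xi>. \<xi> \<in> dual_fibre A x}"

definition sum_pairing :: "'v \<times> ('v \<Rightarrow> real) \<Rightarrow> 'v \<times> ('v \<Rightarrow> real) \<Rightarrow> real"
  where "sum_pairing p q = snd p (fst q) + snd q (fst p)"

definition isotropic_subspace ::
    "('m, 'e, 'v::real_vector) algebroid \<Rightarrow> 'm \<Rightarrow> ('v \<times> ('v \<Rightarrow> real)) set \<Rightarrow> bool"
  where "isotropic_subspace A x L \<longleftrightarrow>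
    L \<subseteq> fibre A x \<times> dual_fibre A x \<and>
    (0, \<lambda>v. 0) \<in> L \<and>
    (\<forall>(a, \<xi>)\<in>L. \<forall>(b, \<eta>)\<in>L. (a + b, \<lambda>v. \<xi> v + \<eta> v) \<in> L) \<and>
    (\<forall>c. \<forall>(a, \<xi>)\<in>L. (c *\<^sub>R a, \<lambda>v. c * \<xi> v) \<in> L) \<and>
    (\<forall>p\<in>L. \<forall>q\<in>L. sum_pairing p q = 0)"

text \<open>A smooth subbundle of the direct sum of the bundle and its dual: near each point there is a
  frame of smooth local sections, of constant rank \<open>k\<close>.\<close>

definition subbundle ::
    "('m::{t2_space,second_countable_topology}, 'e::euclidean_space, 'v::real_vector) algebroid
      \<Rightarrow> ('m \<Rightarrow> ('v \<times> ('v \<Rightarrow> real)) set) \<Rightarrow> bool"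
  where "subbundle A L \<longleftrightarrow>
    (\<exists>k. \<forall>x. \<exists>U X \<xi>. open U \<and> x \<in> U \<and>
       (\<forall>i<k::nat. X i \<in> sections_on A U \<and> \<xi> i \<in> dual_sections_on A U) \<and>
       (\<forall>y\<in>U. L y = range (\<lambda>c::nat \<Rightarrow> real.
                  (\<Sum>i<k. c i *\<^sub>R X i y, \<lambda>v. \<Sum>i<k. c i * \<xi> i y v)) \<and>
         (\<forall>c::nat \<Rightarrow> real.
            (\<Sum>i<k. c i *\<^sub>R X i y) = 0 \<and> (\<forall>v. (\<Sum>i<k. c i * \<xi> i y v) = 0)
            \<longrightarrow> (\<forall>i<k. c i = 0))))"

definition subbundle_sections ::
    "('m::{t2_space,second_countable_topology}, 'e::euclidean_space, 'v::real_vector) algebroid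
      \<Rightarrow> ('m \<Rightarrow> ('v \<times> ('v \<Rightarrow> real)) set) \<Rightarrow> (('m \<Rightarrow> 'v) \<times> ('m \<Rightarrow> 'v \<Rightarrow> real)) set"
  where "subbundle_sections A L =
    {(X, \<xi>). X \<in> sections A \<and> \<xi> \<in> dual_sections A \<and> (\<forall>x. (X x, \<xi> x) \<in> L x)}"

definition dorfman ::
    "('m::{t2_space,second_countable_topology}, 'e::euclidean_space, 'v::real_vector) algebroid
      \<Rightarrow> ('m \<Rightarrow> 'v) \<times> ('m \<Rightarrow> 'v \<Rightarrow> real) \<Rightarrow> ('m \<Rightarrow> 'v) \<times> ('m \<Rightarrow> 'v \<Rightarrow> real)
      \<Rightarrow> ('m \<Rightarrow> 'v) \<times> ('m \<Rightarrow> 'v \<Rightarrow> real)"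
  where "dorfman A p q = (case (p, q) of ((X, \<xi>), (Y, \<eta>)) \<Rightarrow>
    (bracket A X Y, \<lambda>x v. lie_derivative A X \<eta> x v - i_d_form A Y \<xi> x v))"

definition dirac_structure ::
    "('m::{t2_space,second_countable_topology}, 'e::euclidean_space, 'v::real_vector) algebroid
      \<Rightarrow> ('m \<Rightarrow> ('v \<times> ('v \<Rightarrow> real)) set) \<Rightarrow> bool"
  where "dirac_structure A L \<longleftrightarrow>
    subbundle A L \<and>
    (\<forall>x. isotropic_subspace A x (L x) \<and>
       (\<forall>L'. isotropic_subspace A x L' \<and> L x \<subseteq> L' \<longrightarrow> L' = L x)) \<and>
    (\<forall>p\<in>subbundle_sections A L. \<forall>q\<in>subbundle_sections A L.
       dorfman A p q \<in> subbundle_sections A L)"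


section \<open>Nijenhuis relations, Poisson pairs and Dirac pairs\<close>

definition dual_relation ::
    "('m::{t2_space,second_countable_topology}, 'e::euclidean_space, 'v::real_vector) algebroid
      \<Rightarrow> (('m \<Rightarrow> 'v) \<times> ('m \<Rightarrow> 'v)) set \<Rightarrow> (('m \<Rightarrow> 'v \<Rightarrow> real) \<times> ('m \<Rightarrow> 'v \<Rightarrow> real)) set"
  where "dual_relation A N = {(\<beta>, \<alpha>). \<beta> \<in> dual_sections A \<and> \<alpha> \<in> dual_sections A \<and>
    (\<forall>(u, v)\<in>N. pairing \<alpha> u = pairing \<beta> v)}"

definition nijenhuis_relation ::
    "('m::{t2_space,second_countable_topology}, 'e::euclidean_space, 'v::real_vector) algebroid
      \<Rightarrow> (('m \<Rightarrow> 'v) \<times> ('m \<Rightarrow> 'v)) set \<Rightarrow> bool"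
  where "nijenhuis_relation A N \<longleftrightarrow>
    N \<subseteq> sections A \<times> sections A \<and>
    (\<forall>u1 v1 u2 v2 \<alpha> \<alpha>' \<alpha>''.
       (u1, v1) \<in> N \<and> (u2, v2) \<in> N \<and>
       (\<alpha>, \<alpha>') \<in> dual_relation A N \<and> (\<alpha>', \<alpha>'') \<in> dual_relation A N \<longrightarrow>
       (\<forall>x. pairing \<alpha> (bracket A v1 v2) x
          - pairing \<alpha>' (\<lambda>y. bracket A v1 u2 y + bracket A u1 v2 y) x
          + pairing \<alpha>'' (bracket A u1 u2) x = 0))"

definition poisson_pair ::
    "('m::{t2_space,second_countable_topology}, 'e::euclidean_space, 'v::real_vector) algebroid
      \<Rightarrow> ('m \<Rightarrow> ('v \<Rightarrow> real) \<Rightarrow> ('v \<Rightarrow> real) \<Rightarrow> real)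
      \<Rightarrow> ('m \<Rightarrow> ('v \<Rightarrow> real) \<Rightarrow> ('v \<Rightarrow> real) \<Rightarrow> real) \<Rightarrow> bool"
  where "poisson_pair A \<pi> \<pi>' \<longleftrightarrow> poisson A \<pi> \<and> poisson A \<pi>' \<and>
    nijenhuis_relation A
      {(sharp_section A \<pi>' \<xi>, sharp_section A \<pi> \<xi>) |\<xi>. \<xi> \<in> dual_sections A}"

definition dirac_pair ::
    "('m::{t2_space,second_countable_topology}, 'e::euclidean_space, 'v::real_vector) algebroid
      \<Rightarrow> ('m \<Rightarrow> ('v \<times> ('v \<Rightarrow> real)) set) \<Rightarrow> ('m \<Rightarrow> ('v \<times> ('v \<Rightarrow> real)) set) \<Rightarrow> bool"
  where "dirac_pair A L L' \<longleftrightarrow> dirac_structure A L \<and> dirac_structure A L' \<and>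
    nijenhuis_relation A
      {(x, y). x \<in> sections A \<and> y \<in> sections A \<and>
         (\<exists>\<xi>\<in>dual_sections A.
            (x, \<xi>) \<in> subbundle_sections A L' \<and> (y, \<xi>) \<in> subbundle_sections A L)}"

end

(* Write P, P' for the sharp maps of pi, pi' and, for 1-forms xi, eta, zeta, let J(P, Q) be the cyclic sum
   of <zeta, [P xi, Q eta]> + (P xi).<eta, Q zeta>. Expanding both sides with the Leibniz rule on wedge
   products of sections gives [pi, pi'](xi, eta, zeta) = J(P, P') + J(P', P), hence by additivity and locality
   for all bivectors; in particular pi is Poisson iff J(P, P) = 0. Since J(P, P) also equals
   <zeta, X - P sigma>, where X + sigma is the Dorfman bracket of P xi + xi and
   P eta + eta, this says that the graph of pi is closed under the Dorfman bracket. The two relations in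
   Poisson and Dirac pairs coincide, whence (i).
   A pair (alpha, alpha') lies in the dual relation iff P' alpha' = P alpha, and then the Nijenhuis expression
   is J(P, P)(xi, eta, alpha) - [pi, pi'](xi, eta, alpha') + J(P', P')(xi, eta, alpha''). So [pi, pi'] = 0
   implies the Nijenhuis condition; conversely, in the non-degenerate case every covector at a point is the
   value of some alpha' that extends to such a chain alpha, alpha', alpha''. *)

theory Submission
  imports Defs "Jordan_Normal_Form.Determinant"
begin

section \<open>Smooth functions\<close>

text \<open>Bracket, anchor and Nijenhuis relations speak of global sections, whereas graphs,
  non-degeneracy and the Schouten bracket are tested at points. Bump functions mediate between the
  two: they make local frames global, extend covectors at a point to sections, and show that
  brackets and derivatives are local and that function-linear maps act pointwise. The Schouten
  bracket is a definite description over all local decompositions, so its value must be shown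
  independent of the decomposition. The cyclic sum does this, since it refers to a bivector only
  through its sharp map; symmetrizing it in the two maps makes the derivatives of the forms cancel.
  In the non-degenerate case a chain needs global smooth preimages under both sharp maps. Instead of
  inverting them, Cramer's rule is used without division: for each point x there are smooth
  functions D and D', non-zero at x, such that D X and D' X have preimages for every section X. A
  form with the factor D D' then extends to a chain, and it can be normalized at x because the
  Schouten bracket sees only values at x.\<close>

lemma Ck_on_cong:
  assumes "\<And>x. x \<in> S \<Longrightarrow> f x = g x" and "Ck_on k H S f"
  shows "Ck_on k H S g"
proof (cases k)
  case 0
  then show ?thesis using assms continuous_on_cong[of S S f g] by simp
next
  case (Suc n)
  then obtain f' where f': "\<And>x. x \<in> S \<Longrightarrow> (f has_derivative f' x) (at x within S)"
    "\<forall>v\<in>H. Ck_on n H S (\<lambda>x. f' x v)"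
    using assms(2) by auto
  have "(g has_derivative f' x) (at x within S)" if "x \<in> S" for x
    using has_derivative_transform[OF that _ f'(1)[OF that], of g] assms(1) by auto
  then show ?thesis using f'(2) Suc by auto
qed

lemma Ck_on_subset:
  "Ck_on k H S f \<Longrightarrow> T \<subseteq> S \<Longrightarrow> Ck_on k H T f"
proof (induction k arbitrary: f)
  case 0
  then show ?case by (auto intro: continuous_on_subset)
next
  case (Suc k)
  then show ?case by simp (meson has_derivative_subset subsetD)
qed

lemma Ck_on_SucD: "Ck_on (Suc k) H S f \<Longrightarrow> Ck_on k H S f"
proof (induction k arbitrary: f)
  case 0
  then show ?case by (auto intro: has_derivative_continuous_on)
next
  case (Suc k)
  from Suc.prems obtain f' where f': "\<And>x. x \<in> S \<Longrightarrow> (f has_derivative f' x) (at x within S)"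
    "\<And>v. v \<in> H \<Longrightarrow> Ck_on (Suc k) H S (\<lambda>x. f' x v)"
    by auto
  have "\<And>v. v \<in> H \<Longrightarrow> Ck_on k H S (\<lambda>x. f' x v)" using Suc.IH f'(2) by blast
  then show ?case using f'(1) by auto
qed

lemma Ck_on_const: "Ck_on k H S (\<lambda>x. c)"
proof (induction k arbitrary: c)
  case (Suc k)
  have "\<forall>x\<in>S. ((\<lambda>x. c) has_derivative (\<lambda>v. 0)) (at x within S)" by auto
  then show ?case using Suc by (auto intro!: exI[of _ "\<lambda>x v. 0"])
qed simp

lemma Ck_on_add:
  "Ck_on k H S f \<Longrightarrow> Ck_on k H S g \<Longrightarrow> Ck_on k H S (\<lambda>x. f x + g x)"
proof (induction k arbitrary: f g)
  case 0
  then show ?case by (auto intro: continuous_intros)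
next
  case (Suc k)
  from Suc.prems obtain f' g' where
    f': "\<forall>x\<in>S. (f has_derivative f' x) (at x within S)" "\<forall>v\<in>H. Ck_on k H S (\<lambda>x. f' x v)" and
    g': "\<forall>x\<in>S. (g has_derivative g' x) (at x within S)" "\<forall>v\<in>H. Ck_on k H S (\<lambda>x. g' x v)"
    by auto
  have "\<forall>x\<in>S. ((\<lambda>x. f x + g x) has_derivative (\<lambda>v. f' x v + g' x v)) (at x within S)"
    using f' g' by (auto intro: has_derivative_add)
  moreover have "\<forall>v\<in>H. Ck_on k H S (\<lambda>x. f' x v + g' x v)"
    using f' g' Suc.IH by auto
  ultimately show ?case by (auto intro!: exI[of _ "\<lambda>x v. f' x v + g' x v"])
qed

text \<open>The product rule leaves \<open>f\<close> and \<open>g\<close> themselves next to one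
  derivative, so the induction also needs them at order \<open>k\<close>, by
  \<open>Ck_on_SucD\<close>. A general bilinear map covers products of functions and inner products
  at once.\<close>

lemma Ck_on_bilinear:
  assumes "bounded_bilinear b"
  shows "Ck_on k H S f \<Longrightarrow> Ck_on k H S g \<Longrightarrow> Ck_on k H S (\<lambda>x. b (f x) (g x))"
proof (induction k arbitrary: f g)
  case 0
  then show ?case by (auto intro: bounded_bilinear.continuous_on[OF assms])
next
  case (Suc k)
  from Suc.prems obtain f' g' where
    f': "\<forall>x\<in>S. (f has_derivative f' x) (at x within S)" "\<forall>v\<in>H. Ck_on k H S (\<lambda>x. f' x v)" and
    g': "\<forall>x\<in>S. (g has_derivative g' x) (at x within S)" "\<forall>v\<in>H. Ck_on k H S (\<lambda>x. g' x v)"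
    by auto
  have "\<forall>x\<in>S. ((\<lambda>x. b (f x) (g x)) has_derivative (\<lambda>v. b (f x) (g' x v) + b (f' x v) (g x)))
      (at x within S)"
    using f' g' by (auto intro: bounded_bilinear.FDERIV[OF assms])
  moreover have "Ck_on k H S (\<lambda>x. b (f x) (g' x v) + b (f' x v) (g x))" if "v \<in> H" for v
    using f' g' Suc.IH Suc.prems[THEN Ck_on_SucD] that by (auto intro!: Ck_on_add)
  ultimately show ?case
    by (auto intro!: exI[of _ "\<lambda>x v. b (f x) (g' x v) + b (f' x v) (g x)"])
qed

text \<open>The chain rule turns \<open>d n\<close> into \<open>d (Suc n)\<close>, so a whole
  sequence of successive derivatives is fixed and the induction on the order runs for all
  \<open>n\<close> together.\<close>

lemma Ck_on_compose_real:
  fixes d :: "nat \<Rightarrow> real \<Rightarrow> real"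
  assumes "\<And>n t. (d n has_real_derivative d (Suc n) t) (at t)"
  shows "Ck_on k H S g \<Longrightarrow> Ck_on k H S (\<lambda>x. d n (g x))"
proof (induction k arbitrary: n)
  case 0
  have "continuous_on UNIV (d n)"
    using assms by (auto intro!: DERIV_continuous_on)
  then have "continuous_on (g ` S) (d n)" by (rule continuous_on_subset) simp
  then show ?case using 0 continuous_on_compose[of S g "d n"] by (auto simp: comp_def)
next
  case (Suc k)
  from Suc.prems obtain g' where
    g': "\<forall>x\<in>S. (g has_derivative g' x) (at x within S)" "\<forall>v\<in>H. Ck_on k H S (\<lambda>x. g' x v)"
    by auto
  have "\<forall>x\<in>S. ((\<lambda>x. d n (g x)) has_derivative (\<lambda>v. g' x v * d (Suc n) (g x))) (at x within S)"
    using g' assms by (auto intro: DERIV_compose_FDERIV)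
  moreover have "Ck_on k H S (\<lambda>x. g' x v * d (Suc n) (g x))" if "v \<in> H" for v
    using g' that Ck_on_SucD[OF Suc.prems]
    by (auto intro!: Ck_on_bilinear[OF bounded_bilinear_mult] Suc.IH)
  ultimately show ?case
    by (auto intro!: exI[of _ "\<lambda>x v. g' x v * d (Suc n) (g x)"])
qed

text \<open>Restrict \<open>f\<close> to the line through \<open>x\<close> in direction
  \<open>v\<close>: as \<open>S\<close> is relatively open in \<open>H\<close>, small parameters
  stay in \<open>S\<close>, and the derivative of a function of one real variable at an interior
  point is unique. Directions outside \<open>H\<close> are not controlled.\<close>

lemma has_derivative_unique_along:
  fixes f :: "'e::euclidean_space \<Rightarrow> 'f::real_normed_vector"
  assumes H: "subspace H" and S: "openin (top_of_set H) S" and x: "x \<in> S" and v: "v \<in> H"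
    and D1: "(f has_derivative D1) (at x within S)" and D2: "(f has_derivative D2) (at x within S)"
  shows "D1 v = D2 v"
proof -
  obtain W where W: "open W" "S = H \<inter> W" using S by (auto simp: openin_open)
  define p where "p t = x + t *\<^sub>R v" for t :: real
  have cont: "continuous_on UNIV p" unfolding p_def by (intro continuous_intros)
  have op: "open (p -` W)" "0 \<in> p -` W" "p ` (p -` W) \<subseteq> S"
    using W x v H cont by (auto simp: open_vimage p_def subspace_def)
  have dp: "(p has_derivative (\<lambda>t. t *\<^sub>R v)) (at 0 within p -` W)"
    unfolding p_def by (auto intro!: derivative_eq_intros)
  have "((\<lambda>t. f (p t)) has_derivative (\<lambda>t. D (t *\<^sub>R v))) (at 0)"
    if "(f has_derivative D) (at x within S)" for D
  proof -
    have "(f has_derivative D) (at (p 0) within p ` (p -` W))"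
      using has_derivative_subset[OF that op(3)] by (simp add: p_def)
    from has_derivative_in_compose[OF dp this] show ?thesis
      unfolding at_within_open[OF op(2,1)] .
  qed
  from has_derivative_unique[OF this[OF D1] this[OF D2]]
  have eq: "(\<lambda>t::real. D1 (t *\<^sub>R v)) = (\<lambda>t. D2 (t *\<^sub>R v))" .
  show ?thesis using fun_cong[OF eq, of 1] by simp
qed

lemma at_within_openin_eq:
  assumes "openin (top_of_set H) T" "T \<subseteq> S" "S \<subseteq> H" "x \<in> T"
  shows "at x within T = at x within S"
proof -
  obtain W where "open W" "T = H \<inter> W" using assms(1) by (auto simp: openin_open)
  moreover from this assms have "T \<inter> W - {x} = S \<inter> W - {x}" "x \<in> W" by auto
  ultimately show ?thesis using at_within_nhd by blast
qed

text \<open>\<open>Ck_on\<close> asserts that a derivative exists, so the local witnesses have to be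
  glued into one. The diagonal choice takes at each point the witness belonging to that
  point.\<close>

lemma Ck_on_local:
  assumes H: "subspace H"
    and "\<And>x. x \<in> S \<Longrightarrow> \<exists>T. openin (top_of_set H) T \<and> x \<in> T \<and> T \<subseteq> S \<and> Ck_on k H T f"
  shows "Ck_on k H S f"
  using assms(2)
proof (induction k arbitrary: f)
  case 0
  show ?case
    unfolding Ck_on.simps continuous_on_eq_continuous_within
  proof
    fix x assume x: "x \<in> S"
    obtain T where T: "openin (top_of_set H) T" "x \<in> T" "T \<subseteq> S" "continuous_on T f"
      using 0[OF x] by auto
    have "S \<subseteq> H" using 0 openin_subset by fastforce
    then have eq: "at x within T = at x within S"
      using T at_within_openin_eq by blast
    have "continuous (at x within T) f"
      using T by (simp add: continuous_on_eq_continuous_within)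
    then show "continuous (at x within S) f" by (simp only: eq)
  qed
next
  case (Suc k)
  define R where "R x T f' \<longleftrightarrow> openin (top_of_set H) T \<and> x \<in> T \<and> T \<subseteq> S \<and>
      (\<forall>y\<in>T. (f has_derivative f' y) (at y within T)) \<and> (\<forall>v\<in>H. Ck_on k H T (\<lambda>y. f' y v))"
    for x T f'
  have "\<exists>T f'. R x T f'" if "x \<in> S" for x
    using Suc.prems[OF that] unfolding R_def Ck_on.simps by blast
  then obtain T F where "\<And>x. x \<in> S \<Longrightarrow> R x (T x) (F x)"
    by metis
  then have T: "\<And>x. x \<in> S \<Longrightarrow> openin (top_of_set H) (T x)" "\<And>x. x \<in> S \<Longrightarrow> x \<in> T x"
      "\<And>x. x \<in> S \<Longrightarrow> T x \<subseteq> S"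
    and F: "\<And>x y. x \<in> S \<Longrightarrow> y \<in> T x \<Longrightarrow> (f has_derivative F x y) (at y within T x)"
      "\<And>x v. x \<in> S \<Longrightarrow> v \<in> H \<Longrightarrow> Ck_on k H (T x) (\<lambda>y. F x y v)"
    unfolding R_def by blast+
  have SH: "S \<subseteq> H"
  proof
    show "x \<in> H" if "x \<in> S" for x using openin_subset[OF T(1)[OF that]] T(2)[OF that] by auto
  qed
  have "(f has_derivative F x x) (at x within S)" if x: "x \<in> S" for x
  proof -
    have eq: "at x within T x = at x within S"
      by (rule at_within_openin_eq[OF T(1)[OF x] T(3)[OF x] SH T(2)[OF x]])
    show ?thesis using F(1)[OF x T(2)[OF x]] unfolding eq .
  qed
  moreover have "Ck_on k H S (\<lambda>x. F x x v)" if v: "v \<in> H" for v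
  proof (rule Suc.IH)
    fix x assume x: "x \<in> S"
    \<comment> \<open>The witnesses chosen at \<open>x\<close> and at \<open>y\<close> may differ,
      but on the overlap of their neighbourhoods they agree along \<open>H\<close>, and the next
      order of differentiability looks only there.\<close>
    have "F x y v = F y y v" if y: "y \<in> T x" for y
    proof -
      have yS: "y \<in> S" using T(3)[OF x] y by auto
      have "openin (top_of_set H) (T x \<inter> T y)" using T(1) x yS by blast
      moreover have "y \<in> T x \<inter> T y" using y T(2) yS by auto
      ultimately show ?thesis
        by (rule has_derivative_unique_along[OF H _ _ v
              has_derivative_subset[OF F(1)[OF x y] inf_le1]
              has_derivative_subset[OF F(1)[OF yS T(2)[OF yS]] inf_le2]])
    qed
    then have "Ck_on k H (T x) (\<lambda>x. F x x v)" by (rule Ck_on_cong[OF _ F(2)[OF x v]])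
    then show "\<exists>T. openin (top_of_set H) T \<and> x \<in> T \<and> T \<subseteq> S \<and> Ck_on k H T (\<lambda>x. F x x v)"
      using T(1)[OF x] T(2)[OF x] T(3)[OF x] by blast
  qed
  ultimately show ?case by (auto intro!: exI[of _ "\<lambda>x. F x x"])
qed

section \<open>Flat functions and a smooth step\<close>

lemma poly_over_exp_tendsto_0:
  "((\<lambda>s::real. poly p s / exp s) \<longlongrightarrow> 0) at_top"
proof (induction p)
  case 0
  then show ?case by simp
next
  case (pCons a p)
  have "((\<lambda>s. \<Sum>i\<le>degree (pCons a p). coeff (pCons a p) i * (s ^ i / exp s)) \<longlongrightarrow>
      (\<Sum>i\<le>degree (pCons a p). coeff (pCons a p) i * 0)) at_top"
    by (intro tendsto_sum tendsto_mult tendsto_const tendsto_power_div_exp_0)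
  then show ?case by (simp add: poly_altdef sum_divide_distrib)
qed

text \<open>The functions p(1/t) e^(-1/t), continued by 0 to t <= 0. With arbitrary polynomials p
  the family is closed under differentiation, as the chain rule for \<open>Ck_on\<close>
  requires.\<close>

definition flat_fun :: "real poly \<Rightarrow> real \<Rightarrow> real"
  where "flat_fun p t = (if t > 0 then poly p (1 / t) * exp (- (1 / t)) else 0)"

text \<open>With s = 1/t, the derivative of p(s) e^(-s) in t is s^2 (p(s) - p'(s)) e^(-s).\<close>

definition flat_deriv :: "real poly \<Rightarrow> real poly"
  where "flat_deriv p = [:0, 0, 1:] * (p - pderiv p)"

lemma flat_fun_has_derivative:
  "(flat_fun p has_real_derivative flat_fun (flat_deriv p) t) (at t)"
proof (cases t "0::real" rule: linorder_cases)
  case less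
  have "((\<lambda>t. 0) has_real_derivative flat_fun (flat_deriv p) t) (at t)"
    using less by (simp add: flat_fun_def)
  then show ?thesis
    using less by (elim has_field_derivative_transform_within_open[of _ _ _ "{..<0}"])
      (auto simp: flat_fun_def)
next
  case greater
  have "((\<lambda>t. poly p (1 / t) * exp (- (1 / t))) has_real_derivative flat_fun (flat_deriv p) t) (at t)"
    using greater
    by (auto intro!: derivative_eq_intros
      simp: flat_fun_def flat_deriv_def field_simps power2_eq_square)
  then show ?thesis
    using greater by (elim has_field_derivative_transform_within_open[of _ _ _ "{0<..}"])
      (auto simp: flat_fun_def)
next
  case equal
  have l: "((\<lambda>h. flat_fun p h / h) \<longlongrightarrow> 0) (at_left 0)"
  proof (rule tendsto_eventually)
    show "\<forall>\<^sub>F h in at_left 0. flat_fun p h / h = 0"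
      by (auto simp: eventually_at_filter flat_fun_def intro!: always_eventually)
  qed
  \<comment> \<open>With s = 1/h the difference quotient at 0 is s p(s) e^(-s), and
    \<open>pCons 0 p\<close> supplies the extra factor s.\<close>
  have "((\<lambda>h. poly (pCons 0 p) (inverse h) / exp (inverse h)) \<longlongrightarrow> 0) (at_right 0)"
    by (rule filterlim_compose[OF poly_over_exp_tendsto_0 filterlim_inverse_at_top_right])
  moreover have "\<forall>\<^sub>F h in at_right 0.
      poly (pCons 0 p) (inverse h) / exp (inverse h) = flat_fun p h / h"
    by (auto simp: eventually_at_filter flat_fun_def exp_minus field_simps intro!: always_eventually)
  ultimately have r: "((\<lambda>h. flat_fun p h / h) \<longlongrightarrow> 0) (at_right 0)"
    by (rule Lim_transform_eventually)
  have "((\<lambda>h. flat_fun p h / h) \<longlongrightarrow> 0) (at 0)"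
    using l r by (rule filterlim_split_at)
  then show ?thesis
    using equal by (simp add: has_field_derivative_iff flat_fun_def)
qed

definition flat_exp :: "real \<Rightarrow> real" where "flat_exp = flat_fun 1"

lemma flat_exp_eq: "flat_exp t = (if t > 0 then exp (- (1 / t)) else 0)"
  by (simp add: flat_exp_def flat_fun_def)

text \<open>The required sequence of derivatives comes from iterating \<open>flat_deriv\<close> on
  the polynomial 1.\<close>

lemma Ck_on_flat_exp:
  assumes "Ck_on k H S g"
  shows "Ck_on k H S (\<lambda>x. flat_exp (g x))"
  using Ck_on_compose_real[of "\<lambda>n. flat_fun ((flat_deriv ^^ n) 1)", OF _ assms, of 0]
    flat_fun_has_derivative by (simp add: flat_exp_def)

text \<open>Composing the flat function with itself gives a step function without dividing smooth functions.\<close>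

definition cutoff :: "real \<Rightarrow> real \<Rightarrow> real \<Rightarrow> real"
  where "cutoff a b t = 1 + (- 1 / flat_exp (flat_exp (b - a))) *
    flat_exp (flat_exp (b - a) + (- 1) * flat_exp (b + (- 1) * t))"

text \<open>Here \<open>flat_exp (b - t)\<close> is at least \<open>flat_exp (b - a)\<close>, so the
  argument of the outer flat function is not positive and the subtracted term vanishes.\<close>

lemma cutoff_eq_1: "a < b \<Longrightarrow> t \<le> a \<Longrightarrow> cutoff a b t = 1"
  by (auto simp: cutoff_def flat_exp_eq field_simps)

text \<open>Here \<open>flat_exp (b - t)\<close> is 0, so the outer flat function takes exactly the
  value by which it is divided.\<close>

lemma cutoff_eq_0: "a < b \<Longrightarrow> b \<le> t \<Longrightarrow> cutoff a b t = 0"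
  by (auto simp: cutoff_def flat_exp_eq field_simps)

text \<open>In \<open>cutoff\<close> differences are written with the factor -1 and the quotient as
  a constant factor, so the rules for sums, products and constants suffice.\<close>

lemma Ck_on_cutoff:
  "Ck_on k H S g \<Longrightarrow> Ck_on k H S (\<lambda>x. cutoff a b (g x))"
  unfolding cutoff_def
  by (intro Ck_on_add Ck_on_const Ck_on_bilinear[OF bounded_bilinear_mult] Ck_on_flat_exp)

section \<open>Smooth manifolds and vector bundles\<close>

locale smooth_mfd =
  fixes M :: "('m::{t2_space,second_countable_topology}, 'e::euclidean_space, 'z) manifold_scheme"
  assumes smooth_manifold: "smooth_manifold M"
begin

lemma subspace_model_space: "subspace (model_space M)"
  using smooth_manifold by (simp add: smooth_manifold_def)

lemma chart_at: obtains U \<phi> where "(U, \<phi>) \<in> atlas M" "x \<in> U"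
proof -
  have "x \<in> \<Union>(fst ` atlas M)" using smooth_manifold by (simp add: smooth_manifold_def)
  then show ?thesis using that by auto
qed

lemma chart:
  assumes "(U, \<phi>) \<in> atlas M"
  shows "open U" "openin (top_of_set (model_space M)) (\<phi> ` U)"
    "homeomorphism U (\<phi> ` U) \<phi> (inv_into U \<phi>)"
  using assms smooth_manifold unfolding smooth_manifold_def by blast+

lemma transition:
  assumes "(U, \<phi>) \<in> atlas M" "(V, \<psi>) \<in> atlas M"
  shows "smooth_on (model_space M) (\<phi> ` (U \<inter> V)) (\<psi> \<circ> inv_into U \<phi>)"
  using assms smooth_manifold unfolding smooth_manifold_def by blast

lemma chart_inverse: "(U, \<phi>) \<in> atlas M \<Longrightarrow> y \<in> U \<Longrightarrow> inv_into U \<phi> (\<phi> y) = y"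
  using chart(3) by (blast intro: homeomorphism_apply1)

lemma openin_chart_image:
  assumes "(U, \<phi>) \<in> atlas M" "open W"
  shows "openin (top_of_set (model_space M)) (\<phi> ` (U \<inter> W))"
proof -
  have "openin (top_of_set U) (U \<inter> W)" using assms(2) by (simp add: openin_open_Int)
  then have "openin (top_of_set (\<phi> ` U)) (\<phi> ` (U \<inter> W))"
    using chart(3)[OF assms(1)] homeomorphism_imp_open_map by blast
  then show ?thesis using chart(2)[OF assms(1)] openin_trans by blast
qed

lemma smooth_fun_onD:
  "smooth_fun_on M W f \<Longrightarrow> (U, \<phi>) \<in> atlas M \<Longrightarrow>
    Ck_on k (model_space M) (\<phi> ` (U \<inter> W)) (\<lambda>z. f (inv_into U \<phi> z))"
  unfolding smooth_fun_on_def smooth_on_def comp_def by blast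

lemma smooth_fun_onI:
  assumes "\<And>U \<phi> k. (U, \<phi>) \<in> atlas M \<Longrightarrow>
    Ck_on k (model_space M) (\<phi> ` (U \<inter> W)) (\<lambda>z. f (inv_into U \<phi> z))"
  shows "smooth_fun_on M W f"
  using assms unfolding smooth_fun_on_def smooth_on_def comp_def by blast

lemma smooth_fun_on_cong:
  assumes "smooth_fun_on M W f" and eq: "\<And>x. x \<in> W \<Longrightarrow> f x = g x"
  shows "smooth_fun_on M W g"
proof (rule smooth_fun_onI)
  fix U \<phi> k assume c: "(U, \<phi>) \<in> atlas M"
  show "Ck_on k (model_space M) (\<phi> ` (U \<inter> W)) (\<lambda>z. g (inv_into U \<phi> z))"
    by (rule Ck_on_cong[OF _ smooth_fun_onD[OF assms(1) c]]) (auto simp: chart_inverse[OF c] eq)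
qed

lemma smooth_fun_on_subset:
  assumes "smooth_fun_on M W f" and "W' \<subseteq> W"
  shows "smooth_fun_on M W' f"
  by (rule smooth_fun_onI, rule Ck_on_subset[OF smooth_fun_onD[OF assms(1)]]) (use assms(2) in auto)

lemma smooth_fun_on_local:
  assumes "\<And>x. x \<in> W \<Longrightarrow> \<exists>W'. open W' \<and> x \<in> W' \<and> W' \<subseteq> W \<and> smooth_fun_on M W' f"
  shows "smooth_fun_on M W f"
proof (rule smooth_fun_onI, rule Ck_on_local[OF subspace_model_space])
  fix U \<phi> k z assume c: "(U, \<phi>) \<in> atlas M" and "z \<in> \<phi> ` (U \<inter> W)"
  then obtain x where x: "x \<in> U" "x \<in> W" "z = \<phi> x" by auto
  obtain W' where W': "open W'" "x \<in> W'" "W' \<subseteq> W" "smooth_fun_on M W' f"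
    using assms[OF x(2)] by blast
  have "z \<in> \<phi> ` (U \<inter> W')" "\<phi> ` (U \<inter> W') \<subseteq> \<phi> ` (U \<inter> W)" using x W' by auto
  then show "\<exists>T. openin (top_of_set (model_space M)) T \<and> z \<in> T \<and> T \<subseteq> \<phi> ` (U \<inter> W) \<and>
      Ck_on k (model_space M) T (\<lambda>z. f (inv_into U \<phi> z))"
    using openin_chart_image[OF c W'(1)] smooth_fun_onD[OF W'(4) c] by blast
qed

lemma smooth_fun_on_const: "smooth_fun_on M W (\<lambda>x. c)"
  by (rule smooth_fun_onI) (rule Ck_on_const)

lemma smooth_fun_on_add:
  assumes "smooth_fun_on M W f" "smooth_fun_on M W g"
  shows "smooth_fun_on M W (\<lambda>x. f x + g x)"
  by (rule smooth_fun_onI, rule Ck_on_add) (auto intro: smooth_fun_onD assms)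

lemma smooth_fun_on_mult:
  assumes "smooth_fun_on M W f" "smooth_fun_on M W g"
  shows "smooth_fun_on M W (\<lambda>x. f x * g x)"
  by (rule smooth_fun_onI, rule Ck_on_bilinear[OF bounded_bilinear_mult])
    (auto intro: smooth_fun_onD assms)

lemma smooth_fun_on_sum:
  assumes "\<And>i. i \<in> I \<Longrightarrow> smooth_fun_on M W (f i)"
  shows "smooth_fun_on M W (\<lambda>x. \<Sum>i\<in>I. f i x)"
  using assms
  by (induction I rule: infinite_finite_induct) (auto intro: smooth_fun_on_const smooth_fun_on_add)

text \<open>\<open>V\<close> is covered by the open sets \<open>U \<inter> V\<close> and
  \<open>V - K\<close>, and \<open>f\<close> is 0 on the latter. A general \<open>V\<close> is
  allowed because coefficients with respect to a second frame live only on the domain of that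
  frame.\<close>

lemma smooth_fun_on_extend_by_0:
  assumes "open U" "closed K" "K \<subseteq> U" "open V" "smooth_fun_on M (U \<inter> V) f"
    and 0: "\<And>x. x \<notin> K \<Longrightarrow> f x = 0"
  shows "smooth_fun_on M V f"
proof (rule smooth_fun_on_local)
  fix x assume x: "x \<in> V"
  show "\<exists>W'. open W' \<and> x \<in> W' \<and> W' \<subseteq> V \<and> smooth_fun_on M W' f"
  proof (cases "x \<in> U")
    case True
    then show ?thesis using assms x by (intro exI[of _ "U \<inter> V"]) auto
  next
    case False
    have "smooth_fun_on M (V - K) f"
      by (rule smooth_fun_on_cong[OF smooth_fun_on_const[of _ 0]]) (simp add: 0)
    then show ?thesis using assms x False by (intro exI[of _ "V - K"]) auto
  qed
qed

lemma smooth_funs_const: "(\<lambda>x. c) \<in> smooth_funs M"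
  and smooth_funs_add: "f \<in> smooth_funs M \<Longrightarrow> g \<in> smooth_funs M \<Longrightarrow> (\<lambda>x. f x + g x) \<in> smooth_funs M"
  and smooth_funs_mult: "f \<in> smooth_funs M \<Longrightarrow> g \<in> smooth_funs M \<Longrightarrow> (\<lambda>x. f x * g x) \<in> smooth_funs M"
  and smooth_funs_sum: "(\<And>i. i \<in> I \<Longrightarrow> F i \<in> smooth_funs M) \<Longrightarrow> (\<lambda>x. \<Sum>i\<in>I. F i x) \<in> smooth_funs M"
  by (simp_all add: smooth_funs_def smooth_fun_on_const smooth_fun_on_add smooth_fun_on_mult
      smooth_fun_on_sum)

lemma smooth_funs_minus: "f \<in> smooth_funs M \<Longrightarrow> (\<lambda>x. - f x) \<in> smooth_funs M"
  using smooth_funs_mult[OF smooth_funs_const[of "-1"]] by simp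

lemma smooth_funs_diff:
  "f \<in> smooth_funs M \<Longrightarrow> g \<in> smooth_funs M \<Longrightarrow> (\<lambda>x. f x - g x) \<in> smooth_funs M"
  using smooth_funs_add[OF _ smooth_funs_minus] by simp

lemmas smooth_funs_intros =
  smooth_funs_const smooth_funs_add smooth_funs_mult smooth_funs_sum smooth_funs_minus smooth_funs_diff

text \<open>The smooth step is applied to the squared distance from \<open>x\<close> in a chart. The
  closed set \<open>K\<close> serves extension by 0; on the open set \<open>V\<close> multiplication
  by \<open>f\<close> changes nothing.\<close>

lemma bump_function:
  assumes "open U" "x \<in> U"
  obtains f K V where "f \<in> smooth_funs M" "closed K" "K \<subseteq> U" "\<And>y. y \<notin> K \<Longrightarrow> f y = 0"
    "open V" "x \<in> V" "V \<subseteq> U" "\<And>y. y \<in> V \<Longrightarrow> f y = 1"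
proof -
  obtain U0 \<phi> where c: "(U0, \<phi>) \<in> atlas M" and x: "x \<in> U0" by (rule chart_at)
  let ?H = "model_space M"
  have "openin (top_of_set ?H) (\<phi> ` (U0 \<inter> U))" by (rule openin_chart_image[OF c assms(1)])
  then obtain O' where O': "open O'" "\<phi> ` (U0 \<inter> U) = ?H \<inter> O'" by (auto simp: openin_open)
  have "\<phi> x \<in> O'" using O'(2) x assms(2) by auto
  then obtain r where r: "r > 0" "cball (\<phi> x) r \<subseteq> O'" using O'(1) open_contains_cball by blast
  define B where "B = ?H \<inter> cball (\<phi> x) r"
  have B: "B \<subseteq> \<phi> ` (U0 \<inter> U)" using O' r by (auto simp: B_def)
  define K where "K = inv_into U0 \<phi> ` B"
  have KU: "K \<subseteq> U0 \<inter> U"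
  proof
    fix y assume "y \<in> K"
    then obtain z where z: "z \<in> B" "y = inv_into U0 \<phi> z" by (auto simp: K_def)
    then obtain u where "u \<in> U0 \<inter> U" "z = \<phi> u" using B by blast
    then show "y \<in> U0 \<inter> U" using z(2) chart_inverse[OF c, of u] by simp
  qed
  \<comment> \<open>The inverse chart carries the compact ball to a compact set, which is closed
    because the manifold is Hausdorff. A closed subset of the chart image need not have a closed
    preimage in the manifold.\<close>
  have "compact B" unfolding B_def
    by (rule closed_Int_compact[OF closed_subspace[OF subspace_model_space] compact_cball])
  moreover have "continuous_on B (inv_into U0 \<phi>)"
    using chart(3)[OF c] B by (meson continuous_on_subset homeomorphism_def image_mono inf_le1 order_trans)
  ultimately have "compact K" unfolding K_def by (rule compact_continuous_image[rotated])
  then have K: "closed K" by (rule compact_imp_closed)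
  \<comment> \<open>The step descends from 1 to 0 while the squared distance \<open>q\<close> runs
    from \<open>a\<close> to the squared radius. Squaring keeps \<open>q\<close> smooth at
    \<open>x\<close> too.\<close>
  define a where "a = r\<^sup>2 / 2"
  define q where "q y = inner (\<phi> y - \<phi> x) (\<phi> y - \<phi> x)" for y
  have ab: "0 < a" "a < r\<^sup>2" using r by (auto simp: a_def)
  define f where "f y = (if y \<in> U0 then cutoff a (r\<^sup>2) (q y) else 0)" for y
  have inK: "y \<in> K" if "y \<in> U0" "q y \<le> r\<^sup>2" for y
  proof -
    have "(norm (\<phi> y - \<phi> x))\<^sup>2 \<le> r\<^sup>2" using that(2) by (simp add: q_def power2_norm_eq_inner)
    then have "norm (\<phi> y - \<phi> x) \<le> r" by (rule power2_le_imp_le) (use r(1) in simp)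
    moreover have "\<phi> y \<in> ?H" using openin_subset[OF chart(2)[OF c]] that(1) by auto
    ultimately have "\<phi> y \<in> B" by (simp add: B_def dist_norm norm_minus_commute)
    then have "inv_into U0 \<phi> (\<phi> y) \<in> K" unfolding K_def by (rule imageI)
    then show ?thesis by (simp only: chart_inverse[OF c that(1)])
  qed
  have f0: "f y = 0" if y: "y \<notin> K" for y
  proof (cases "y \<in> U0")
    case True
    then have "r\<^sup>2 \<le> q y" using inK[of y] y by linarith
    then show ?thesis using cutoff_eq_0[OF ab(2)] by (simp add: f_def)
  qed (simp add: f_def)
  have "smooth_fun_on M U0 f"
  proof (rule smooth_fun_onI)
    fix V \<psi> k assume c': "(V, \<psi>) \<in> atlas M"
    have "Ck_on k ?H (\<psi> ` (V \<inter> U0)) (\<lambda>z. \<phi> (inv_into V \<psi> z) + - \<phi> x)"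
      using transition[OF c' c] unfolding smooth_on_def comp_def
      by (intro Ck_on_add Ck_on_const) auto
    then have "Ck_on k ?H (\<psi> ` (V \<inter> U0)) (\<lambda>z. q (inv_into V \<psi> z))"
      using Ck_on_bilinear[OF bounded_bilinear_inner] by (auto simp: q_def)
    then show "Ck_on k ?H (\<psi> ` (V \<inter> U0)) (\<lambda>z. f (inv_into V \<psi> z))"
      by (rule Ck_on_cong[OF _ Ck_on_cutoff[of _ _ _ _ a "r\<^sup>2"], rotated])
        (auto simp: f_def chart_inverse[OF c'])
  qed
  then have "f \<in> smooth_funs M"
    unfolding smooth_funs_def mem_Collect_eq
    by (intro smooth_fun_on_extend_by_0[OF chart(1)[OF c] K _ open_UNIV _ f0]) (use KU in auto)
  moreover have "continuous_on U0 q"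
    using chart(3)[OF c] unfolding q_def by (auto simp: homeomorphism_def intro!: continuous_intros)
  then have "open (U0 \<inter> q -` {..<a})"
    by (rule continuous_open_preimage[OF _ chart(1)[OF c] open_lessThan])
  moreover have "x \<in> U0 \<inter> q -` {..<a}" using x ab by (simp add: q_def)
  moreover have "U0 \<inter> q -` {..<a} \<subseteq> U" using inK KU ab(2) by fastforce
  moreover have "f y = 1" if "y \<in> U0 \<inter> q -` {..<a}" for y
    using that ab(2) by (auto simp: f_def intro!: cutoff_eq_1)
  ultimately show thesis using that[of f K "U0 \<inter> q -` {..<a}"] K KU f0 by blast
qed

end

section \<open>Coordinates with respect to a basis\<close>

definition basis_coord :: "nat \<Rightarrow> (nat \<Rightarrow> 'v::real_vector) \<Rightarrow> nat \<Rightarrow> 'v \<Rightarrow> real"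
  where "basis_coord r b i v = representation (b ` {..<r}) v (b i)"

lemma basis_coord_basis:
  assumes "is_basis r b W" "i < r" "j < r"
  shows "basis_coord r b i (b j) = (if i = j then 1 else 0)"
  using assms unfolding is_basis_def basis_coord_def
  by (auto simp: representation_basis inj_on_eq_iff)

lemma basis_coord_expand:
  assumes "is_basis r b W" "v \<in> W"
  shows "(\<Sum>i<r. basis_coord r b i v *\<^sub>R b i) = v"
proof -
  have "(\<Sum>w\<in>b ` {..<r}. representation (b ` {..<r}) v w *\<^sub>R w) = v"
    using assms by (intro sum_representation_eq) (auto simp: is_basis_def)
  then show ?thesis using assms(1)
    by (simp add: sum.reindex is_basis_def basis_coord_def)
qed

lemma basis_coord_add:
  assumes "is_basis r b W" "v \<in> W" "w \<in> W"
  shows "basis_coord r b i (v + w) = basis_coord r b i v + basis_coord r b i w"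
  using assms by (auto simp: is_basis_def basis_coord_def representation_add)

lemma basis_coord_scale:
  assumes "is_basis r b W" "v \<in> W"
  shows "basis_coord r b i (c *\<^sub>R v) = c * basis_coord r b i v"
  using assms by (auto simp: is_basis_def basis_coord_def representation_scale)

lemma basis_coord_sum:
  assumes "is_basis r b W" "i < r"
  shows "basis_coord r b i (\<Sum>j<r. c j *\<^sub>R b j) = c i"
proof -
  have "b j \<in> span (b ` {..<r})" if "j < r" for j using that by (auto intro: span_base)
  then have "basis_coord r b i (\<Sum>j<r. c j *\<^sub>R b j) = (\<Sum>j<r. c j * basis_coord r b i (b j))"
    using assms(1) unfolding basis_coord_def is_basis_def
    by (subst representation_sum) (auto simp: representation_scale intro: span_scale)
  also have "\<dots> = (\<Sum>j<r. if j = i then c j else 0)"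
    by (intro sum.cong) (auto simp: basis_coord_basis[OF assms(1) assms(2)])
  finally show ?thesis using assms(2) by simp
qed

section \<open>Vector bundles: fibres, dual frames and smoothness of sections\<close>

locale vec_bundle =
  fixes A :: "('m::{t2_space,second_countable_topology}, 'e::euclidean_space, 'v::real_vector, 'z)
    vbundle_scheme"
  assumes vector_bundle: "vector_bundle A"
begin

sublocale smooth_mfd A
  using vector_bundle by unfold_locales (simp add: vector_bundle_def)

lemma frame_at: obtains U e where "(U, e) \<in> local_frames A" "x \<in> U"
proof -
  have "x \<in> \<Union>(fst ` local_frames A)" using vector_bundle by (simp add: vector_bundle_def)
  then show ?thesis using that by auto
qed

lemma frame:
  assumes "(U, e) \<in> local_frames A"
  shows "open U" "x \<in> U \<Longrightarrow> is_basis (fibre_dim A) (\<lambda>i. e i x) (fibre A x)"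
  using assms vector_bundle unfolding vector_bundle_def by blast+

lemma frame_transition:
  assumes "(U, e) \<in> local_frames A" "(V, f) \<in> local_frames A"
  obtains g where "\<And>i j. i < fibre_dim A \<Longrightarrow> j < fibre_dim A \<Longrightarrow> smooth_fun_on A (U \<inter> V) (g i j)"
    "\<And>x j. x \<in> U \<inter> V \<Longrightarrow> j < fibre_dim A \<Longrightarrow> f j x = (\<Sum>i<fibre_dim A. g i j x *\<^sub>R e i x)"
proof -
  have "\<forall>(U, e)\<in>local_frames A. \<forall>(V, f)\<in>local_frames A. \<exists>g.
       (\<forall>i<fibre_dim A. \<forall>j<fibre_dim A. smooth_fun_on A (U \<inter> V) (g i j)) \<and>
       (\<forall>x\<in>U \<inter> V. \<forall>j<fibre_dim A. f j x = (\<Sum>i<fibre_dim A. g i j x *\<^sub>R e i x))"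
    using vector_bundle unfolding vector_bundle_def by (elim conjE)
  from bspec[OF this assms(1)] have "\<forall>(V, f)\<in>local_frames A. \<exists>g.
       (\<forall>i<fibre_dim A. \<forall>j<fibre_dim A. smooth_fun_on A (U \<inter> V) (g i j)) \<and>
       (\<forall>x\<in>U \<inter> V. \<forall>j<fibre_dim A. f j x = (\<Sum>i<fibre_dim A. g i j x *\<^sub>R e i x))"
    unfolding prod.case .
  from bspec[OF this assms(2)] show thesis unfolding prod.case using that by blast
qed

lemma subspace_fibre: "subspace (fibre A x)"
proof -
  obtain U e where "(U, e) \<in> local_frames A" "x \<in> U" by (rule frame_at)
  then have "span ((\<lambda>i. e i x) ` {..<fibre_dim A}) = fibre A x"
    using frame by (simp add: is_basis_def)
  then show ?thesis using subspace_span by metis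
qed

lemmas fibre_intros = subspace_0[OF subspace_fibre] subspace_add[OF subspace_fibre]
  subspace_scale[OF subspace_fibre] subspace_diff[OF subspace_fibre] subspace_neg[OF subspace_fibre]
  subspace_sum[OF subspace_fibre]

lemma frame_in_fibre:
  "(U, e) \<in> local_frames A \<Longrightarrow> x \<in> U \<Longrightarrow> i < fibre_dim A \<Longrightarrow> e i x \<in> fibre A x"
  using frame(2) unfolding is_basis_def by (metis imageI lessThan_iff span_base)

lemma dual_add: "\<xi> \<in> dual_fibre A x \<Longrightarrow> u \<in> fibre A x \<Longrightarrow> v \<in> fibre A x \<Longrightarrow> \<xi> (u + v) = \<xi> u + \<xi> v"
  and dual_scale: "\<xi> \<in> dual_fibre A x \<Longrightarrow> v \<in> fibre A x \<Longrightarrow> \<xi> (c *\<^sub>R v) = c * \<xi> v"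
  and dual_outside: "\<xi> \<in> dual_fibre A x \<Longrightarrow> v \<notin> fibre A x \<Longrightarrow> \<xi> v = 0"
  by (simp_all add: dual_fibre_def)

lemma dual_0: "\<xi> \<in> dual_fibre A x \<Longrightarrow> \<xi> 0 = 0"
  using dual_scale[of \<xi> x 0 0] fibre_intros(1) by simp

lemma dual_minus: "\<xi> \<in> dual_fibre A x \<Longrightarrow> v \<in> fibre A x \<Longrightarrow> \<xi> (- v) = - \<xi> v"
  using dual_scale[of \<xi> x v "-1"] by simp

lemma dual_diff:
  "\<xi> \<in> dual_fibre A x \<Longrightarrow> u \<in> fibre A x \<Longrightarrow> v \<in> fibre A x \<Longrightarrow> \<xi> (u - v) = \<xi> u - \<xi> v"
  using dual_add[of \<xi> x u "- v"] dual_minus[of \<xi> x v] fibre_intros(5) by simp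

lemma dual_sum:
  assumes "\<xi> \<in> dual_fibre A x" "\<And>i. i \<in> I \<Longrightarrow> v i \<in> fibre A x"
  shows "\<xi> (\<Sum>i\<in>I. c i *\<^sub>R v i) = (\<Sum>i\<in>I. c i * \<xi> (v i))"
  using assms(2)
proof (induction I rule: infinite_finite_induct)
  case (insert i I)
  then have "c i *\<^sub>R v i \<in> fibre A x" "(\<Sum>i\<in>I. c i *\<^sub>R v i) \<in> fibre A x"
    by (auto intro!: fibre_intros)
  then show ?case using insert by (simp add: dual_add[OF assms(1)] dual_scale[OF assms(1)])
qed (simp_all add: dual_0[OF assms(1)])

lemma dual_fibre_add:
  "\<xi> \<in> dual_fibre A x \<Longrightarrow> \<eta> \<in> dual_fibre A x \<Longrightarrow> (\<lambda>v. \<xi> v + \<eta> v) \<in> dual_fibre A x"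
  by (simp add: dual_fibre_def algebra_simps)

lemma dual_fibre_scale: "\<xi> \<in> dual_fibre A x \<Longrightarrow> (\<lambda>v. c * \<xi> v) \<in> dual_fibre A x"
  by (simp add: dual_fibre_def algebra_simps)

lemma dual_fibre_0: "(\<lambda>v. 0) \<in> dual_fibre A x"
  by (simp add: dual_fibre_def)

lemma dual_fibre_sum:
  "(\<And>i. i \<in> I \<Longrightarrow> \<xi> i \<in> dual_fibre A x) \<Longrightarrow> (\<lambda>v. \<Sum>i\<in>I. c i * \<xi> i v) \<in> dual_fibre A x"
  by (induction I rule: infinite_finite_induct)
    (auto intro!: dual_fibre_0 dual_fibre_add dual_fibre_scale)

lemma section_in_fibre: "X \<in> sections A \<Longrightarrow> X x \<in> fibre A x"
  by (simp add: sections_on_def)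

lemma dual_section_in_dual_fibre: "\<xi> \<in> dual_sections A \<Longrightarrow> \<xi> x \<in> dual_fibre A x"
  by (simp add: dual_sections_on_def)

lemma sections_onI:
  assumes "\<And>x. x \<in> W \<Longrightarrow> X x \<in> fibre A x"
    and "\<And>U e. (U, e) \<in> local_frames A \<Longrightarrow>
      \<exists>c. (\<forall>i<fibre_dim A. smooth_fun_on A (U \<inter> W) (c i)) \<and>
        (\<forall>x\<in>U \<inter> W. X x = (\<Sum>i<fibre_dim A. c i x *\<^sub>R e i x))"
  shows "X \<in> sections_on A W"
  using assms unfolding sections_on_def by blast

lemma sections_onE:
  assumes "X \<in> sections_on A W" "(U, e) \<in> local_frames A"
  obtains c where "\<And>i. i < fibre_dim A \<Longrightarrow> smooth_fun_on A (U \<inter> W) (c i)"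
    "\<And>x. x \<in> U \<Longrightarrow> x \<in> W \<Longrightarrow> X x = (\<Sum>i<fibre_dim A. c i x *\<^sub>R e i x)"
  using assms unfolding sections_on_def by blast

lemma dual_sections_onI:
  assumes "\<And>x. x \<in> W \<Longrightarrow> \<xi> x \<in> dual_fibre A x"
    and "\<And>U e i. (U, e) \<in> local_frames A \<Longrightarrow> i < fibre_dim A \<Longrightarrow>
      smooth_fun_on A (U \<inter> W) (\<lambda>x. \<xi> x (e i x))"
  shows "\<xi> \<in> dual_sections_on A W"
  using assms unfolding dual_sections_on_def by blast

lemma dual_sections_onD:
  "\<xi> \<in> dual_sections_on A W \<Longrightarrow> (U, e) \<in> local_frames A \<Longrightarrow> i < fibre_dim A \<Longrightarrow>
    smooth_fun_on A (U \<inter> W) (\<lambda>x. \<xi> x (e i x))"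
  unfolding dual_sections_on_def by blast

lemma sections_on_subset:
  assumes X: "X \<in> sections A" shows "X \<in> sections_on A W"
proof (rule sections_onI)
  fix U e assume e: "(U, e) \<in> local_frames A"
  obtain c where c: "\<And>i. i < fibre_dim A \<Longrightarrow> smooth_fun_on A (U \<inter> UNIV) (c i)"
    "\<And>x. x \<in> U \<Longrightarrow> x \<in> UNIV \<Longrightarrow> X x = (\<Sum>i<fibre_dim A. c i x *\<^sub>R e i x)"
    using sections_onE[OF X e] by metis
  show "\<exists>c. (\<forall>i<fibre_dim A. smooth_fun_on A (U \<inter> W) (c i)) \<and>
        (\<forall>x\<in>U \<inter> W. X x = (\<Sum>i<fibre_dim A. c i x *\<^sub>R e i x))"
    using c(2) by (intro exI[of _ c] conjI allI impI smooth_fun_on_subset[OF c(1)]) auto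
qed (rule section_in_fibre[OF X])

lemma dual_sections_on_subset:
  assumes \<xi>: "\<xi> \<in> dual_sections A" shows "\<xi> \<in> dual_sections_on A W"
  by (intro dual_sections_onI dual_section_in_dual_fibre[OF \<xi>]
      smooth_fun_on_subset[OF dual_sections_onD[OF \<xi>]]) auto

lemma pairing_smooth:
  assumes \<xi>: "\<xi> \<in> dual_sections A" and X: "X \<in> sections A"
  shows "pairing \<xi> X \<in> smooth_funs A"
  unfolding smooth_funs_def mem_Collect_eq
proof (rule smooth_fun_on_local)
  fix x
  obtain U e where e: "(U, e) \<in> local_frames A" "x \<in> U" by (rule frame_at)
  obtain c where c: "\<And>i. i < fibre_dim A \<Longrightarrow> smooth_fun_on A (U \<inter> UNIV) (c i)"
    "\<And>x. x \<in> U \<Longrightarrow> x \<in> UNIV \<Longrightarrow> X x = (\<Sum>i<fibre_dim A. c i x *\<^sub>R e i x)"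
    using sections_onE[OF X e(1)] by metis
  have "smooth_fun_on A U (\<lambda>y. \<Sum>i<fibre_dim A. c i y * \<xi> y (e i y))"
    using c(1) dual_sections_onD[OF \<xi> e(1)]
    by (intro smooth_fun_on_sum smooth_fun_on_mult) auto
  moreover have "pairing \<xi> X y = (\<Sum>i<fibre_dim A. c i y * \<xi> y (e i y))" if "y \<in> U" for y
  proof -
    have "\<xi> y (\<Sum>i<fibre_dim A. c i y *\<^sub>R e i y) = (\<Sum>i<fibre_dim A. c i y * \<xi> y (e i y))"
      by (rule dual_sum[OF dual_section_in_dual_fibre[OF \<xi>]])
        (use frame_in_fibre[OF e(1) that] in simp)
    then show ?thesis by (simp add: pairing_def c(2)[OF that])
  qed
  ultimately have "smooth_fun_on A U (pairing \<xi> X)" using smooth_fun_on_cong by simp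
  then show "\<exists>W'. open W' \<and> x \<in> W' \<and> W' \<subseteq> UNIV \<and> smooth_fun_on A W' (pairing \<xi> X)"
    using e frame(1) by blast
qed

text \<open>The local frame and its coordinate functionals are multiplied by a bump function
  supported in \<open>U\<close> and extended by 0. This matters because bracket axioms and
  smoothness of bivectors are stated for global sections only.\<close>

lemma global_frame_near:
  assumes e: "(U, e) \<in> local_frames A" and x: "x \<in> U"
  obtains V E \<epsilon> where "open V" "x \<in> V" "V \<subseteq> U"
    "\<And>i. i < fibre_dim A \<Longrightarrow> E i \<in> sections A"
    "\<And>i. i < fibre_dim A \<Longrightarrow> \<epsilon> i \<in> dual_sections A"
    "\<And>i y. i < fibre_dim A \<Longrightarrow> y \<in> V \<Longrightarrow> E i y = e i y"
    "\<And>i y v. i < fibre_dim A \<Longrightarrow> y \<in> V \<Longrightarrow> v \<in> fibre A y \<Longrightarrow>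
      \<epsilon> i y v = basis_coord (fibre_dim A) (\<lambda>i. e i y) i v"
proof -
  let ?r = "fibre_dim A"
  obtain f K V where f: "f \<in> smooth_funs A" "closed K" "K \<subseteq> U" "\<And>y. y \<notin> K \<Longrightarrow> f y = 0"
    "open V" "x \<in> V" "V \<subseteq> U" "\<And>y. y \<in> V \<Longrightarrow> f y = 1"
    using bump_function[OF frame(1)[OF e] x] by blast
  have fs: "smooth_fun_on A W f" for W
    using f(1) smooth_fun_on_subset unfolding smooth_funs_def by blast
  define E where "E i y = (if y \<in> U then f y *\<^sub>R e i y else 0)" for i y
  define \<epsilon> where "\<epsilon> i y v = (if y \<in> U \<and> v \<in> fibre A y then
      f y * basis_coord ?r (\<lambda>i. e i y) i v else 0)" for i y v
  have "E i \<in> sections A" if i: "i < ?r" for i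
  proof (rule sections_onI)
    show "E i y \<in> fibre A y" for y
      using frame_in_fibre[OF e _ i] by (auto simp: E_def intro: fibre_intros)
  next
    fix V' e' assume e': "(V', e') \<in> local_frames A"
    obtain g where g: "\<And>i j. i < ?r \<Longrightarrow> j < ?r \<Longrightarrow> smooth_fun_on A (V' \<inter> U) (g i j)"
      "\<And>x j. x \<in> V' \<inter> U \<Longrightarrow> j < ?r \<Longrightarrow> e j x = (\<Sum>i<?r. g i j x *\<^sub>R e' i x)"
      by (rule frame_transition[OF e' e], rule that)
    \<comment> \<open>These are the coefficients of the cut-off section in the second frame
      \<open>e'\<close>. They are smooth on \<open>U \<inter> V'\<close> and vanish outside
      \<open>K\<close>, hence are smooth on all of \<open>V'\<close>.\<close>
    define c where "c k y = (if y \<in> U then f y * g k i y else 0)" for k y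
    have "smooth_fun_on A V' (c k)" if k: "k < ?r" for k
    proof (rule smooth_fun_on_extend_by_0[OF frame(1)[OF e] f(2,3) frame(1)[OF e']])
      have "smooth_fun_on A (U \<inter> V') (\<lambda>y. f y * g k i y)"
        using g(1)[OF k i] by (intro smooth_fun_on_mult fs) (simp add: Int_commute)
      then show "smooth_fun_on A (U \<inter> V') (c k)"
        by (rule smooth_fun_on_cong) (simp add: c_def)
      show "y \<notin> K \<Longrightarrow> c k y = 0" for y using f(4) by (simp add: c_def)
    qed
    moreover have "E i y = (\<Sum>k<?r. c k y *\<^sub>R e' k y)" if "y \<in> V'" for y
      using that g(2)[OF _ i] by (auto simp: E_def c_def scaleR_sum_right)
    ultimately show "\<exists>c. (\<forall>i<?r. smooth_fun_on A (V' \<inter> UNIV) (c i)) \<and>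
        (\<forall>x\<in>V' \<inter> UNIV. E i x = (\<Sum>i<?r. c i x *\<^sub>R e' i x))"
      by (intro exI[of _ c]) auto
  qed
  moreover have "\<epsilon> i \<in> dual_sections A" if i: "i < ?r" for i
  proof (rule dual_sections_onI)
    fix y
    show "\<epsilon> i y \<in> dual_fibre A y"
      unfolding dual_fibre_def \<epsilon>_def using frame(2)[OF e, of y]
      by (auto simp: basis_coord_add basis_coord_scale algebra_simps fibre_intros)
  next
    fix V' e' j assume e': "(V', e') \<in> local_frames A" and j: "j < ?r"
    obtain g where g: "\<And>i j. i < ?r \<Longrightarrow> j < ?r \<Longrightarrow> smooth_fun_on A (U \<inter> V') (g i j)"
      "\<And>x j. x \<in> U \<inter> V' \<Longrightarrow> j < ?r \<Longrightarrow> e' j x = (\<Sum>i<?r. g i j x *\<^sub>R e i x)"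
      by (rule frame_transition[OF e e'], rule that)
    have "smooth_fun_on A V' (\<lambda>y. \<epsilon> i y (e' j y))"
    proof (rule smooth_fun_on_extend_by_0[OF frame(1)[OF e] f(2,3) frame(1)[OF e']])
      have "smooth_fun_on A (U \<inter> V') (\<lambda>y. f y * g i j y)"
        using g(1)[OF i j] by (intro smooth_fun_on_mult fs)
      then show "smooth_fun_on A (U \<inter> V') (\<lambda>y. \<epsilon> i y (e' j y))"
      proof (rule smooth_fun_on_cong)
        fix y assume y: "y \<in> U \<inter> V'"
        \<comment> \<open>The coordinate functionals of \<open>e\<close> evaluated on
          \<open>e'\<close> are the entries of the transition matrix, which are smooth.\<close>
        then have "basis_coord ?r (\<lambda>i. e i y) i (e' j y) = g i j y"
          using basis_coord_sum[OF frame(2)[OF e] i, of y] by (simp add: g(2)[OF y j])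
        then show "f y * g i j y = \<epsilon> i y (e' j y)"
          using y frame_in_fibre[OF e' _ j] by (simp add: \<epsilon>_def)
      qed
      show "y \<notin> K \<Longrightarrow> \<epsilon> i y (e' j y) = 0" for y using f(4) by (simp add: \<epsilon>_def)
    qed
    then show "smooth_fun_on A (V' \<inter> UNIV) (\<lambda>y. \<epsilon> i y (e' j y))" by simp
  qed
  moreover have "E i y = e i y" if "y \<in> V" for i y
    using that f(7,8) by (auto simp: E_def)
  moreover have "\<epsilon> i y v = basis_coord ?r (\<lambda>i. e i y) i v" if "y \<in> V" "v \<in> fibre A y" for i y v
    using that f(7,8) by (auto simp: \<epsilon>_def)
  ultimately show thesis using that[of V E \<epsilon>] f(5-7) by blast
qed

text \<open>Near each point the coefficients of \<open>X\<close> in a frame are its pairings with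
  the global forms of \<open>global_frame_near\<close>. Smoothness of sections thus reduces to
  smoothness of scalar functions, with no further reference to charts or frames.\<close>

lemma sections_iff:
  "X \<in> sections A \<longleftrightarrow>
    (\<forall>x. X x \<in> fibre A x) \<and> (\<forall>\<xi>\<in>dual_sections A. pairing \<xi> X \<in> smooth_funs A)"
  (is "_ \<longleftrightarrow> ?R")
proof
  assume "X \<in> sections A"
  then show ?R by (auto intro: section_in_fibre pairing_smooth)
next
  assume R: ?R
  let ?r = "fibre_dim A"
  show "X \<in> sections A"
  proof (rule sections_onI)
    fix U e assume e: "(U, e) \<in> local_frames A"
    define c where "c i y = basis_coord ?r (\<lambda>i. e i y) i (X y)" for i y
    have "smooth_fun_on A U (c i)" if i: "i < ?r" for i
    proof (rule smooth_fun_on_local)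
      fix x assume x: "x \<in> U"
      obtain V E \<epsilon> where V: "open V" "x \<in> V" "V \<subseteq> U"
        "\<And>i. i < ?r \<Longrightarrow> \<epsilon> i \<in> dual_sections A"
        "\<And>i y v. i < ?r \<Longrightarrow> y \<in> V \<Longrightarrow> v \<in> fibre A y \<Longrightarrow> \<epsilon> i y v = basis_coord ?r (\<lambda>i. e i y) i v"
        using global_frame_near[OF e x] by metis
      have "smooth_fun_on A UNIV (pairing (\<epsilon> i) X)"
        using R V(4)[OF i] unfolding smooth_funs_def by blast
      then have "smooth_fun_on A V (pairing (\<epsilon> i) X)" by (rule smooth_fun_on_subset) simp
      then have "smooth_fun_on A V (c i)"
        by (rule smooth_fun_on_cong) (use R V(5)[OF i] in \<open>simp add: c_def pairing_def\<close>)
      then show "\<exists>W'. open W' \<and> x \<in> W' \<and> W' \<subseteq> U \<and> smooth_fun_on A W' (c i)" using V by blast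
    qed
    moreover have "X y = (\<Sum>i<?r. c i y *\<^sub>R e i y)" if "y \<in> U" for y
      unfolding c_def using basis_coord_expand[OF frame(2)[OF e that]] R by simp
    ultimately show "\<exists>c. (\<forall>i<?r. smooth_fun_on A (U \<inter> UNIV) (c i)) \<and>
        (\<forall>x\<in>U \<inter> UNIV. X x = (\<Sum>i<?r. c i x *\<^sub>R e i x))"
      by (intro exI[of _ c]) auto
  qed (use R in blast)
qed

text \<open>The values of a form on a local frame agree near each point with its pairings against
  the globalized frame.\<close>

lemma dual_sections_iff:
  "\<xi> \<in> dual_sections A \<longleftrightarrow>
    (\<forall>x. \<xi> x \<in> dual_fibre A x) \<and> (\<forall>X\<in>sections A. pairing \<xi> X \<in> smooth_funs A)"
  (is "_ \<longleftrightarrow> ?R")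
proof
  assume "\<xi> \<in> dual_sections A"
  then show ?R by (auto intro: dual_section_in_dual_fibre pairing_smooth)
next
  assume R: ?R
  show "\<xi> \<in> dual_sections A"
  proof (rule dual_sections_onI)
    fix U e i assume e: "(U, e) \<in> local_frames A" and i: "i < fibre_dim A"
    have "smooth_fun_on A U (\<lambda>y. \<xi> y (e i y))"
    proof (rule smooth_fun_on_local)
      fix x assume x: "x \<in> U"
      obtain V E \<epsilon> where V: "open V" "x \<in> V" "V \<subseteq> U"
        "\<And>i. i < fibre_dim A \<Longrightarrow> E i \<in> sections A"
        "\<And>i y. i < fibre_dim A \<Longrightarrow> y \<in> V \<Longrightarrow> E i y = e i y"
        using global_frame_near[OF e x] by metis
      have "smooth_fun_on A UNIV (pairing \<xi> (E i))"
        using R V(4)[OF i] unfolding smooth_funs_def by blast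
      then have "smooth_fun_on A V (pairing \<xi> (E i))" by (rule smooth_fun_on_subset) simp
      then have "smooth_fun_on A V (\<lambda>y. \<xi> y (e i y))"
        by (rule smooth_fun_on_cong) (simp add: pairing_def V(5)[OF i])
      then show "\<exists>W'. open W' \<and> x \<in> W' \<and> W' \<subseteq> U \<and> smooth_fun_on A W' (\<lambda>y. \<xi> y (e i y))"
        using V by blast
    qed
    then show "smooth_fun_on A (U \<inter> UNIV) (\<lambda>y. \<xi> y (e i y))" by simp
  qed (use R in blast)
qed

text \<open>Packages the globalized frame as a dual pair with both expansions. The expansion of a
  covector is an equality of functions on all of the ambient space, since both sides vanish outside
  the fibre.\<close>

lemma frame_near:
  obtains U E \<epsilon> where "open U" "x \<in> U"
    "\<And>i. i < fibre_dim A \<Longrightarrow> E i \<in> sections A"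
    "\<And>i. i < fibre_dim A \<Longrightarrow> \<epsilon> i \<in> dual_sections A"
    "\<And>y i j. y \<in> U \<Longrightarrow> i < fibre_dim A \<Longrightarrow> j < fibre_dim A \<Longrightarrow>
      \<epsilon> i y (E j y) = (if i = j then 1 else 0)"
    "\<And>y v. y \<in> U \<Longrightarrow> v \<in> fibre A y \<Longrightarrow> (\<Sum>i<fibre_dim A. \<epsilon> i y v *\<^sub>R E i y) = v"
    "\<And>y \<xi>. y \<in> U \<Longrightarrow> \<xi> \<in> dual_fibre A y \<Longrightarrow> (\<lambda>v. \<Sum>i<fibre_dim A. \<xi> (E i y) * \<epsilon> i y v) = \<xi>"
proof -
  let ?r = "fibre_dim A"
  obtain U0 e where e: "(U0, e) \<in> local_frames A" "x \<in> U0" by (rule frame_at)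
  obtain U E \<epsilon> where U: "open U" "x \<in> U" "U \<subseteq> U0"
    "\<And>i. i < ?r \<Longrightarrow> E i \<in> sections A"
    "\<And>i. i < ?r \<Longrightarrow> \<epsilon> i \<in> dual_sections A"
    "\<And>i y. i < ?r \<Longrightarrow> y \<in> U \<Longrightarrow> E i y = e i y"
    "\<And>i y v. i < ?r \<Longrightarrow> y \<in> U \<Longrightarrow> v \<in> fibre A y \<Longrightarrow> \<epsilon> i y v = basis_coord ?r (\<lambda>i. e i y) i v"
    by (rule global_frame_near[OF e], rule that)
  have 1: "\<epsilon> i y (E j y) = (if i = j then 1 else 0)" if "y \<in> U" "i < ?r" "j < ?r" for y i j
  proof -
    have "y \<in> U0" using that U(3) by auto
    then show ?thesis
      using that U(6,7) frame_in_fibre[OF e(1)] basis_coord_basis[OF frame(2)[OF e(1)]] by simp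
  qed
  have 2: "(\<Sum>i<?r. \<epsilon> i y v *\<^sub>R E i y) = v" if "y \<in> U" "v \<in> fibre A y" for y v
  proof -
    have "y \<in> U0" using that U(3) by auto
    then show ?thesis
      using that U(6,7) basis_coord_expand[OF frame(2)[OF e(1)]] by simp
  qed
  have 3: "(\<lambda>v. \<Sum>i<?r. \<xi> (E i y) * \<epsilon> i y v) = \<xi>" if "y \<in> U" "\<xi> \<in> dual_fibre A y" for y \<xi>
  proof
    fix v
    show "(\<Sum>i<?r. \<xi> (E i y) * \<epsilon> i y v) = \<xi> v"
    proof (cases "v \<in> fibre A y")
      case True
      have "\<xi> v = \<xi> (\<Sum>i<?r. \<epsilon> i y v *\<^sub>R E i y)" using 2[OF that(1) True] by simp
      also have "\<dots> = (\<Sum>i<?r. \<epsilon> i y v * \<xi> (E i y))"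
        using U(4) section_in_fibre by (intro dual_sum[OF that(2)]) auto
      finally show ?thesis by (simp add: mult.commute)
    next
      case False
      then show ?thesis
        using that(2) U(5) by (simp add: dual_outside[OF dual_section_in_dual_fibre] dual_outside)
    qed
  qed
  show thesis using that[OF U(1,2,4,5) 1 2 3] by blast
qed

end

section \<open>Operations on sections, extension from a point, tensoriality\<close>

context vec_bundle
begin

lemmas dual_section_linear =
  dual_add[OF dual_section_in_dual_fibre] dual_scale[OF dual_section_in_dual_fibre]
  dual_0[OF dual_section_in_dual_fibre] dual_minus[OF dual_section_in_dual_fibre]
  dual_diff[OF dual_section_in_dual_fibre]

lemma sections_add: "X \<in> sections A \<Longrightarrow> Y \<in> sections A \<Longrightarrow> (\<lambda>x. X x + Y x) \<in> sections A"
  and sections_scale: "f \<in> smooth_funs A \<Longrightarrow> X \<in> sections A \<Longrightarrow> (\<lambda>x. f x *\<^sub>R X x) \<in> sections A"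
  and sections_0: "(\<lambda>x. 0) \<in> sections A"
  unfolding sections_iff
  by (auto simp: pairing_def dual_section_linear intro!: fibre_intros smooth_funs_intros)

lemma sections_minus: "X \<in> sections A \<Longrightarrow> (\<lambda>x. - X x) \<in> sections A"
  using sections_scale[OF smooth_funs_const[of "-1"]] by simp

lemma sections_diff: "X \<in> sections A \<Longrightarrow> Y \<in> sections A \<Longrightarrow> (\<lambda>x. X x - Y x) \<in> sections A"
  using sections_add[OF _ sections_minus] by simp

lemma sections_sum:
  "(\<And>i. i \<in> I \<Longrightarrow> X i \<in> sections A) \<Longrightarrow> (\<lambda>x. \<Sum>i\<in>I. X i x) \<in> sections A"
  by (induction I rule: infinite_finite_induct) (auto intro: sections_0 sections_add)

lemma dual_sections_add:
    "\<xi> \<in> dual_sections A \<Longrightarrow> \<eta> \<in> dual_sections A \<Longrightarrow> (\<lambda>x v. \<xi> x v + \<eta> x v) \<in> dual_sections A"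
  and dual_sections_scale:
    "f \<in> smooth_funs A \<Longrightarrow> \<xi> \<in> dual_sections A \<Longrightarrow> (\<lambda>x v. f x * \<xi> x v) \<in> dual_sections A"
  and dual_sections_0: "(\<lambda>x v. 0) \<in> dual_sections A"
  unfolding dual_sections_iff
  by (auto simp: pairing_def dual_fibre_0 intro!: dual_fibre_add dual_fibre_scale smooth_funs_intros)

lemma dual_sections_diff:
  assumes "\<xi> \<in> dual_sections A" "\<eta> \<in> dual_sections A"
  shows "(\<lambda>x v. \<xi> x v - \<eta> x v) \<in> dual_sections A"
  using dual_sections_add[OF assms(1) dual_sections_scale[OF smooth_funs_const[of "-1"] assms(2)]]
  by simp

lemma dual_sections_sum:
  "(\<And>i. i \<in> I \<Longrightarrow> \<xi> i \<in> dual_sections A) \<Longrightarrow> (\<lambda>x v. \<Sum>i\<in>I. \<xi> i x v) \<in> dual_sections A"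
  by (induction I rule: infinite_finite_induct) (auto intro: dual_sections_0 dual_sections_add)

text \<open>A combination of the globalized frame with constant coefficients, the coordinates of
  \<open>v\<close> at \<open>x\<close>.\<close>

lemma section_through:
  assumes "v \<in> fibre A x"
  obtains X where "X \<in> sections A" "X x = v"
proof -
  obtain U E \<epsilon> where F: "open U" "x \<in> U"
    "\<And>i. i < fibre_dim A \<Longrightarrow> E i \<in> sections A"
    "\<And>y v. y \<in> U \<Longrightarrow> v \<in> fibre A y \<Longrightarrow> (\<Sum>i<fibre_dim A. \<epsilon> i y v *\<^sub>R E i y) = v"
    by (rule frame_near[of x], rule that)
  show thesis
  proof (rule that)
    show "(\<lambda>y. \<Sum>i<fibre_dim A. \<epsilon> i x v *\<^sub>R E i y) \<in> sections A"
      by (rule sections_sum, rule sections_scale[OF smooth_funs_const]) (use F(3) in simp)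
    show "(\<Sum>i<fibre_dim A. \<epsilon> i x v *\<^sub>R E i x) = v" by (rule F(4)[OF F(2) assms])
  qed
qed

lemma dual_section_through:
  assumes "\<xi> \<in> dual_fibre A x"
  obtains \<alpha> where "\<alpha> \<in> dual_sections A" "\<alpha> x = \<xi>"
proof -
  obtain U E \<epsilon> where F: "open U" "x \<in> U"
    "\<And>i. i < fibre_dim A \<Longrightarrow> \<epsilon> i \<in> dual_sections A"
    "\<And>y \<xi>. y \<in> U \<Longrightarrow> \<xi> \<in> dual_fibre A y \<Longrightarrow> (\<lambda>v. \<Sum>i<fibre_dim A. \<xi> (E i y) * \<epsilon> i y v) = \<xi>"
    by (rule frame_near[of x], rule that)
  show thesis
  proof (rule that)
    show "(\<lambda>y v. \<Sum>i<fibre_dim A. \<xi> (E i x) * \<epsilon> i y v) \<in> dual_sections A"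
      by (rule dual_sections_sum, rule dual_sections_scale[OF smooth_funs_const]) (use F(3) in simp)
    show "(\<lambda>v. \<Sum>i<fibre_dim A. \<xi> (E i x) * \<epsilon> i x v) = \<xi>" by (rule F(4)[OF F(2) assms])
  qed
qed

text \<open>The frame coordinates are covectors, so covectors separate the vectors of a
  fibre.\<close>

lemma fibre_eqI:
  assumes "a \<in> fibre A x" "b \<in> fibre A x" and eq: "\<And>\<eta>. \<eta> \<in> dual_fibre A x \<Longrightarrow> \<eta> a = \<eta> b"
  shows "a = b"
proof -
  obtain U E \<epsilon> where F: "open U" "x \<in> U"
    "\<And>i. i < fibre_dim A \<Longrightarrow> \<epsilon> i \<in> dual_sections A"
    "\<And>y v. y \<in> U \<Longrightarrow> v \<in> fibre A y \<Longrightarrow> (\<Sum>i<fibre_dim A. \<epsilon> i y v *\<^sub>R E i y) = v"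
    by (rule frame_near[of x], rule that)
  have "(\<Sum>i<fibre_dim A. \<epsilon> i x a *\<^sub>R E i x) = (\<Sum>i<fibre_dim A. \<epsilon> i x b *\<^sub>R E i x)"
    by (intro sum.cong refl arg_cong2[of _ _ _ _ scaleR] eq dual_section_in_dual_fibre F(3)) simp
  then show ?thesis using F(4)[OF F(2)] assms(1,2) by metis
qed

text \<open>A function-linear map on sections is pointwise: near \<open>x\<close>, write a section vanishing at \<open>x\<close>
  in a frame and cut off with a bump function.\<close>

lemma tensorial:
  fixes F :: "('m \<Rightarrow> 'v) \<Rightarrow> 'm \<Rightarrow> real"
  assumes add: "\<And>X Y. X \<in> sections A \<Longrightarrow> Y \<in> sections A \<Longrightarrow> F (\<lambda>y. X y + Y y) x = F X x + F Y x"
    and scale: "\<And>f X. f \<in> smooth_funs A \<Longrightarrow> X \<in> sections A \<Longrightarrow> F (\<lambda>y. f y *\<^sub>R X y) x = f x * F X x"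
    and X: "X \<in> sections A" and Y: "Y \<in> sections A" and eq: "X x = Y x"
  shows "F X x = F Y x"
proof -
  let ?r = "fibre_dim A"
  obtain U E \<epsilon> where F: "open U" "x \<in> U"
    "\<And>i. i < ?r \<Longrightarrow> E i \<in> sections A" "\<And>i. i < ?r \<Longrightarrow> \<epsilon> i \<in> dual_sections A"
    "\<And>y v. y \<in> U \<Longrightarrow> v \<in> fibre A y \<Longrightarrow> (\<Sum>i<?r. \<epsilon> i y v *\<^sub>R E i y) = v"
    by (rule frame_near[of x], rule that)
  obtain f K V where f: "f \<in> smooth_funs A" "K \<subseteq> U" "\<And>y. y \<notin> K \<Longrightarrow> f y = 0"
    "x \<in> V" "\<And>y. y \<in> V \<Longrightarrow> f y = 1"
    by (rule bump_function[OF F(1,2)], rule that)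
  define Z where "Z y = X y - Y y" for y
  have Z: "Z \<in> sections A" unfolding Z_def by (intro sections_diff X Y)
  have Zx: "Z x = 0" using eq by (simp add: Z_def)
  define c where "c i = pairing (\<epsilon> i) Z" for i
  have c: "c i \<in> smooth_funs A" if "i < ?r" for i
    unfolding c_def using F(4)[OF that] Z by (rule pairing_smooth)
  have cx: "c i x = 0" if "i < ?r" for i
    using dual_0[OF dual_section_in_dual_fibre[OF F(4)[OF that]]] by (simp add: c_def pairing_def Zx)
  \<comment> \<open>With \<open>Z = X - Y\<close>, write \<open>Z = (1 - f) Z + f Z\<close> and
    expand only \<open>f Z\<close> in the frame: this is valid globally because \<open>f\<close>
    vanishes outside \<open>U\<close>. Every coefficient on the right is a global smooth function
    that vanishes at \<open>x\<close>.\<close>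
  have split: "X = (\<lambda>y. Y y + ((1 - f y) *\<^sub>R Z y + (\<Sum>i<?r. (f y * c i y) *\<^sub>R E i y)))"
  proof
    fix y
    have "(\<Sum>i<?r. (f y * c i y) *\<^sub>R E i y) = f y *\<^sub>R Z y"
    proof (cases "y \<in> U")
      case True
      have "(\<Sum>i<?r. \<epsilon> i y (Z y) *\<^sub>R E i y) = Z y"
        by (rule F(5)[OF True section_in_fibre[OF Z]])
      then show ?thesis
        by (simp add: c_def pairing_def scaleR_scaleR[symmetric] scaleR_sum_right[symmetric] del: scaleR_scaleR)
    next
      case False
      then have "f y = 0" using f(2,3) by blast
      then show ?thesis by simp
    qed
    then show "X y = Y y + ((1 - f y) *\<^sub>R Z y + (\<Sum>i<?r. (f y * c i y) *\<^sub>R E i y))"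
      by (simp add: Z_def algebra_simps)
  qed
  \<comment> \<open>Additivity is given for two sections at a time, so the finite sum needs an
    induction that also carries membership in \<open>sections A\<close>.\<close>
  have zero: "F (\<lambda>y. \<Sum>i\<in>I. (f y * c i y) *\<^sub>R E i y) x = 0
      \<and> (\<lambda>y. \<Sum>i\<in>I. (f y * c i y) *\<^sub>R E i y) \<in> sections A" if "finite I" "I \<subseteq> {..<?r}" for I
    using that
  proof (induction I rule: finite_induct)
    case empty
    show ?case using scale[OF smooth_funs_const[of 0] Z] sections_0 by simp
  next
    case (insert i I)
    then have i: "i < ?r" and fc: "(\<lambda>y. f y * c i y) \<in> smooth_funs A"
      using f(1) c by (auto intro: smooth_funs_mult)
    have s: "(\<lambda>y. (f y * c i y) *\<^sub>R E i y) \<in> sections A" by (rule sections_scale[OF fc F(3)[OF i]])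
    have "F (\<lambda>y. (f y * c i y) *\<^sub>R E i y) x = 0" using scale[OF fc F(3)[OF i]] cx[OF i] by simp
    then show ?case using insert add[OF s] sections_add[OF s] by simp
  qed
  have g: "(\<lambda>y. 1 - f y) \<in> smooth_funs A" by (intro smooth_funs_intros f(1))
  have gZ: "(\<lambda>y. (1 - f y) *\<^sub>R Z y) \<in> sections A" by (rule sections_scale[OF g Z])
  have "F (\<lambda>y. (1 - f y) *\<^sub>R Z y) x = 0" using scale[OF g Z] f(4,5) by simp
  then have "F (\<lambda>y. Y y + ((1 - f y) *\<^sub>R Z y + (\<Sum>i<?r. (f y * c i y) *\<^sub>R E i y))) x = F Y x"
    using add[OF gZ] add[OF Y sections_add[OF gZ]] zero[of "{..<?r}"] by simp
  then show ?thesis using split by simp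
qed

text \<open>By \<open>tensorial\<close> all sections through a vector give the same value, so the
  definite description in \<open>dual_section_of\<close> is well defined. Linearity on fibres is
  then inherited by choosing sections through the given vectors.\<close>

lemma dual_section_of:
  assumes add: "\<And>X Y x. X \<in> sections A \<Longrightarrow> Y \<in> sections A \<Longrightarrow> F (\<lambda>y. X y + Y y) x = F X x + F Y x"
    and scale: "\<And>f X x. f \<in> smooth_funs A \<Longrightarrow> X \<in> sections A \<Longrightarrow> F (\<lambda>y. f y *\<^sub>R X y) x = f x * F X x"
    and smooth: "\<And>X. X \<in> sections A \<Longrightarrow> F X \<in> smooth_funs A"
  shows dual_section_of_in: "dual_section_of A F \<in> dual_sections A"
    and dual_section_of_apply: "X \<in> sections A \<Longrightarrow> dual_section_of A F x (X x) = F X x"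
proof -
  show *: "dual_section_of A F x (X x) = F X x" if X: "X \<in> sections A" for X x
  proof -
    have "(THE c. \<forall>V\<in>sections A. V x = X x \<longrightarrow> F V x = c) = F X x"
    proof (rule the_equality)
      show "\<forall>V\<in>sections A. V x = X x \<longrightarrow> F V x = F X x"
        using tensorial[of F x _ X, OF add scale _ X] by blast
    qed (use X in blast)
    then show ?thesis using section_in_fibre[OF X] by (simp add: dual_section_of_def)
  qed
  show "dual_section_of A F \<in> dual_sections A"
    unfolding dual_sections_iff
  proof (intro conjI allI ballI)
    fix x
    show "dual_section_of A F x \<in> dual_fibre A x"
      unfolding dual_fibre_def mem_Collect_eq
    proof (intro conjI ballI allI impI)
      fix u v assume uv: "u \<in> fibre A x" "v \<in> fibre A x"
      obtain X where X: "X \<in> sections A" "X x = u" by (rule section_through[OF uv(1)])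
      obtain Y where Y: "Y \<in> sections A" "Y x = v" by (rule section_through[OF uv(2)])
      show "dual_section_of A F x (u + v) = dual_section_of A F x u + dual_section_of A F x v"
        using *[OF sections_add[OF X(1) Y(1)], of x] *[OF X(1), of x] *[OF Y(1), of x] X Y add by simp
    next
      fix c v assume v: "v \<in> fibre A x"
      obtain Y where Y: "Y \<in> sections A" "Y x = v" by (rule section_through[OF v])
      show "dual_section_of A F x (c *\<^sub>R v) = c * dual_section_of A F x v"
        using *[OF sections_scale[OF smooth_funs_const Y(1)], of x c] *[OF Y(1), of x] Y
          scale[OF smooth_funs_const Y(1)] by simp
    qed (simp add: dual_section_of_def)
  next
    fix X assume X: "X \<in> sections A"
    have "pairing (dual_section_of A F) X = F X" using *[OF X] by (auto simp: pairing_def)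
    then show "pairing (dual_section_of A F) X \<in> smooth_funs A" using smooth[OF X] by simp
  qed
qed

end

section \<open>Lie algebroids\<close>

locale lie_algd =
  fixes A :: "('m::{t2_space,second_countable_topology}, 'e::euclidean_space, 'v::real_vector) algebroid"
  assumes lie_algebroid: "lie_algebroid A"
begin

sublocale vec_bundle A
  using lie_algebroid by unfold_locales (simp add: lie_algebroid_def)

lemmas lie_algebroid_unfolded = lie_algebroid[unfolded lie_algebroid_def]

lemma anchor_tangent: "a \<in> fibre A x \<Longrightarrow> anchor A x a \<in> tangent_space A x"
proof -
  have "\<forall>x. \<forall>a\<in>fibre A x. anchor A x a \<in> tangent_space A x"
    using lie_algebroid_unfolded by (elim conjE)
  then show "a \<in> fibre A x \<Longrightarrow> anchor A x a \<in> tangent_space A x" by blast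
qed

lemma anchor_linear:
  "a \<in> fibre A x \<Longrightarrow> b \<in> fibre A x \<Longrightarrow> f \<in> smooth_funs A \<Longrightarrow>
    anchor A x (a + b) f = anchor A x a f + anchor A x b f \<and>
    anchor A x (c *\<^sub>R a) f = c * anchor A x a f"
proof -
  have "\<forall>x. \<forall>a\<in>fibre A x. \<forall>b\<in>fibre A x. \<forall>c. \<forall>f\<in>smooth_funs A.
       anchor A x (a + b) f = anchor A x a f + anchor A x b f \<and>
       anchor A x (c *\<^sub>R a) f = c * anchor A x a f"
    using lie_algebroid_unfolded by (elim conjE)
  then show "a \<in> fibre A x \<Longrightarrow> b \<in> fibre A x \<Longrightarrow> f \<in> smooth_funs A \<Longrightarrow> ?thesis" by blast
qed

lemma anchor_add:
    "a \<in> fibre A x \<Longrightarrow> b \<in> fibre A x \<Longrightarrow> f \<in> smooth_funs A \<Longrightarrow>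
      anchor A x (a + b) f = anchor A x a f + anchor A x b f"
  and anchor_scale:
    "a \<in> fibre A x \<Longrightarrow> f \<in> smooth_funs A \<Longrightarrow> anchor A x (c *\<^sub>R a) f = c * anchor A x a f"
  using anchor_linear[of a x b f] anchor_linear[of a x a f c] by simp_all

lemma anchor_minus:
  "a \<in> fibre A x \<Longrightarrow> f \<in> smooth_funs A \<Longrightarrow> anchor A x (- a) f = - anchor A x a f"
  using anchor_scale[of a x f "-1"] by simp

lemma anchor_diff:
  "a \<in> fibre A x \<Longrightarrow> b \<in> fibre A x \<Longrightarrow> f \<in> smooth_funs A \<Longrightarrow>
    anchor A x (a - b) f = anchor A x a f - anchor A x b f"
  using anchor_add[of a x "- b" f] anchor_minus[of b x f] fibre_intros(5) by simp

lemma anchor_fun_add: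
    "a \<in> fibre A x \<Longrightarrow> f \<in> smooth_funs A \<Longrightarrow> g \<in> smooth_funs A \<Longrightarrow>
      anchor A x a (\<lambda>y. f y + g y) = anchor A x a f + anchor A x a g"
  and anchor_fun_mult:
    "a \<in> fibre A x \<Longrightarrow> f \<in> smooth_funs A \<Longrightarrow> g \<in> smooth_funs A \<Longrightarrow>
      anchor A x a (\<lambda>y. f y * g y) = anchor A x a f * g x + f x * anchor A x a g"
  and anchor_fun_scale:
    "a \<in> fibre A x \<Longrightarrow> f \<in> smooth_funs A \<Longrightarrow> anchor A x a (\<lambda>y. c * f y) = c * anchor A x a f"
  using anchor_tangent[of a x] by (auto simp: tangent_space_def)

lemma anchor_fun_minus:
  "a \<in> fibre A x \<Longrightarrow> f \<in> smooth_funs A \<Longrightarrow> anchor A x a (\<lambda>y. - f y) = - anchor A x a f"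
  using anchor_fun_scale[of a x f "-1"] by simp

lemma anchor_fun_diff:
  "a \<in> fibre A x \<Longrightarrow> f \<in> smooth_funs A \<Longrightarrow> g \<in> smooth_funs A \<Longrightarrow>
    anchor A x a (\<lambda>y. f y - g y) = anchor A x a f - anchor A x a g"
  using anchor_fun_add[OF _ _ smooth_funs_minus[of g], of a x f] anchor_fun_minus[of a x g] by simp

text \<open>Tangent vectors are derivations of global functions, so locality has to be derived:
  \<open>f - g\<close> equals \<open>(1 - b) * (f - g)\<close> for a bump function \<open>b\<close>
  supported in \<open>U\<close>, and a derivation kills a product of two functions vanishing at
  \<open>x\<close>.\<close>

lemma anchor_local:
  assumes a: "a \<in> fibre A x" and f: "f \<in> smooth_funs A" and g: "g \<in> smooth_funs A"
    and U: "open U" "x \<in> U" and eq: "\<And>y. y \<in> U \<Longrightarrow> f y = g y"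
  shows "anchor A x a f = anchor A x a g"
proof -
  obtain b K V where b: "b \<in> smooth_funs A" "K \<subseteq> U" "\<And>y. y \<notin> K \<Longrightarrow> b y = 0"
    "x \<in> V" "\<And>y. y \<in> V \<Longrightarrow> b y = 1"
    by (rule bump_function[OF U], rule that)
  have b1: "(\<lambda>y. 1 - b y) \<in> smooth_funs A" by (intro smooth_funs_intros b(1))
  have h: "(\<lambda>y. f y - g y) \<in> smooth_funs A" by (intro smooth_funs_intros f g)
  have "(\<lambda>y. f y - g y) = (\<lambda>y. (1 - b y) * (f y - g y))"
  proof
    fix y show "f y - g y = (1 - b y) * (f y - g y)"
      using b(2,3) eq by (cases "y \<in> U") auto
  qed
  then have "anchor A x a (\<lambda>y. f y - g y) = anchor A x a (\<lambda>y. (1 - b y) * (f y - g y))" by simp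
  also have "\<dots> = 0" using anchor_fun_mult[OF a b1 h] b(4,5) eq[OF U(2)] by simp
  finally show ?thesis using anchor_fun_diff[OF a f g] by simp
qed

lemma anchor_action_smooth:
  assumes "X \<in> sections A" "f \<in> smooth_funs A"
  shows "anchor_action A X f \<in> smooth_funs A"
proof -
  have "\<forall>X\<in>sections A. \<forall>f\<in>smooth_funs A. anchor_action A X f \<in> smooth_funs A"
    using lie_algebroid_unfolded by (elim conjE)
  then show ?thesis using assms by blast
qed

lemma bracket_section:
  assumes "X \<in> sections A" "Y \<in> sections A"
  shows "bracket A X Y \<in> sections A"
proof -
  have "\<forall>X\<in>sections A. \<forall>Y\<in>sections A. bracket A X Y \<in> sections A"
    using lie_algebroid_unfolded by (elim conjE)
  then show ?thesis using assms by blast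
qed

lemma bracket_skew:
  assumes "X \<in> sections A" "Y \<in> sections A"
  shows "bracket A X Y x = - bracket A Y X x"
proof -
  have "\<forall>X\<in>sections A. \<forall>Y\<in>sections A. bracket A X Y = (\<lambda>x. - bracket A Y X x)"
    using lie_algebroid_unfolded by (elim conjE)
  from fun_cong[OF bspec[OF bspec[OF this assms(1)] assms(2)], of x] show ?thesis .
qed

lemma bracket_add_left:
  assumes "X \<in> sections A" "Y \<in> sections A" "Z \<in> sections A"
  shows "bracket A (\<lambda>y. X y + Y y) Z x = bracket A X Z x + bracket A Y Z x"
proof -
  have "\<forall>X\<in>sections A. \<forall>Y\<in>sections A. \<forall>Z\<in>sections A. \<forall>c.
       bracket A (\<lambda>x. X x + Y x) Z = (\<lambda>x. bracket A X Z x + bracket A Y Z x) \<and>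
       bracket A (\<lambda>x. c *\<^sub>R X x) Z = (\<lambda>x. c *\<^sub>R bracket A X Z x)"
    using lie_algebroid_unfolded by (elim conjE)
  from bspec[OF bspec[OF bspec[OF this assms(1)] assms(2)] assms(3)]
  have "bracket A (\<lambda>x. X x + Y x) Z = (\<lambda>x. bracket A X Z x + bracket A Y Z x)" by blast
  from fun_cong[OF this, of x] show ?thesis .
qed

lemma bracket_add_right:
  "X \<in> sections A \<Longrightarrow> Y \<in> sections A \<Longrightarrow> Z \<in> sections A \<Longrightarrow>
    bracket A Z (\<lambda>y. X y + Y y) x = bracket A Z X x + bracket A Z Y x"
  using bracket_add_left[of X Y Z x] bracket_skew[of Z _ x] sections_add[of X Y]
  by simp

lemma bracket_leibniz_right:
  assumes "X \<in> sections A" "Y \<in> sections A" "f \<in> smooth_funs A"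
  shows "bracket A X (\<lambda>y. f y *\<^sub>R Y y) x = f x *\<^sub>R bracket A X Y x + anchor A x (X x) f *\<^sub>R Y x"
proof -
  have "\<forall>X\<in>sections A. \<forall>Y\<in>sections A. \<forall>f\<in>smooth_funs A.
       bracket A X (\<lambda>x. f x *\<^sub>R Y x) =
         (\<lambda>x. f x *\<^sub>R bracket A X Y x + anchor_action A X f x *\<^sub>R Y x)"
    using lie_algebroid_unfolded by (elim conjE)
  from fun_cong[OF bspec[OF bspec[OF bspec[OF this assms(1)] assms(2)] assms(3)], of x] show ?thesis by (simp add: anchor_action_def)
qed

lemma bracket_leibniz_left:
  assumes X: "X \<in> sections A" and Y: "Y \<in> sections A" and f: "f \<in> smooth_funs A"
  shows "bracket A (\<lambda>y. f y *\<^sub>R X y) Y x = f x *\<^sub>R bracket A X Y x - anchor A x (Y x) f *\<^sub>R X x"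
  using bracket_skew[OF sections_scale[OF f X] Y, of x] bracket_leibniz_right[OF Y X f, of x]
    bracket_skew[OF X Y, of x] by simp

text \<open>The Leibniz rule with the constant function -1. A derivation kills constants: applied to
  1 = 1 * 1 it gives D 1 = 2 D 1.\<close>

lemma bracket_minus_right:
  "X \<in> sections A \<Longrightarrow> Y \<in> sections A \<Longrightarrow> bracket A X (\<lambda>y. - Y y) x = - bracket A X Y x"
  using bracket_leibniz_right[OF _ _ smooth_funs_const, of X Y "-1" x]
    anchor_fun_scale[OF section_in_fibre smooth_funs_const, of X x "-1" 1]
    anchor_fun_mult[OF section_in_fibre smooth_funs_const smooth_funs_const, of X x 1 1]
  by simp

lemma bracket_diff_right:
  "X \<in> sections A \<Longrightarrow> Y \<in> sections A \<Longrightarrow> Z \<in> sections A \<Longrightarrow>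
    bracket A Z (\<lambda>y. X y - Y y) x = bracket A Z X x - bracket A Z Y x"
  using bracket_add_right[of X "\<lambda>y. - Y y" Z x] sections_minus[of Y] bracket_minus_right[of Z Y x] by simp

lemma bracket_diff_left:
  "X \<in> sections A \<Longrightarrow> Y \<in> sections A \<Longrightarrow> Z \<in> sections A \<Longrightarrow>
    bracket A (\<lambda>y. X y - Y y) Z x = bracket A X Z x - bracket A Y Z x"
  using bracket_diff_right[of X Y Z x] bracket_skew[OF sections_diff[of X Y], of Z x]
    bracket_skew[of Z X x] bracket_skew[of Z Y x] by simp

text \<open>As for functions: \<open>Y - Z\<close> equals \<open>(1 - b) (Y - Z)\<close>, and both
  terms of the Leibniz rule vanish at \<open>x\<close>.\<close>

lemma bracket_local_right:
  assumes X: "X \<in> sections A" and Y: "Y \<in> sections A" and Z: "Z \<in> sections A"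
    and U: "open U" "x \<in> U" and eq: "\<And>y. y \<in> U \<Longrightarrow> Y y = Z y"
  shows "bracket A X Y x = bracket A X Z x"
proof -
  obtain b K V where b: "b \<in> smooth_funs A" "K \<subseteq> U" "\<And>y. y \<notin> K \<Longrightarrow> b y = 0"
    "x \<in> V" "\<And>y. y \<in> V \<Longrightarrow> b y = 1"
    by (rule bump_function[OF U], rule that)
  have b1: "(\<lambda>y. 1 - b y) \<in> smooth_funs A" by (intro smooth_funs_intros b(1))
  have h: "(\<lambda>y. Y y - Z y) \<in> sections A" by (intro sections_diff Y Z)
  have "(\<lambda>y. Y y - Z y) = (\<lambda>y. (1 - b y) *\<^sub>R (Y y - Z y))"
  proof
    fix y show "Y y - Z y = (1 - b y) *\<^sub>R (Y y - Z y)"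
    proof (cases "y \<in> U")
      case False
      then have "b y = 0" using b(2,3) by blast
      then show ?thesis by simp
    qed (simp add: eq)
  qed
  then have "bracket A X (\<lambda>y. Y y - Z y) x = bracket A X (\<lambda>y. (1 - b y) *\<^sub>R (Y y - Z y)) x" by simp
  also have "\<dots> = 0" using bracket_leibniz_right[OF X h b1] b(4,5) eq[OF U(2)] by simp
  finally show ?thesis using bracket_diff_right[OF Y Z X] by simp
qed

lemma bracket_local:
  assumes X: "X \<in> sections A" "X' \<in> sections A" and Y: "Y \<in> sections A" "Y' \<in> sections A"
    and U: "open U" "x \<in> U" and eq: "\<And>y. y \<in> U \<Longrightarrow> X y = X' y" "\<And>y. y \<in> U \<Longrightarrow> Y y = Y' y"
  shows "bracket A X Y x = bracket A X' Y' x"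
  using bracket_local_right[OF X(1) Y U eq(2)] bracket_local_right[OF Y(2) X U eq(1)]
    bracket_skew[OF X(1) Y(2)] bracket_skew[OF X(2) Y(2)] by simp

end

section \<open>The Schouten bracket on 1-forms\<close>

context lie_algd
begin

text \<open>A common frame for the sharp maps of bivectors, of wedge products and of finite sums of
  these, so that additivity and locality are proved once.\<close>

definition section_map :: "(('m \<Rightarrow> 'v \<Rightarrow> real) \<Rightarrow> 'm \<Rightarrow> 'v) \<Rightarrow> bool"
  where "section_map P \<longleftrightarrow> (\<forall>\<xi>\<in>dual_sections A. P \<xi> \<in> sections A)"

text \<open>Two maps rather than one make the expression biadditive, so that sums of bivectors
  expand into pure and mixed terms.\<close>

definition jac_term where
  "jac_term P Q \<xi> \<eta> \<zeta> x =
    pairing \<zeta> (bracket A (P \<xi>) (Q \<eta>)) x + anchor A x (P \<xi> x) (pairing \<eta> (Q \<zeta>))"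

definition jac where
  "jac P Q \<xi> \<eta> \<zeta> x = jac_term P Q \<xi> \<eta> \<zeta> x + jac_term P Q \<eta> \<zeta> \<xi> x + jac_term P Q \<zeta> \<xi> \<eta> x"

text \<open>The Schouten bracket of the bivectors with sharp maps \<open>P\<close> and \<open>Q\<close>, evaluated on 1-forms. In
  this symmetrized cyclic sum all derivatives of the forms cancel.\<close>

definition schouten_form where
  "schouten_form P Q \<xi> \<eta> \<zeta> x = jac P Q \<xi> \<eta> \<zeta> x + jac Q P \<xi> \<eta> \<zeta> x"

lemma section_mapD: "section_map P \<Longrightarrow> \<xi> \<in> dual_sections A \<Longrightarrow> P \<xi> \<in> sections A"
  by (simp add: section_map_def)

lemma pairing_apply: "pairing \<xi> X x = \<xi> x (X x)"
  by (simp add: pairing_def)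

lemma pairing_add:
  assumes "\<zeta> \<in> dual_sections A" "X \<in> sections A" "Y \<in> sections A"
  shows "pairing \<zeta> (\<lambda>y. X y + Y y) = (\<lambda>y. pairing \<zeta> X y + pairing \<zeta> Y y)"
  using assms by (simp add: pairing_def dual_section_linear section_in_fibre)

lemma jac_term_add_left:
  assumes "section_map P" "section_map P'" "section_map Q"
    "\<xi> \<in> dual_sections A" "\<eta> \<in> dual_sections A" "\<zeta> \<in> dual_sections A"
  shows "jac_term (\<lambda>\<xi> x. P \<xi> x + P' \<xi> x) Q \<xi> \<eta> \<zeta> x = jac_term P Q \<xi> \<eta> \<zeta> x + jac_term P' Q \<xi> \<eta> \<zeta> x"
proof -
  note s = section_mapD[OF assms(1,4)] section_mapD[OF assms(2,4)] section_mapD[OF assms(3,5)]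
    section_mapD[OF assms(3,6)]
  show ?thesis
    unfolding jac_term_def pairing_def[of \<zeta>] bracket_add_left[OF s(1-3)]
      anchor_add[OF section_in_fibre[OF s(1)] section_in_fibre[OF s(2)]
        pairing_smooth[OF assms(5) s(4)]]
      dual_section_linear(1)[OF assms(6) section_in_fibre[OF bracket_section[OF s(1,3)]]
        section_in_fibre[OF bracket_section[OF s(2,3)]]]
    by simp
qed

lemma jac_term_add_right:
  assumes "section_map P" "section_map Q" "section_map Q'"
    "\<xi> \<in> dual_sections A" "\<eta> \<in> dual_sections A" "\<zeta> \<in> dual_sections A"
  shows "jac_term P (\<lambda>\<xi> x. Q \<xi> x + Q' \<xi> x) \<xi> \<eta> \<zeta> x = jac_term P Q \<xi> \<eta> \<zeta> x + jac_term P Q' \<xi> \<eta> \<zeta> x"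
proof -
  note s = section_mapD[OF assms(1,4)] section_mapD[OF assms(2,5)] section_mapD[OF assms(3,5)]
    section_mapD[OF assms(2,6)] section_mapD[OF assms(3,6)]
  show ?thesis
    unfolding jac_term_def pairing_add[OF assms(5) s(4,5)]
      anchor_fun_add[OF section_in_fibre[OF s(1)] pairing_smooth[OF assms(5) s(4)]
        pairing_smooth[OF assms(5) s(5)]]
    unfolding pairing_def[of \<zeta>] bracket_add_right[OF s(2,3,1)]
      dual_section_linear(1)[OF assms(6) section_in_fibre[OF bracket_section[OF s(1,2)]]
        section_in_fibre[OF bracket_section[OF s(1,3)]]]
    by simp
qed

lemma section_map_add:
  "section_map P \<Longrightarrow> section_map Q \<Longrightarrow> section_map (\<lambda>\<xi> x. P \<xi> x + Q \<xi> x)"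
  by (simp add: section_map_def sections_add)

lemma section_map_0: "section_map (\<lambda>\<xi> x. 0)"
  by (simp add: section_map_def sections_0)

lemma schouten_form_sym: "schouten_form P Q \<xi> \<eta> \<zeta> x = schouten_form Q P \<xi> \<eta> \<zeta> x"
  by (simp add: schouten_form_def)

lemma schouten_form_add_left:
  assumes "section_map P" "section_map P'" "section_map Q"
    "\<xi> \<in> dual_sections A" "\<eta> \<in> dual_sections A" "\<zeta> \<in> dual_sections A"
  shows "schouten_form (\<lambda>\<xi> x. P \<xi> x + P' \<xi> x) Q \<xi> \<eta> \<zeta> x =
    schouten_form P Q \<xi> \<eta> \<zeta> x + schouten_form P' Q \<xi> \<eta> \<zeta> x"
  using assms by (simp add: schouten_form_def jac_def jac_term_add_left jac_term_add_right)

lemma schouten_form_add_right: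
  assumes "section_map P" "section_map Q" "section_map Q'"
    "\<xi> \<in> dual_sections A" "\<eta> \<in> dual_sections A" "\<zeta> \<in> dual_sections A"
  shows "schouten_form P (\<lambda>\<xi> x. Q \<xi> x + Q' \<xi> x) \<xi> \<eta> \<zeta> x =
    schouten_form P Q \<xi> \<eta> \<zeta> x + schouten_form P Q' \<xi> \<eta> \<zeta> x"
  using assms by (simp add: schouten_form_def jac_def jac_term_add_left jac_term_add_right)

lemma schouten_form_0:
  assumes "section_map Q" "\<xi> \<in> dual_sections A" "\<eta> \<in> dual_sections A" "\<zeta> \<in> dual_sections A"
  shows "schouten_form (\<lambda>\<xi> x. 0) Q \<xi> \<eta> \<zeta> x = 0"
  using schouten_form_add_left[OF section_map_0 section_map_0 assms, of x] by simp

text \<open>Agreement on a neighbourhood is asked for, not merely at \<open>x\<close>, because both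
  summands differentiate the images of the maps.\<close>

lemma jac_term_local:
  assumes P: "section_map P" "section_map P'" and Q: "section_map Q" "section_map Q'"
    and d: "\<xi> \<in> dual_sections A" "\<eta> \<in> dual_sections A" "\<zeta> \<in> dual_sections A"
    and U: "open U" "x \<in> U"
    and eq: "\<And>\<xi> y. \<xi> \<in> dual_sections A \<Longrightarrow> y \<in> U \<Longrightarrow> P \<xi> y = P' \<xi> y"
      "\<And>\<xi> y. \<xi> \<in> dual_sections A \<Longrightarrow> y \<in> U \<Longrightarrow> Q \<xi> y = Q' \<xi> y"
  shows "jac_term P Q \<xi> \<eta> \<zeta> x = jac_term P' Q' \<xi> \<eta> \<zeta> x"
proof -
  have "bracket A (P \<xi>) (Q \<eta>) x = bracket A (P' \<xi>) (Q' \<eta>) x"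
    by (rule bracket_local[OF _ _ _ _ U]) (use P Q d eq in \<open>auto simp: section_mapD\<close>)
  moreover have "anchor A x (P' \<xi> x) (pairing \<eta> (Q \<zeta>)) = anchor A x (P' \<xi> x) (pairing \<eta> (Q' \<zeta>))"
    by (rule anchor_local[OF _ _ _ U])
      (use P Q d eq in \<open>auto simp: section_mapD section_in_fibre pairing_smooth pairing_apply\<close>)
  ultimately show ?thesis using eq(1)[OF d(1) U(2)] by (simp add: jac_term_def pairing_def[of \<zeta>])
qed

lemma schouten_form_local:
  assumes "section_map P" "section_map P'" "section_map Q" "section_map Q'"
    "\<xi> \<in> dual_sections A" "\<eta> \<in> dual_sections A" "\<zeta> \<in> dual_sections A" "open U" "x \<in> U"
    "\<And>\<xi> y. \<xi> \<in> dual_sections A \<Longrightarrow> y \<in> U \<Longrightarrow> P \<xi> y = P' \<xi> y"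
    "\<And>\<xi> y. \<xi> \<in> dual_sections A \<Longrightarrow> y \<in> U \<Longrightarrow> Q \<xi> y = Q' \<xi> y"
  shows "schouten_form P Q \<xi> \<eta> \<zeta> x = schouten_form P' Q' \<xi> \<eta> \<zeta> x"
proof -
  have "jac_term P Q \<alpha> \<beta> \<gamma> x = jac_term P' Q' \<alpha> \<beta> \<gamma> x"
    "jac_term Q P \<alpha> \<beta> \<gamma> x = jac_term Q' P' \<alpha> \<beta> \<gamma> x"
    if "\<alpha> \<in> dual_sections A" "\<beta> \<in> dual_sections A" "\<gamma> \<in> dual_sections A" for \<alpha> \<beta> \<gamma>
    using jac_term_local[OF assms(1-4) that assms(8,9)] jac_term_local[OF assms(3,4,1,2) that assms(8,9)]
      assms(10,11) by blast+
  then show ?thesis using assms(5-7) by (simp add: schouten_form_def jac_def)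
qed

section \<open>The cyclic sum on wedge products of sections\<close>

definition wedge_sharp where
  "wedge_sharp p \<xi> x = \<xi> x (fst p x) *\<^sub>R snd p x - \<xi> x (snd p x) *\<^sub>R fst p x"

lemma section_map_wedge_sharp:
  assumes "X \<in> sections A" "Y \<in> sections A"
  shows "section_map (wedge_sharp (X, Y))"
  unfolding section_map_def
proof
  fix \<xi> assume \<xi>: "\<xi> \<in> dual_sections A"
  have "wedge_sharp (X, Y) \<xi> = (\<lambda>x. pairing \<xi> X x *\<^sub>R Y x - pairing \<xi> Y x *\<^sub>R X x)"
    by (auto simp: wedge_sharp_def pairing_def)
  then show "wedge_sharp (X, Y) \<xi> \<in> sections A"
    using \<xi> assms by (auto intro!: sections_diff sections_scale pairing_smooth)
qed

text \<open>[f X, g Y] = f g [X, Y] + f X(g) Y - g Y(f) X, paired with a form.\<close>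

lemma pairing_bracket_scaled:
  assumes X: "X \<in> sections A" and Y: "Y \<in> sections A" and f: "f \<in> smooth_funs A" and g: "g \<in> smooth_funs A"
    and \<zeta>: "\<zeta> \<in> dual_sections A"
  shows "\<zeta> x (bracket A (\<lambda>y. f y *\<^sub>R X y) (\<lambda>y. g y *\<^sub>R Y y) x) =
    f x * g x * \<zeta> x (bracket A X Y x) + f x * anchor A x (X x) g * \<zeta> x (Y x)
      - g x * anchor A x (Y x) f * \<zeta> x (X x)"
proof -
  note fibs = section_in_fibre[OF X] section_in_fibre[OF Y] section_in_fibre[OF bracket_section[OF X Y]]
  have "bracket A (\<lambda>y. f y *\<^sub>R X y) (\<lambda>y. g y *\<^sub>R Y y) x =
    g x *\<^sub>R (f x *\<^sub>R bracket A X Y x - anchor A x (Y x) f *\<^sub>R X x)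
      + (f x * anchor A x (X x) g) *\<^sub>R Y x"
    using bracket_leibniz_right[OF sections_scale[OF f X] Y g, of x] bracket_leibniz_left[OF X Y f, of x]
      anchor_scale[OF fibs(1) g] by simp
  then show ?thesis
    by (simp only: dual_section_linear[OF \<zeta>] fibs fibre_intros) (simp add: algebra_simps)
qed

text \<open>Each sharp image is a difference of two scaled sections, so the bracket splits into four
  blocks. They are written out as scalars so that the later cancellation is plain commutative
  algebra.\<close>

lemma pairing_bracket_wedge_sharp:
  assumes X: "X1 \<in> sections A" "X2 \<in> sections A" and Y: "Y1 \<in> sections A" "Y2 \<in> sections A"
    and d: "\<xi> \<in> dual_sections A" "\<eta> \<in> dual_sections A" "\<zeta> \<in> dual_sections A"
  shows "\<zeta> x (bracket A (wedge_sharp (X1, X2) \<xi>) (wedge_sharp (Y1, Y2) \<eta>) x) =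
    (pairing \<xi> X1 x * pairing \<eta> Y1 x * \<zeta> x (bracket A X2 Y2 x)
      + pairing \<xi> X1 x * anchor A x (X2 x) (pairing \<eta> Y1) * \<zeta> x (Y2 x)
      - pairing \<eta> Y1 x * anchor A x (Y2 x) (pairing \<xi> X1) * \<zeta> x (X2 x))
    - (pairing \<xi> X1 x * pairing \<eta> Y2 x * \<zeta> x (bracket A X2 Y1 x)
      + pairing \<xi> X1 x * anchor A x (X2 x) (pairing \<eta> Y2) * \<zeta> x (Y1 x)
      - pairing \<eta> Y2 x * anchor A x (Y1 x) (pairing \<xi> X1) * \<zeta> x (X2 x))
    - (pairing \<xi> X2 x * pairing \<eta> Y1 x * \<zeta> x (bracket A X1 Y2 x)
      + pairing \<xi> X2 x * anchor A x (X1 x) (pairing \<eta> Y1) * \<zeta> x (Y2 x)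
      - pairing \<eta> Y1 x * anchor A x (Y2 x) (pairing \<xi> X2) * \<zeta> x (X1 x))
    + (pairing \<xi> X2 x * pairing \<eta> Y2 x * \<zeta> x (bracket A X1 Y1 x)
      + pairing \<xi> X2 x * anchor A x (X1 x) (pairing \<eta> Y2) * \<zeta> x (Y1 x)
      - pairing \<eta> Y2 x * anchor A x (Y1 x) (pairing \<xi> X2) * \<zeta> x (X1 x))"
proof -
  have eq: "wedge_sharp (X1, X2) \<xi> = (\<lambda>x. pairing \<xi> X1 x *\<^sub>R X2 x - pairing \<xi> X2 x *\<^sub>R X1 x)"
    "wedge_sharp (Y1, Y2) \<eta> = (\<lambda>x. pairing \<eta> Y1 x *\<^sub>R Y2 x - pairing \<eta> Y2 x *\<^sub>R Y1 x)"
    by (auto simp: wedge_sharp_def pairing_def)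
  note f = pairing_smooth[OF d(1) X(1)] pairing_smooth[OF d(1) X(2)]
    pairing_smooth[OF d(2) Y(1)] pairing_smooth[OF d(2) Y(2)]
  note s = sections_scale[OF f(1) X(2)] sections_scale[OF f(2) X(1)]
    sections_scale[OF f(3) Y(2)] sections_scale[OF f(4) Y(1)]
  note b = bracket_section[OF s(1) s(3), THEN section_in_fibre]
    bracket_section[OF s(1) s(4), THEN section_in_fibre]
    bracket_section[OF s(2) s(3), THEN section_in_fibre]
    bracket_section[OF s(2) s(4), THEN section_in_fibre]
  show ?thesis
    unfolding eq bracket_diff_left[OF s(1,2) sections_diff[OF s(3,4)]]
      bracket_diff_right[OF s(3,4) s(1)] bracket_diff_right[OF s(3,4) s(2)]
      dual_section_linear(5)[OF d(3) fibre_intros(4)[OF b(1,2)] fibre_intros(4)[OF b(3,4)]]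
      dual_section_linear(5)[OF d(3) b(1,2)] dual_section_linear(5)[OF d(3) b(3,4)]
      pairing_bracket_scaled[OF X(2) Y(2) f(1,3) d(3)]
      pairing_bracket_scaled[OF X(2) Y(1) f(1,4) d(3)]
      pairing_bracket_scaled[OF X(1) Y(2) f(2,3) d(3)]
      pairing_bracket_scaled[OF X(1) Y(1) f(2,4) d(3)]
    by (simp only: algebra_simps)
qed

lemma anchor_wedge_sharp:
  assumes X: "X1 \<in> sections A" "X2 \<in> sections A" and Y: "Y1 \<in> sections A" "Y2 \<in> sections A"
    and d: "\<xi> \<in> dual_sections A" "\<eta> \<in> dual_sections A" "\<zeta> \<in> dual_sections A"
  shows "anchor A x (wedge_sharp (X1, X2) \<xi> x) (pairing \<eta> (wedge_sharp (Y1, Y2) \<zeta>)) =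
    \<xi> x (X1 x) * (anchor A x (X2 x) (pairing \<zeta> Y1) * \<eta> x (Y2 x) + \<zeta> x (Y1 x) * anchor A x (X2 x) (pairing \<eta> Y2)
      - anchor A x (X2 x) (pairing \<zeta> Y2) * \<eta> x (Y1 x) - \<zeta> x (Y2 x) * anchor A x (X2 x) (pairing \<eta> Y1))
    - \<xi> x (X2 x) * (anchor A x (X1 x) (pairing \<zeta> Y1) * \<eta> x (Y2 x) + \<zeta> x (Y1 x) * anchor A x (X1 x) (pairing \<eta> Y2)
      - anchor A x (X1 x) (pairing \<zeta> Y2) * \<eta> x (Y1 x) - \<zeta> x (Y2 x) * anchor A x (X1 x) (pairing \<eta> Y1))"
proof -
  note f = pairing_smooth[OF d(3) Y(1)] pairing_smooth[OF d(2) Y(2)]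
    pairing_smooth[OF d(3) Y(2)] pairing_smooth[OF d(2) Y(1)]
  have eq: "pairing \<eta> (wedge_sharp (Y1, Y2) \<zeta>) =
      (\<lambda>x. pairing \<zeta> Y1 x * pairing \<eta> Y2 x - pairing \<zeta> Y2 x * pairing \<eta> Y1 x)"
    using d Y
    by (auto simp: wedge_sharp_def pairing_def dual_section_linear section_in_fibre fibre_intros)
  have 1: "anchor A x a (pairing \<eta> (wedge_sharp (Y1, Y2) \<zeta>)) =
      anchor A x a (pairing \<zeta> Y1) * \<eta> x (Y2 x) + \<zeta> x (Y1 x) * anchor A x a (pairing \<eta> Y2)
      - anchor A x a (pairing \<zeta> Y2) * \<eta> x (Y1 x) - \<zeta> x (Y2 x) * anchor A x a (pairing \<eta> Y1)"
    if a: "a \<in> fibre A x" for a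
    unfolding eq anchor_fun_diff[OF a smooth_funs_mult[OF f(1,2)] smooth_funs_mult[OF f(3,4)]]
      anchor_fun_mult[OF a f(1,2)] anchor_fun_mult[OF a f(3,4)]
    by (simp add: pairing_apply)
  have sm: "pairing \<eta> (wedge_sharp (Y1, Y2) \<zeta>) \<in> smooth_funs A"
    unfolding eq by (intro smooth_funs_intros f)
  note X' = section_in_fibre[OF X(1), of x] section_in_fibre[OF X(2), of x]
  have "anchor A x (wedge_sharp (X1, X2) \<xi> x) (pairing \<eta> (wedge_sharp (Y1, Y2) \<zeta>)) =
      \<xi> x (X1 x) * anchor A x (X2 x) (pairing \<eta> (wedge_sharp (Y1, Y2) \<zeta>))
      - \<xi> x (X2 x) * anchor A x (X1 x) (pairing \<eta> (wedge_sharp (Y1, Y2) \<zeta>))"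
    unfolding wedge_sharp_def[of "(X1, X2)"] fst_conv snd_conv
      anchor_diff[OF fibre_intros(3)[OF X'(2)] fibre_intros(3)[OF X'(1)] sm]
      anchor_scale[OF X'(2) sm] anchor_scale[OF X'(1) sm] ..
  then show ?thesis unfolding 1[OF X'(1)] 1[OF X'(2)] .
qed

text \<open>A term such as \<xi>(X1) X2(\<eta>(Y1)) \<zeta>(Y2) arises once from a bracket and once,
  with opposite sign, from an anchor term of the cyclic sum. Some of these partners lie in
  \<open>jac P Q\<close> and some in \<open>jac Q P\<close>, hence the symmetrization. What remains
  are 24 bracket terms, matching the four \<open>wedge3\<close> expressions with six terms
  each.\<close>

lemma schouten_decomposable_eq:
  assumes X: "X1 \<in> sections A" "X2 \<in> sections A" and Y: "Y1 \<in> sections A" "Y2 \<in> sections A"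
    and d: "\<xi> \<in> dual_sections A" "\<eta> \<in> dual_sections A" "\<zeta> \<in> dual_sections A"
  shows "schouten_decomposable A (X1, X2) (Y1, Y2) x (\<xi> x) (\<eta> x) (\<zeta> x) =
    schouten_form (wedge_sharp (X1, X2)) (wedge_sharp (Y1, Y2)) \<xi> \<eta> \<zeta> x"
proof -
  have skew: "\<theta> x (bracket A Y' X' x) = - \<theta> x (bracket A X' Y' x)"
    if "\<theta> \<in> dual_sections A" "X' \<in> sections A" "Y' \<in> sections A" for \<theta> X' Y'
    using that by (subst bracket_skew)
      (auto simp: dual_section_linear bracket_section section_in_fibre)
  \<comment> \<open>The swapped sum \<open>jac Q P\<close> produces brackets [Y, X]; these are
    normalized to [X, Y] before terms are compared.\<close>
  note sk = skew[OF _ X(1) Y(1)] skew[OF _ X(1) Y(2)] skew[OF _ X(2) Y(1)] skew[OF _ X(2) Y(2)]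
  show ?thesis
    unfolding schouten_form_def jac_def jac_term_def pairing_def[of _ "bracket A _ _"]
      pairing_bracket_wedge_sharp[OF X Y d] pairing_bracket_wedge_sharp[OF X Y d(2,3,1)]
      pairing_bracket_wedge_sharp[OF X Y d(3,1,2)]
      pairing_bracket_wedge_sharp[OF Y X d] pairing_bracket_wedge_sharp[OF Y X d(2,3,1)]
      pairing_bracket_wedge_sharp[OF Y X d(3,1,2)]
      anchor_wedge_sharp[OF X Y d] anchor_wedge_sharp[OF X Y d(2,3,1)]
      anchor_wedge_sharp[OF X Y d(3,1,2)]
      anchor_wedge_sharp[OF Y X d] anchor_wedge_sharp[OF Y X d(2,3,1)]
      anchor_wedge_sharp[OF Y X d(3,1,2)]
      sk[OF d(1)] sk[OF d(2)] sk[OF d(3)]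
      schouten_decomposable_def prod.case wedge3_def wedge2_def pairing_apply
    by (simp add: algebra_simps)
qed

definition list_sharp where
  "list_sharp ps \<xi> x = (\<Sum>p\<leftarrow>ps. wedge_sharp p \<xi> x)"

lemma list_sharp_Cons: "list_sharp (p # ps) = (\<lambda>\<xi> x. wedge_sharp p \<xi> x + list_sharp ps \<xi> x)"
  and list_sharp_Nil: "list_sharp [] = (\<lambda>\<xi> x. 0)"
  by (auto simp: list_sharp_def fun_eq_iff)

lemma section_map_list_sharp:
  "set ps \<subseteq> sections A \<times> sections A \<Longrightarrow> section_map (list_sharp ps)"
  by (induction ps) (auto simp: list_sharp_Nil list_sharp_Cons section_map_0
      intro!: section_map_add section_map_wedge_sharp)

text \<open>Biadditivity reduces sums of wedge products to the decomposable case, by an induction on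
  each list.\<close>

lemma schouten_form_list:
  assumes d: "\<xi> \<in> dual_sections A" "\<eta> \<in> dual_sections A" "\<zeta> \<in> dual_sections A"
    and ps: "set ps \<subseteq> sections A \<times> sections A" and qs: "set qs \<subseteq> sections A \<times> sections A"
  shows "schouten_form (list_sharp ps) (list_sharp qs) \<xi> \<eta> \<zeta> x =
    (\<Sum>P\<leftarrow>ps. \<Sum>Q\<leftarrow>qs. schouten_decomposable A P Q x (\<xi> x) (\<eta> x) (\<zeta> x))"
  using ps
proof (induction ps)
  case Nil
  then show ?case
    using schouten_form_0[OF section_map_list_sharp[OF qs] d] by (simp add: list_sharp_Nil)
next
  case (Cons p ps)
  obtain X1 X2 where p: "p = (X1, X2)" by (cases p)
  have X: "X1 \<in> sections A" "X2 \<in> sections A" using Cons.prems p by auto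
  note P = section_map_wedge_sharp[OF X]
  have 1: "schouten_form (wedge_sharp (X1, X2)) (list_sharp qs) \<xi> \<eta> \<zeta> x =
      (\<Sum>Q\<leftarrow>qs. schouten_decomposable A (X1, X2) Q x (\<xi> x) (\<eta> x) (\<zeta> x))"
    using qs
  proof (induction qs)
    case Nil
    then show ?case
      using schouten_form_0[OF P d] schouten_form_sym by (simp add: list_sharp_Nil)
  next
    case (Cons q qs)
    obtain Y1 Y2 where q: "q = (Y1, Y2)" by (cases q)
    have Y: "Y1 \<in> sections A" "Y2 \<in> sections A" using Cons.prems q by auto
    have qs: "set qs \<subseteq> sections A \<times> sections A" using Cons.prems by auto
    show ?case
      unfolding q list_sharp_Cons
        schouten_form_add_right[OF P section_map_wedge_sharp[OF Y] section_map_list_sharp[OF qs] d]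
        Cons.IH[OF qs] schouten_decomposable_eq[OF X Y d, symmetric]
      by simp
  qed
  have ps: "set ps \<subseteq> sections A \<times> sections A" using Cons.prems by auto
  show ?case
    unfolding p list_sharp_Cons
      schouten_form_add_left[OF P section_map_list_sharp[OF ps] section_map_list_sharp[OF qs] d]
      Cons.IH[OF ps] 1
    by simp
qed

end

section \<open>Sharp maps and graphs of bivectors\<close>

context lie_algd
begin

lemma bivector_add:
    "bivector A \<pi> \<Longrightarrow> \<xi> \<in> dual_fibre A x \<Longrightarrow> \<xi>' \<in> dual_fibre A x \<Longrightarrow> \<eta> \<in> dual_fibre A x \<Longrightarrow>
      \<pi> x (\<lambda>v. \<xi> v + \<xi>' v) \<eta> = \<pi> x \<xi> \<eta> + \<pi> x \<xi>' \<eta>"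
  and bivector_scale:
    "bivector A \<pi> \<Longrightarrow> \<xi> \<in> dual_fibre A x \<Longrightarrow> \<eta> \<in> dual_fibre A x \<Longrightarrow>
      \<pi> x (\<lambda>v. c * \<xi> v) \<eta> = c * \<pi> x \<xi> \<eta>"
  and bivector_skew:
    "bivector A \<pi> \<Longrightarrow> \<xi> \<in> dual_fibre A x \<Longrightarrow> \<eta> \<in> dual_fibre A x \<Longrightarrow> \<pi> x \<xi> \<eta> = - \<pi> x \<eta> \<xi>"
  and bivector_smooth:
    "bivector A \<pi> \<Longrightarrow> \<alpha> \<in> dual_sections A \<Longrightarrow> \<beta> \<in> dual_sections A \<Longrightarrow>
      (\<lambda>x. \<pi> x (\<alpha> x) (\<beta> x)) \<in> smooth_funs A"
  unfolding bivector_def by blast+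

lemma bivector_sum_left:
  assumes "bivector A \<pi>" "\<And>i. i \<in> I \<Longrightarrow> \<xi> i \<in> dual_fibre A x" "\<eta> \<in> dual_fibre A x"
  shows "\<pi> x (\<lambda>v. \<Sum>i\<in>I. c i * \<xi> i v) \<eta> = (\<Sum>i\<in>I. c i * \<pi> x (\<xi> i) \<eta>)"
  using assms(2)
proof (induction I rule: infinite_finite_induct)
  case (insert i I)
  then show ?case
    using bivector_add[OF assms(1) dual_fibre_scale[of "\<xi> i" x "c i"] dual_fibre_sum[of I \<xi> x c] assms(3)]
      bivector_scale[OF assms(1) _ assms(3)] by simp
qed (use bivector_scale[OF assms(1) dual_fibre_0 assms(3), of 0] in simp_all)

lemma bivector_sum_right:
  assumes "bivector A \<pi>" "\<And>i. i \<in> I \<Longrightarrow> \<xi> i \<in> dual_fibre A x" "\<eta> \<in> dual_fibre A x"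
  shows "\<pi> x \<eta> (\<lambda>v. \<Sum>i\<in>I. c i * \<xi> i v) = (\<Sum>i\<in>I. c i * \<pi> x \<eta> (\<xi> i))"
proof -
  have "\<pi> x \<eta> (\<lambda>v. \<Sum>i\<in>I. c i * \<xi> i v) = - \<pi> x (\<lambda>v. \<Sum>i\<in>I. c i * \<xi> i v) \<eta>"
    by (rule bivector_skew[OF assms(1,3) dual_fibre_sum[OF assms(2)]])
  also have "\<pi> x (\<lambda>v. \<Sum>i\<in>I. c i * \<xi> i v) \<eta> = (\<Sum>i\<in>I. c i * \<pi> x (\<xi> i) \<eta>)"
    by (rule bivector_sum_left[OF assms])
  also have "- (\<Sum>i\<in>I. c i * \<pi> x (\<xi> i) \<eta>) = (\<Sum>i\<in>I. c i * \<pi> x \<eta> (\<xi> i))"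
    unfolding sum_negf[symmetric]
    by (intro sum.cong refl) (use bivector_skew[OF assms(1,3) assms(2)] in simp)
  finally show ?thesis .
qed

text \<open>The linear functional \<eta> \<mapsto> \<pi>(\<xi>, \<eta>) on covectors is evaluation
  at a vector, namely the one whose frame coordinates are its values on the dual frame.\<close>

lemma sharp_exists:
  assumes \<pi>: "bivector A \<pi>" and \<xi>: "\<xi> \<in> dual_fibre A x"
  shows "\<exists>a. a \<in> fibre A x \<and> (\<forall>\<eta>\<in>dual_fibre A x. \<eta> a = \<pi> x \<xi> \<eta>)"
proof -
  let ?r = "fibre_dim A"
  obtain U E \<epsilon> where F: "open U" "x \<in> U"
    "\<And>i. i < ?r \<Longrightarrow> E i \<in> sections A" "\<And>i. i < ?r \<Longrightarrow> \<epsilon> i \<in> dual_sections A"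
    "\<And>y \<xi>. y \<in> U \<Longrightarrow> \<xi> \<in> dual_fibre A y \<Longrightarrow> (\<lambda>v. \<Sum>i<?r. \<xi> (E i y) * \<epsilon> i y v) = \<xi>"
    by (rule frame_near[of x], rule that)
  let ?a = "\<Sum>i<?r. \<pi> x \<xi> (\<epsilon> i x) *\<^sub>R E i x"
  have "\<eta> ?a = \<pi> x \<xi> \<eta>" if \<eta>: "\<eta> \<in> dual_fibre A x" for \<eta>
  proof -
    have "\<eta> ?a = (\<Sum>i<?r. \<eta> (E i x) * \<pi> x \<xi> (\<epsilon> i x))"
      by (subst dual_sum[OF \<eta>]) (use F(3) in \<open>auto intro: section_in_fibre simp: mult.commute\<close>)
    also have "\<dots> = \<pi> x \<xi> (\<lambda>v. \<Sum>i<?r. \<eta> (E i x) * \<epsilon> i x v)"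
      by (rule bivector_sum_right[OF \<pi> _ \<xi>, symmetric])
        (use F(4) in \<open>auto intro: dual_section_in_dual_fibre\<close>)
    finally show ?thesis unfolding F(5)[OF F(2) \<eta>] .
  qed
  moreover have "?a \<in> fibre A x"
    by (rule fibre_intros(6), rule fibre_intros(3), rule section_in_fibre[OF F(3)]) simp
  ultimately show ?thesis by blast
qed

lemma sharp:
  assumes "bivector A \<pi>" "\<xi> \<in> dual_fibre A x"
  shows sharp_in_fibre: "sharp A \<pi> x \<xi> \<in> fibre A x"
    and sharp_apply: "\<eta> \<in> dual_fibre A x \<Longrightarrow> \<eta> (sharp A \<pi> x \<xi>) = \<pi> x \<xi> \<eta>"
proof -
  obtain a where a: "a \<in> fibre A x" "\<And>\<eta>. \<eta> \<in> dual_fibre A x \<Longrightarrow> \<eta> a = \<pi> x \<xi> \<eta>"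
    using sharp_exists[OF assms] by blast
  have "\<exists>!a. a \<in> fibre A x \<and> (\<forall>\<eta>\<in>dual_fibre A x. \<eta> a = \<pi> x \<xi> \<eta>)"
  proof (rule ex1I[of _ a])
    fix b assume "b \<in> fibre A x \<and> (\<forall>\<eta>\<in>dual_fibre A x. \<eta> b = \<pi> x \<xi> \<eta>)"
    then show "b = a" using a by (intro fibre_eqI[of b x a]) simp_all
  qed (simp add: a)
  from theI'[OF this] show "sharp A \<pi> x \<xi> \<in> fibre A x"
    "\<eta> \<in> dual_fibre A x \<Longrightarrow> \<eta> (sharp A \<pi> x \<xi>) = \<pi> x \<xi> \<eta>"
    unfolding sharp_def by blast+
qed

lemma sharp_skew:
  assumes "bivector A \<pi>" "\<xi> \<in> dual_fibre A x" "\<eta> \<in> dual_fibre A x"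
  shows "\<eta> (sharp A \<pi> x \<xi>) = - \<xi> (sharp A \<pi> x \<eta>)"
  using assms bivector_skew by (simp add: sharp_apply)

lemma sharp_sum:
  assumes "bivector A \<pi>" "\<And>i. i \<in> I \<Longrightarrow> \<xi> i \<in> dual_fibre A x"
  shows "sharp A \<pi> x (\<lambda>v. \<Sum>i\<in>I. c i * \<xi> i v) = (\<Sum>i\<in>I. c i *\<^sub>R sharp A \<pi> x (\<xi> i))"
proof (rule fibre_eqI)
  have d: "(\<lambda>v. \<Sum>i\<in>I. c i * \<xi> i v) \<in> dual_fibre A x" by (rule dual_fibre_sum[OF assms(2)])
  show "sharp A \<pi> x (\<lambda>v. \<Sum>i\<in>I. c i * \<xi> i v) \<in> fibre A x" by (rule sharp_in_fibre[OF assms(1) d])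
  show "(\<Sum>i\<in>I. c i *\<^sub>R sharp A \<pi> x (\<xi> i)) \<in> fibre A x"
    by (intro fibre_intros sharp_in_fibre assms)
  fix \<eta> assume \<eta>: "\<eta> \<in> dual_fibre A x"
  have "\<eta> (\<Sum>i\<in>I. c i *\<^sub>R sharp A \<pi> x (\<xi> i)) = (\<Sum>i\<in>I. c i * \<eta> (sharp A \<pi> x (\<xi> i)))"
    by (rule dual_sum[OF \<eta> sharp_in_fibre[OF assms]])
  also have "\<dots> = (\<Sum>i\<in>I. c i * \<pi> x (\<xi> i) \<eta>)"
    by (intro sum.cong refl) (simp add: sharp_apply[OF assms(1) assms(2) \<eta>])
  finally show "\<eta> (sharp A \<pi> x (\<lambda>v. \<Sum>i\<in>I. c i * \<xi> i v)) = \<eta> (\<Sum>i\<in>I. c i *\<^sub>R sharp A \<pi> x (\<xi> i))"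
    using bivector_sum_left[OF assms \<eta>] by (simp add: sharp_apply[OF assms(1) d \<eta>])
qed

lemma sharp_add:
  assumes "bivector A \<pi>" "\<xi> \<in> dual_fibre A x" "\<eta> \<in> dual_fibre A x"
  shows "sharp A \<pi> x (\<lambda>v. \<xi> v + \<eta> v) = sharp A \<pi> x \<xi> + sharp A \<pi> x \<eta>"
  \<comment> \<open>The type of booleans serves as a two-element index set.\<close>
  using sharp_sum[OF assms(1), of UNIV "\<lambda>b. if b then \<xi> else \<eta>" x "\<lambda>b. 1"] assms(2,3)
  by (simp add: UNIV_bool add.commute)

lemma sharp_scale:
  assumes "bivector A \<pi>" "\<xi> \<in> dual_fibre A x"
  shows "sharp A \<pi> x (\<lambda>v. c * \<xi> v) = c *\<^sub>R sharp A \<pi> x \<xi>"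
  using sharp_sum[OF assms(1), of "{()}" "\<lambda>_. \<xi>" x "\<lambda>_. c"] assms(2) by simp

text \<open>Pairing the image with \<eta> gives the function \<pi>(\<xi>, \<eta>), smooth by the
  definition of a bivector; \<open>sections_iff\<close> does the rest.\<close>

lemma section_map_sharp:
  assumes "bivector A \<pi>" shows "section_map (sharp_section A \<pi>)"
  unfolding section_map_def sections_iff
proof (intro ballI conjI allI)
  fix \<xi> \<eta> x assume \<xi>: "\<xi> \<in> dual_sections A"
  show "sharp_section A \<pi> \<xi> x \<in> fibre A x"
    unfolding sharp_section_def by (rule sharp_in_fibre[OF assms dual_section_in_dual_fibre[OF \<xi>]])
  assume \<eta>: "\<eta> \<in> dual_sections A"
  have "pairing \<eta> (sharp_section A \<pi> \<xi>) = (\<lambda>x. \<pi> x (\<xi> x) (\<eta> x))"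
    using \<xi> \<eta> by (simp add: pairing_def sharp_section_def sharp_apply[OF assms] dual_section_in_dual_fibre)
  then show "pairing \<eta> (sharp_section A \<pi> \<xi>) \<in> smooth_funs A"
    using bivector_smooth[OF assms \<xi> \<eta>] by simp
qed

lemma pairing_sharp_skew:
  assumes "bivector A \<pi>" "\<xi> \<in> dual_sections A" "\<eta> \<in> dual_sections A"
  shows "pairing \<eta> (sharp_section A \<pi> \<xi>) = (\<lambda>x. - pairing \<xi> (sharp_section A \<pi> \<eta>) x)"
  unfolding pairing_def sharp_section_def
  using sharp_skew[OF assms(1) dual_section_in_dual_fibre[OF assms(2)]
      dual_section_in_dual_fibre[OF assms(3)]] by simp

text \<open>In a frame, \<pi> is one half of the sum of m_ij E_i wedge E_j over all ordered pairs.
  The sections used are global, as \<open>decomposes_on\<close> demands, while the identity holds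
  where the frame expansions do.\<close>

lemma decomposition_near:
  assumes \<pi>: "bivector A \<pi>"
  obtains U ps where "open U" "x \<in> U" "decomposes_on A U \<pi> ps"
proof -
  let ?r = "fibre_dim A"
  obtain U E \<epsilon> where F: "open U" "x \<in> U"
    "\<And>i. i < ?r \<Longrightarrow> E i \<in> sections A" "\<And>i. i < ?r \<Longrightarrow> \<epsilon> i \<in> dual_sections A"
    "\<And>y \<xi>. y \<in> U \<Longrightarrow> \<xi> \<in> dual_fibre A y \<Longrightarrow> (\<lambda>v. \<Sum>i<?r. \<xi> (E i y) * \<epsilon> i y v) = \<xi>"
    by (rule frame_near[of x], rule that)
  define m where "m i j y = \<pi> y (\<epsilon> i y) (\<epsilon> j y)" for i j y
  \<comment> \<open>The factor 1/2 compensates for counting each unordered pair twice, and together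
    with the coefficient it is absorbed into the first section.\<close>
  define w where "w = (\<lambda>(i, j). ((\<lambda>y. (m i j y / 2) *\<^sub>R E i y), E j))"
  define ps where "ps = map w (List.product [0..<?r] [0..<?r])"
  have "decomposes_on A U \<pi> ps"
    unfolding decomposes_on_def
  proof (intro conjI ballI)
    have "(\<lambda>y. (m i j y / 2) *\<^sub>R E i y) \<in> sections A" if "i < ?r" "j < ?r" for i j
      unfolding m_def
      using smooth_funs_mult[OF smooth_funs_const[of "1 / 2"]
          bivector_smooth[OF \<pi> F(4)[OF that(1)] F(4)[OF that(2)]]] F(3)[OF that(1)]
      by (intro sections_scale) simp_all
    then show "set ps \<subseteq> sections A \<times> sections A"
      using F(3) by (auto simp: ps_def w_def)
  next
    fix y \<xi> \<eta> assume y: "y \<in> U" and \<xi>: "\<xi> \<in> dual_fibre A y" and \<eta>: "\<eta> \<in> dual_fibre A y"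
    note \<epsilon> = dual_section_in_dual_fibre[OF F(4)]
    define p where "p i j = \<xi> (E i y) * \<eta> (E j y) * m i j y" for i j
    have "\<pi> y \<xi> \<eta> = (\<Sum>i<?r. \<xi> (E i y) * \<pi> y (\<epsilon> i y) \<eta>)"
      using bivector_sum_left[OF \<pi> _ \<eta>, of "{..<?r}" "\<lambda>i. \<epsilon> i y" "\<lambda>i. \<xi> (E i y)"] \<epsilon>
      by (simp add: F(5)[OF y \<xi>])
    also have "\<dots> = (\<Sum>i<?r. \<xi> (E i y) * (\<Sum>j<?r. \<eta> (E j y) * m i j y))"
      using bivector_sum_right[OF \<pi>, of "{..<?r}" "\<lambda>i. \<epsilon> i y" y _ "\<lambda>i. \<eta> (E i y)"] \<epsilon>
      by (intro sum.cong) (simp_all add: F(5)[OF y \<eta>] m_def)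
    finally have 1: "\<pi> y \<xi> \<eta> = (\<Sum>i<?r. \<Sum>j<?r. p i j)"
      by (simp add: sum_distrib_left p_def mult.assoc)
    \<comment> \<open>Skew symmetry of m turns the second half of each wedge into the transposed
      summand, so exchanging the order of summation gives the full sum again.\<close>
    have skew: "\<xi> (E j y) * \<eta> (E i y) * m i j y = - p j i" if "i < ?r" "j < ?r" for i j
      unfolding m_def p_def using bivector_skew[OF \<pi> \<epsilon>[OF that(1)] \<epsilon>[OF that(2)]] by simp
    have dE: "\<theta> ((m i j y / 2) *\<^sub>R E i y) = m i j y / 2 * \<theta> (E i y)"
      if "\<theta> \<in> dual_fibre A y" "i < ?r" for \<theta> i j
      by (rule dual_scale[OF that(1) section_in_fibre[OF F(3)[OF that(2)]]])
    have "(\<Sum>(X, Y)\<leftarrow>ps. wedge2 (X y) (Y y) \<xi> \<eta>) =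
        (\<Sum>(i, j)\<in>{..<?r} \<times> {..<?r}. wedge2 ((m i j y / 2) *\<^sub>R E i y) (E j y) \<xi> \<eta>)"
      unfolding ps_def map_map
      by (subst sum_list_distinct_conv_sum_set)
        (auto simp: distinct_product w_def atLeast0LessThan[symmetric] intro!: sum.cong)
    also have "\<dots> = (\<Sum>i<?r. \<Sum>j<?r. 1 / 2 * p i j - 1 / 2 * (\<xi> (E j y) * \<eta> (E i y) * m i j y))"
      unfolding sum.cartesian_product[symmetric]
      by (intro sum.cong refl) (simp add: wedge2_def dE[OF \<xi>] dE[OF \<eta>] p_def mult.commute mult.left_commute)
    also have "\<dots> = (\<Sum>i<?r. \<Sum>j<?r. 1 / 2 * p i j + 1 / 2 * p j i)"
      by (intro sum.cong refl) (simp add: skew)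
    also have "\<dots> = 1 / 2 * (\<Sum>i<?r. \<Sum>j<?r. p i j) + 1 / 2 * (\<Sum>i<?r. \<Sum>j<?r. p j i)"
      by (simp add: sum.distrib sum_distrib_left)
    also have "(\<Sum>i<?r. \<Sum>j<?r. p j i) = (\<Sum>i<?r. \<Sum>j<?r. p i j)" by (rule sum.swap)
    finally show "\<pi> y \<xi> \<eta> = (\<Sum>(X, Y)\<leftarrow>ps. wedge2 (X y) (Y y) \<xi> \<eta>)" using 1 by simp
  qed
  then show thesis using that F(1,2) by blast
qed

lemma list_sharp_eq_sharp:
  assumes \<pi>: "bivector A \<pi>" and ps: "decomposes_on A U \<pi> ps" and y: "y \<in> U"
    and \<xi>: "\<xi> \<in> dual_sections A"
  shows "list_sharp ps \<xi> y = sharp_section A \<pi> \<xi> y"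
proof -
  have sub: "set ps \<subseteq> sections A \<times> sections A" using ps by (simp add: decomposes_on_def)
  have in_fibre: "list_sharp qs \<xi> y \<in> fibre A y" if "set qs \<subseteq> sections A \<times> sections A" for qs
    using section_in_fibre[OF section_mapD[OF section_map_list_sharp[OF that] \<xi>]] .
  show ?thesis
  proof (rule fibre_eqI)
    fix \<eta> assume \<eta>: "\<eta> \<in> dual_fibre A y"
    have "\<eta> (list_sharp qs \<xi> y) = (\<Sum>(X, Y)\<leftarrow>qs. wedge2 (X y) (Y y) (\<xi> y) \<eta>)"
      if "set qs \<subseteq> sections A \<times> sections A" for qs
      using that
    proof (induction qs)
      case Nil
      then show ?case by (simp add: list_sharp_Nil dual_0[OF \<eta>])
    next
      case (Cons q qs)
      obtain X Y where q: "q = (X, Y)" by (cases q)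
      have XY: "X y \<in> fibre A y" "Y y \<in> fibre A y" using Cons.prems q by (auto intro: section_in_fibre)
      have "\<eta> (wedge_sharp q \<xi> y) = wedge2 (X y) (Y y) (\<xi> y) \<eta>"
        by (simp add: q wedge_sharp_def wedge2_def dual_diff[OF \<eta>] dual_scale[OF \<eta>] XY fibre_intros)
      moreover have "wedge_sharp q \<xi> y \<in> fibre A y"
        by (simp add: q wedge_sharp_def XY fibre_intros)
      ultimately show ?case
        using Cons in_fibre[of qs] by (simp add: list_sharp_Cons dual_add[OF \<eta>] q)
    qed
    from this[OF sub] show "\<eta> (list_sharp ps \<xi> y) = \<eta> (sharp_section A \<pi> \<xi> y)"
      using ps y \<eta> dual_section_in_dual_fibre[OF \<xi>]
      by (simp add: sharp_section_def sharp_apply[OF \<pi>] decomposes_on_def)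
  next
    show "sharp_section A \<pi> \<xi> y \<in> fibre A y"
      by (rule section_in_fibre[OF section_mapD[OF section_map_sharp[OF \<pi>] \<xi>]])
  qed (rule in_fibre[OF sub])
qed

text \<open>Every admissible pair of decompositions yields the same number: its sum is
  \<open>schouten_form\<close> of the associated list maps, and these agree with the sharp maps near
  \<open>x\<close>. The description in \<open>schouten\<close> is thus well defined, and the
  right-hand side depends only on the values of the forms at \<open>x\<close>.\<close>

lemma schouten_eq:
  assumes \<pi>: "bivector A \<pi>" and \<pi>': "bivector A \<pi>'"
    and d: "\<xi> \<in> dual_sections A" "\<eta> \<in> dual_sections A" "\<zeta> \<in> dual_sections A"
  shows "schouten A \<pi> \<pi>' x (\<xi> x) (\<eta> x) (\<zeta> x) =
    schouten_form (sharp_section A \<pi>) (sharp_section A \<pi>') \<xi> \<eta> \<zeta> x"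
proof -
  have key: "(\<Sum>P\<leftarrow>ps. \<Sum>Q\<leftarrow>qs. schouten_decomposable A P Q x (\<xi> x) (\<eta> x) (\<zeta> x)) =
      schouten_form (sharp_section A \<pi>) (sharp_section A \<pi>') \<xi> \<eta> \<zeta> x"
    if U: "open U" "x \<in> U" and ps: "decomposes_on A U \<pi> ps" and qs: "decomposes_on A U \<pi>' qs" for U ps qs
  proof -
    have sub: "set ps \<subseteq> sections A \<times> sections A" "set qs \<subseteq> sections A \<times> sections A"
      using ps qs by (auto simp: decomposes_on_def)
    show ?thesis
      unfolding schouten_form_list[OF d sub, symmetric]
      by (rule schouten_form_local[OF section_map_list_sharp[OF sub(1)] section_map_sharp[OF \<pi>]
            section_map_list_sharp[OF sub(2)] section_map_sharp[OF \<pi>'] d U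
            list_sharp_eq_sharp[OF \<pi> ps] list_sharp_eq_sharp[OF \<pi>' qs]])
  qed
  obtain U ps where U: "open U" "x \<in> U" "decomposes_on A U \<pi> ps"
    by (rule decomposition_near[OF \<pi>])
  obtain V qs where V: "open V" "x \<in> V" "decomposes_on A V \<pi>' qs"
    by (rule decomposition_near[OF \<pi>'])
  \<comment> \<open>The definition of \<open>schouten\<close> asks for one open set carrying both
    decompositions.\<close>
  have W: "open (U \<inter> V)" "x \<in> U \<inter> V" "decomposes_on A (U \<inter> V) \<pi> ps" "decomposes_on A (U \<inter> V) \<pi>' qs"
    using U V by (auto simp: decomposes_on_def)
  show ?thesis
    unfolding schouten_def
  proof (rule the_equality)
    show "\<exists>U ps qs. open U \<and> x \<in> U \<and> decomposes_on A U \<pi> ps \<and> decomposes_on A U \<pi>' qs \<and>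
       schouten_form (sharp_section A \<pi>) (sharp_section A \<pi>') \<xi> \<eta> \<zeta> x =
       (\<Sum>P\<leftarrow>ps. \<Sum>Q\<leftarrow>qs. schouten_decomposable A P Q x (\<xi> x) (\<eta> x) (\<zeta> x))"
      using W key[OF W] by metis
  qed (use key in metis)
qed

abbreviation jac_sharp where
  "jac_sharp \<pi> \<equiv> jac (sharp_section A \<pi>) (sharp_section A \<pi>)"

text \<open>With both arguments equal, symmetrization merely doubles the cyclic sum. Covectors at a
  point are extended to forms to pass from pointwise vanishing to sections and back.\<close>

lemma poisson_iff_jac:
  assumes \<pi>: "bivector A \<pi>"
  shows "poisson A \<pi> \<longleftrightarrow> (\<forall>\<xi>\<in>dual_sections A. \<forall>\<eta>\<in>dual_sections A. \<forall>\<zeta>\<in>dual_sections A.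
    \<forall>x. jac_sharp \<pi> \<xi> \<eta> \<zeta> x = 0)"
proof -
  have eq: "schouten A \<pi> \<pi> x (\<xi> x) (\<eta> x) (\<zeta> x) = 2 * jac_sharp \<pi> \<xi> \<eta> \<zeta> x"
    if "\<xi> \<in> dual_sections A" "\<eta> \<in> dual_sections A" "\<zeta> \<in> dual_sections A" for \<xi> \<eta> \<zeta> x
    unfolding schouten_eq[OF \<pi> \<pi> that] schouten_form_def by simp
  show ?thesis
  proof
    assume "poisson A \<pi>"
    then have "schouten A \<pi> \<pi> x (\<xi> x) (\<eta> x) (\<zeta> x) = 0"
      if "\<xi> \<in> dual_sections A" "\<eta> \<in> dual_sections A" "\<zeta> \<in> dual_sections A" for \<xi> \<eta> \<zeta> x
      using that unfolding poisson_def by (blast intro: dual_section_in_dual_fibre)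
    then show "\<forall>\<xi>\<in>dual_sections A. \<forall>\<eta>\<in>dual_sections A. \<forall>\<zeta>\<in>dual_sections A.
        \<forall>x. jac_sharp \<pi> \<xi> \<eta> \<zeta> x = 0"
      using eq by simp
  next
    assume R: "\<forall>\<xi>\<in>dual_sections A. \<forall>\<eta>\<in>dual_sections A. \<forall>\<zeta>\<in>dual_sections A.
        \<forall>x. jac_sharp \<pi> \<xi> \<eta> \<zeta> x = 0"
    show "poisson A \<pi>"
      unfolding poisson_def
    proof (intro conjI allI ballI)
      fix x \<xi>0 \<eta>0 \<zeta>0
      assume d: "\<xi>0 \<in> dual_fibre A x" "\<eta>0 \<in> dual_fibre A x" "\<zeta>0 \<in> dual_fibre A x"
      obtain \<xi> where \<xi>: "\<xi> \<in> dual_sections A" "\<xi> x = \<xi>0" by (rule dual_section_through[OF d(1)])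
      obtain \<eta> where \<eta>: "\<eta> \<in> dual_sections A" "\<eta> x = \<eta>0" by (rule dual_section_through[OF d(2)])
      obtain \<zeta> where \<zeta>: "\<zeta> \<in> dual_sections A" "\<zeta> x = \<zeta>0" by (rule dual_section_through[OF d(3)])
      show "schouten A \<pi> \<pi> x \<xi>0 \<eta>0 \<zeta>0 = 0"
        using eq[OF \<xi>(1) \<eta>(1) \<zeta>(1), of x] R \<xi> \<eta> \<zeta> by simp
    qed (rule \<pi>)
  qed
qed

section \<open>The differential and the Dorfman bracket of sections of a graph\<close>

lemma d_form_tensorial:
  assumes \<xi>: "\<xi> \<in> dual_sections A" and X: "X \<in> sections A"
  shows "i_d_form A X \<xi> \<in> dual_sections A"
    and "V \<in> sections A \<Longrightarrow> i_d_form A X \<xi> x (V x) = d_form A \<xi> X V x"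
proof -
  note Xx = section_in_fibre[OF X] and pX = pairing_smooth[OF \<xi> X]
  have add: "d_form A \<xi> X (\<lambda>y. V y + W y) x = d_form A \<xi> X V x + d_form A \<xi> X W x"
    if VW: "V \<in> sections A" "W \<in> sections A" for V W x
    unfolding d_form_def anchor_action_def pairing_add[OF \<xi> VW]
      anchor_fun_add[OF Xx pairing_smooth[OF \<xi> VW(1)] pairing_smooth[OF \<xi> VW(2)]]
      anchor_add[OF section_in_fibre[OF VW(1)] section_in_fibre[OF VW(2)] pX]
    unfolding pairing_apply bracket_add_right[OF VW X]
      dual_section_linear(1)[OF \<xi> section_in_fibre[OF bracket_section[OF X VW(1)]]
        section_in_fibre[OF bracket_section[OF X VW(2)]]]
    by simp
  \<comment> \<open>The derivative of \<open>f\<close> from the first anchor term cancels against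
    the one from the Leibniz rule for the bracket.\<close>
  have scale: "d_form A \<xi> X (\<lambda>y. f y *\<^sub>R V y) x = f x * d_form A \<xi> X V x"
    if f: "f \<in> smooth_funs A" and V: "V \<in> sections A" for f V x
  proof -
    have eq: "pairing \<xi> (\<lambda>y. f y *\<^sub>R V y) = (\<lambda>y. f y * pairing \<xi> V y)"
      by (simp add: pairing_def dual_section_linear(2)[OF \<xi> section_in_fibre[OF V]])
    note Vx = section_in_fibre[OF V] and b = section_in_fibre[OF bracket_section[OF X V]]
    show ?thesis
      unfolding d_form_def anchor_action_def eq anchor_fun_mult[OF Xx f pairing_smooth[OF \<xi> V]]
        anchor_scale[OF Vx pX]
      unfolding pairing_apply bracket_leibniz_right[OF X V f]
        dual_section_linear(1)[OF \<xi> fibre_intros(3)[OF b] fibre_intros(3)[OF Vx]]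
        dual_section_linear(2)[OF \<xi> b] dual_section_linear(2)[OF \<xi> Vx]
      by (simp add: algebra_simps)
  qed
  have smooth: "d_form A \<xi> X V \<in> smooth_funs A" if V: "V \<in> sections A" for V
    unfolding d_form_def
    by (intro smooth_funs_diff anchor_action_smooth pairing_smooth bracket_section \<xi> X V)
  show "i_d_form A X \<xi> \<in> dual_sections A"
    unfolding i_d_form_def by (rule dual_section_of_in[OF add scale smooth])
  show "V \<in> sections A \<Longrightarrow> i_d_form A X \<xi> x (V x) = d_form A \<xi> X V x"
    unfolding i_d_form_def by (rule dual_section_of_apply[OF add scale smooth])
qed

lemma d_fun_tensorial:
  assumes f: "f \<in> smooth_funs A"
  shows "d_fun A f \<in> dual_sections A"
    and "V \<in> sections A \<Longrightarrow> d_fun A f x (V x) = anchor A x (V x) f"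
proof -
  have add: "anchor_action A (\<lambda>y. V y + W y) f x = anchor_action A V f x + anchor_action A W f x"
    if "V \<in> sections A" "W \<in> sections A" for V W x
    using that by (simp add: anchor_action_def anchor_add section_in_fibre f)
  have scale: "anchor_action A (\<lambda>y. g y *\<^sub>R V y) f x = g x * anchor_action A V f x"
    if "g \<in> smooth_funs A" "V \<in> sections A" for g V x
    using that by (simp add: anchor_action_def anchor_scale section_in_fibre f)
  have smooth: "anchor_action A V f \<in> smooth_funs A" if "V \<in> sections A" for V
    by (rule anchor_action_smooth[OF that f])
  show "d_fun A f \<in> dual_sections A"
    unfolding d_fun_def by (rule dual_section_of_in[OF add scale smooth])
  assume "V \<in> sections A"
  with add scale smooth have "d_fun A f x (V x) = anchor_action A V f x"
    unfolding d_fun_def by (rule dual_section_of_apply)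
  then show "d_fun A f x (V x) = anchor A x (V x) f" by (simp only: anchor_action_def)
qed

text \<open>Evaluating the form component on the image of \<zeta> makes every contraction an
  explicit anchor or bracket term. The two derivatives of <\<eta>, P \<xi>> along P \<zeta>, one
  from the contracted differential and one from the differential of the pairing, cancel.\<close>

lemma dorfman_sharp:
  assumes \<pi>: "bivector A \<pi>" and d: "\<xi> \<in> dual_sections A" "\<eta> \<in> dual_sections A"
  defines "D \<equiv> dorfman A (sharp_section A \<pi> \<xi>, \<xi>) (sharp_section A \<pi> \<eta>, \<eta>)"
  shows "fst D = bracket A (sharp_section A \<pi> \<xi>) (sharp_section A \<pi> \<eta>)"
    and "snd D \<in> dual_sections A"
    and "\<zeta> \<in> dual_sections A \<Longrightarrow>
      \<zeta> x (fst D x) + snd D x (sharp_section A \<pi> \<zeta> x) = jac_sharp \<pi> \<xi> \<eta> \<zeta> x"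
proof -
  let ?P = "sharp_section A \<pi>"
  have s: "?P \<theta> \<in> sections A" if "\<theta> \<in> dual_sections A" for \<theta>
    by (rule section_mapD[OF section_map_sharp[OF \<pi>] that])
  have D: "fst D = bracket A (?P \<xi>) (?P \<eta>)"
    "snd D = (\<lambda>x v. (i_d_form A (?P \<xi>) \<eta> x v + d_fun A (pairing \<eta> (?P \<xi>)) x v) - i_d_form A (?P \<eta>) \<xi> x v)"
    by (simp_all add: D_def dorfman_def lie_derivative_def)
  show "fst D = bracket A (?P \<xi>) (?P \<eta>)" by (rule D(1))
  show "snd D \<in> dual_sections A"
    unfolding D(2)
    by (intro dual_sections_diff dual_sections_add d_form_tensorial d_fun_tensorial pairing_smooth d s)
  assume \<zeta>: "\<zeta> \<in> dual_sections A"
  note Z = s[OF \<zeta>]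
  have a: "i_d_form A (?P \<xi>) \<eta> x (?P \<zeta> x) = d_form A \<eta> (?P \<xi>) (?P \<zeta>) x"
    "i_d_form A (?P \<eta>) \<xi> x (?P \<zeta> x) = d_form A \<xi> (?P \<eta>) (?P \<zeta>) x"
    by (rule d_form_tensorial(2)[OF d(2) s[OF d(1)] Z] d_form_tensorial(2)[OF d(1) s[OF d(2)] Z])+
  have b: "d_fun A (pairing \<eta> (?P \<xi>)) x (?P \<zeta> x) = anchor A x (?P \<zeta> x) (pairing \<eta> (?P \<xi>))"
    by (rule d_fun_tensorial(2)[OF pairing_smooth[OF d(2) s[OF d(1)]] Z])
  \<comment> \<open>Two sign changes bring the terms into cyclic order: skewness of the bracket
    here, skewness of the bivector in \<open>e\<close>.\<close>
  have c: "\<eta> x (bracket A (?P \<xi>) (?P \<zeta>) x) = - \<eta> x (bracket A (?P \<zeta>) (?P \<xi>) x)"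
    by (subst bracket_skew[OF s[OF d(1)] Z])
      (rule dual_section_linear(4)[OF d(2) section_in_fibre[OF bracket_section[OF Z s[OF d(1)]]]])
  have e: "anchor A x (?P \<eta> x) (pairing \<zeta> (?P \<xi>)) = - anchor A x (?P \<eta> x) (pairing \<xi> (?P \<zeta>))"
    unfolding pairing_sharp_skew[OF \<pi> d(1) \<zeta>]
    by (rule anchor_fun_minus[OF section_in_fibre[OF s[OF d(2)]] pairing_smooth[OF d(1) Z]])
  show "\<zeta> x (fst D x) + snd D x (?P \<zeta> x) = jac_sharp \<pi> \<xi> \<eta> \<zeta> x"
    unfolding D a b d_form_def jac_def jac_term_def anchor_action_def pairing_apply c e
    by simp
qed

section \<open>Graphs of bivectors as Dirac structures\<close>

lemma bivector_graph_iff: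
  "(a, \<xi>) \<in> bivector_graph A \<pi> x \<longleftrightarrow> \<xi> \<in> dual_fibre A x \<and> a = sharp A \<pi> x \<xi>"
  by (auto simp: bivector_graph_def)

text \<open>A section of the graph is determined by its form component, and its vector component is
  then automatically smooth.\<close>

lemma subbundle_sections_graph_iff:
  assumes "bivector A \<pi>"
  shows "(X, \<xi>) \<in> subbundle_sections A (bivector_graph A \<pi>) \<longleftrightarrow>
    \<xi> \<in> dual_sections A \<and> X = sharp_section A \<pi> \<xi>"
  using section_mapD[OF section_map_sharp[OF assms], of \<xi>]
  by (auto simp: subbundle_sections_def bivector_graph_iff sharp_section_def
      dual_section_in_dual_fibre)

text \<open>The pairs of a dual frame form and its sharp image are a frame of the graph, so its rank
  is that of the bundle. Independence is visible in the form component.\<close>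

lemma subbundle_graph:
  assumes \<pi>: "bivector A \<pi>"
  shows "subbundle A (bivector_graph A \<pi>)"
  unfolding subbundle_def
proof (intro exI[of _ "fibre_dim A"] allI)
  let ?r = "fibre_dim A"
  fix x
  obtain U E \<epsilon> where F: "open U" "x \<in> U"
    "\<And>i. i < ?r \<Longrightarrow> E i \<in> sections A" "\<And>i. i < ?r \<Longrightarrow> \<epsilon> i \<in> dual_sections A"
    "\<And>y i j. y \<in> U \<Longrightarrow> i < ?r \<Longrightarrow> j < ?r \<Longrightarrow> \<epsilon> i y (E j y) = (if i = j then 1 else 0)"
    "\<And>y \<xi>. y \<in> U \<Longrightarrow> \<xi> \<in> dual_fibre A y \<Longrightarrow> (\<lambda>v. \<Sum>i<?r. \<xi> (E i y) * \<epsilon> i y v) = \<xi>"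
    by (rule frame_near[of x], rule that)
  note \<epsilon> = dual_section_in_dual_fibre[OF F(4)]
  have sum: "(\<Sum>i<?r. c i *\<^sub>R sharp_section A \<pi> (\<epsilon> i) y) = sharp A \<pi> y (\<lambda>v. \<Sum>i<?r. c i * \<epsilon> i y v)" for c y
    unfolding sharp_section_def by (rule sharp_sum[OF \<pi>, symmetric]) (use \<epsilon> in simp)
  show "\<exists>U X \<xi>. open U \<and> x \<in> U \<and>
       (\<forall>i<?r. X i \<in> sections_on A U \<and> \<xi> i \<in> dual_sections_on A U) \<and>
       (\<forall>y\<in>U. bivector_graph A \<pi> y = range (\<lambda>c::nat \<Rightarrow> real.
                  (\<Sum>i<?r. c i *\<^sub>R X i y, \<lambda>v. \<Sum>i<?r. c i * \<xi> i y v)) \<and>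
         (\<forall>c::nat \<Rightarrow> real.
            (\<Sum>i<?r. c i *\<^sub>R X i y) = 0 \<and> (\<forall>v. (\<Sum>i<?r. c i * \<xi> i y v) = 0)
            \<longrightarrow> (\<forall>i<?r. c i = 0)))"
  proof (intro exI[of _ U] exI[of _ "\<lambda>i. sharp_section A \<pi> (\<epsilon> i)"] exI[of _ \<epsilon>] conjI allI impI ballI F(1,2))
    fix i assume i: "i < ?r"
    show "sharp_section A \<pi> (\<epsilon> i) \<in> sections_on A U"
      by (rule sections_on_subset[OF section_mapD[OF section_map_sharp[OF \<pi>] F(4)[OF i]]])
    show "\<epsilon> i \<in> dual_sections_on A U" by (rule dual_sections_on_subset[OF F(4)[OF i]])
  next
    fix y assume y: "y \<in> U"
    show "bivector_graph A \<pi> y = range (\<lambda>c::nat \<Rightarrow> real.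
        (\<Sum>i<?r. c i *\<^sub>R sharp_section A \<pi> (\<epsilon> i) y, \<lambda>v. \<Sum>i<?r. c i * \<epsilon> i y v))"
      unfolding sum
    proof (intro equalityI subsetI)
      fix p assume "p \<in> bivector_graph A \<pi> y"
      then obtain \<xi> where \<xi>: "\<xi> \<in> dual_fibre A y" "p = (sharp A \<pi> y \<xi>, \<xi>)"
        by (auto simp: bivector_graph_def)
      then have "p = (sharp A \<pi> y (\<lambda>v. \<Sum>i<?r. \<xi> (E i y) * \<epsilon> i y v), \<lambda>v. \<Sum>i<?r. \<xi> (E i y) * \<epsilon> i y v)"
        by (simp add: F(6)[OF y \<xi>(1)])
      then show "p \<in> range (\<lambda>c::nat \<Rightarrow> real.
          (sharp A \<pi> y (\<lambda>v. \<Sum>i<?r. c i * \<epsilon> i y v), \<lambda>v. \<Sum>i<?r. c i * \<epsilon> i y v))"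
        by (intro image_eqI[of _ _ "\<lambda>i. \<xi> (E i y)"]) auto
    next
      fix p assume "p \<in> range (\<lambda>c::nat \<Rightarrow> real.
          (sharp A \<pi> y (\<lambda>v. \<Sum>i<?r. c i * \<epsilon> i y v), \<lambda>v. \<Sum>i<?r. c i * \<epsilon> i y v))"
      then show "p \<in> bivector_graph A \<pi> y"
        using dual_fibre_sum[of "{..<?r}" "\<lambda>i. \<epsilon> i y" y, OF \<epsilon>] by (auto simp: bivector_graph_iff)
    qed
  next
    fix y and c :: "nat \<Rightarrow> real" and j
    assume y: "y \<in> U" and j: "j < ?r"
      and 0: "(\<Sum>i<?r. c i *\<^sub>R sharp_section A \<pi> (\<epsilon> i) y) = 0 \<and> (\<forall>v. (\<Sum>i<?r. c i * \<epsilon> i y v) = 0)"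
    \<comment> \<open>Evaluating the vanishing combination of forms at the frame vector
      \<open>E j\<close> isolates its coefficient.\<close>
    have "0 = (\<Sum>i<?r. c i * \<epsilon> i y (E j y))" using 0 by simp
    also have "\<dots> = (\<Sum>i<?r. if i = j then c i else 0)"
      by (intro sum.cong refl) (simp add: F(5)[OF y _ j])
    finally show "c j = 0" using j by simp
  qed
qed

text \<open>Isotropy is skewness. For maximality, a pair (a, \<xi>) orthogonal to all (P \<eta>,
  \<eta>) satisfies \<eta>(a) = - \<xi>(P \<eta>) = \<eta>(P \<xi>) for every \<eta>, so a = P
  \<xi>.\<close>

lemma isotropic_graph:
  assumes \<pi>: "bivector A \<pi>"
  shows "isotropic_subspace A x (bivector_graph A \<pi> x)"
    and "isotropic_subspace A x L' \<Longrightarrow> bivector_graph A \<pi> x \<subseteq> L' \<Longrightarrow> L' = bivector_graph A \<pi> x"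
proof -
  have "sharp A \<pi> x (\<lambda>v. 0) = 0" using sharp_scale[OF \<pi> dual_fibre_0, of x 0] by simp
  moreover have "sum_pairing p q = 0" if pq: "p \<in> bivector_graph A \<pi> x" "q \<in> bivector_graph A \<pi> x" for p q
  proof -
    obtain \<xi> \<eta> where d: "\<xi> \<in> dual_fibre A x" "p = (sharp A \<pi> x \<xi>, \<xi>)"
      "\<eta> \<in> dual_fibre A x" "q = (sharp A \<pi> x \<eta>, \<eta>)"
      using pq by (auto simp: bivector_graph_def)
    show ?thesis using sharp_skew[OF \<pi> d(1,3)] by (simp add: sum_pairing_def d(2,4))
  qed
  ultimately show "isotropic_subspace A x (bivector_graph A \<pi> x)"
    unfolding isotropic_subspace_def
    by (auto simp: bivector_graph_iff sharp_in_fibre[OF \<pi>] dual_fibre_0 dual_fibre_add dual_fibre_scale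
        sharp_add[OF \<pi>] sharp_scale[OF \<pi>])
  assume L': "isotropic_subspace A x L'" "bivector_graph A \<pi> x \<subseteq> L'"
  show "L' = bivector_graph A \<pi> x"
  proof (intro equalityI subsetI L'(2)[THEN subsetD])
    fix p assume p: "p \<in> L'"
    obtain a \<xi> where ax: "p = (a, \<xi>)" by (cases p)
    have mem: "a \<in> fibre A x" "\<xi> \<in> dual_fibre A x"
      using L'(1) p ax by (auto simp: isotropic_subspace_def)
    have "a = sharp A \<pi> x \<xi>"
    proof (rule fibre_eqI[OF mem(1) sharp_in_fibre[OF \<pi> mem(2)]])
      fix \<eta> assume \<eta>: "\<eta> \<in> dual_fibre A x"
      then have "(sharp A \<pi> x \<eta>, \<eta>) \<in> L'" using L'(2) by (auto simp: bivector_graph_iff)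
      then have "sum_pairing p (sharp A \<pi> x \<eta>, \<eta>) = 0"
        using L'(1) p by (auto simp: isotropic_subspace_def)
      then show "\<eta> a = \<eta> (sharp A \<pi> x \<xi>)"
        using sharp_skew[OF \<pi> mem(2) \<eta>] by (simp add: ax sum_pairing_def)
    qed
    then show "p \<in> bivector_graph A \<pi> x" using mem ax by (simp add: bivector_graph_iff)
  qed
qed

text \<open>The graph of any bivector is a maximally isotropic subbundle, so only closure under the
  Dorfman bracket imposes a condition. It can be tested one pair of forms at a time, since forms
  parametrize the sections.\<close>

lemma dirac_graph_iff_poisson:
  assumes \<pi>: "bivector A \<pi>"
  shows "dirac_structure A (bivector_graph A \<pi>) \<longleftrightarrow> poisson A \<pi>"
proof -
  let ?P = "sharp_section A \<pi>" and ?S = "subbundle_sections A (bivector_graph A \<pi>)"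
  have closed_iff: "dorfman A (?P \<xi>, \<xi>) (?P \<eta>, \<eta>) \<in> ?S \<longleftrightarrow>
      (\<forall>\<zeta>\<in>dual_sections A. \<forall>x. jac_sharp \<pi> \<xi> \<eta> \<zeta> x = 0)"
    if d: "\<xi> \<in> dual_sections A" "\<eta> \<in> dual_sections A" for \<xi> \<eta>
  proof -
    define B where "B = fst (dorfman A (?P \<xi>, \<xi>) (?P \<eta>, \<eta>))"
    define D where "D = snd (dorfman A (?P \<xi>, \<xi>) (?P \<eta>, \<eta>))"
    have p: "dorfman A (?P \<xi>, \<xi>) (?P \<eta>, \<eta>) = (B, D)" by (simp add: B_def D_def)
    have D: "D \<in> dual_sections A" unfolding D_def by (rule dorfman_sharp(2)[OF \<pi> d])
    have B: "B \<in> sections A"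
      unfolding B_def dorfman_sharp(1)[OF \<pi> d]
      by (intro bracket_section section_mapD[OF section_map_sharp[OF \<pi>]] d)
    have jac: "jac_sharp \<pi> \<xi> \<eta> \<zeta> x = \<zeta> x (B x) - \<zeta> x (?P D x)" if "\<zeta> \<in> dual_sections A" for \<zeta> x
      using dorfman_sharp(3)[OF \<pi> d that, of x]
        sharp_skew[OF \<pi> dual_section_in_dual_fibre[OF that, of x] dual_section_in_dual_fibre[OF D, of x]]
      by (simp add: B_def D_def sharp_section_def)
    show ?thesis
      unfolding p subbundle_sections_graph_iff[OF \<pi>]
    proof
      assume "D \<in> dual_sections A \<and> B = ?P D"
      then show "\<forall>\<zeta>\<in>dual_sections A. \<forall>x. jac_sharp \<pi> \<xi> \<eta> \<zeta> x = 0" using jac by simp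
    next
      assume R: "\<forall>\<zeta>\<in>dual_sections A. \<forall>x. jac_sharp \<pi> \<xi> \<eta> \<zeta> x = 0"
      have "B x = ?P D x" for x
      proof (rule fibre_eqI)
        fix \<theta> assume "\<theta> \<in> dual_fibre A x"
        then obtain \<zeta> where \<zeta>: "\<zeta> \<in> dual_sections A" "\<zeta> x = \<theta>" by (rule dual_section_through)
        then show "\<theta> (B x) = \<theta> (?P D x)" using R jac[OF \<zeta>(1), of x] by simp
      qed (intro section_in_fibre B section_mapD[OF section_map_sharp[OF \<pi>]] D)+
      then show "D \<in> dual_sections A \<and> B = ?P D" using D by auto
    qed
  qed
  have S: "?S = (\<lambda>\<xi>. (?P \<xi>, \<xi>)) ` dual_sections A"
    using subbundle_sections_graph_iff[OF \<pi>] by auto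
  have "(\<forall>p\<in>?S. \<forall>q\<in>?S. dorfman A p q \<in> ?S) \<longleftrightarrow>
      (\<forall>\<xi>\<in>dual_sections A. \<forall>\<eta>\<in>dual_sections A. dorfman A (?P \<xi>, \<xi>) (?P \<eta>, \<eta>) \<in> ?S)"
    unfolding S ball_simps ..
  also have "\<dots> \<longleftrightarrow> poisson A \<pi>"
    unfolding poisson_iff_jac[OF \<pi>] by (intro ball_cong refl closed_iff)
  finally have closed: "(\<forall>p\<in>?S. \<forall>q\<in>?S. dorfman A p q \<in> ?S) \<longleftrightarrow> poisson A \<pi>" .
  have "isotropic_subspace A x (bivector_graph A \<pi> x) \<and>
      (\<forall>L'. isotropic_subspace A x L' \<and> bivector_graph A \<pi> x \<subseteq> L' \<longrightarrow> L' = bivector_graph A \<pi> x)" for x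
    using isotropic_graph(1)[OF \<pi>, of x] isotropic_graph(2)[OF \<pi>, of x] by blast
  then show ?thesis
    unfolding dirac_structure_def closed using subbundle_graph[OF \<pi>] by blast
qed

lemma dirac_pair_graphs_iff_poisson_pair:
  assumes \<pi>: "bivector A \<pi>" and \<pi>': "bivector A \<pi>'"
  shows "poisson_pair A \<pi> \<pi>' \<longleftrightarrow> dirac_pair A (bivector_graph A \<pi>) (bivector_graph A \<pi>')"
proof -
  have "{(x, y). x \<in> sections A \<and> y \<in> sections A \<and>
         (\<exists>\<xi>\<in>dual_sections A.
            (x, \<xi>) \<in> subbundle_sections A (bivector_graph A \<pi>') \<and>
            (y, \<xi>) \<in> subbundle_sections A (bivector_graph A \<pi>))} =
      {(sharp_section A \<pi>' \<xi>, sharp_section A \<pi> \<xi>) |\<xi>. \<xi> \<in> dual_sections A}"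
    unfolding subbundle_sections_graph_iff[OF \<pi>] subbundle_sections_graph_iff[OF \<pi>']
    using section_mapD[OF section_map_sharp[OF \<pi>]] section_mapD[OF section_map_sharp[OF \<pi>']]
    by blast
  then show ?thesis
    unfolding poisson_pair_def dirac_pair_def dirac_graph_iff_poisson[OF \<pi>]
      dirac_graph_iff_poisson[OF \<pi>'] by simp
qed

end

section \<open>Nijenhuis relations and Hamiltonian pairs\<close>

context lie_algd
begin

text \<open>Skewness moves both sharp maps from the varying form \<xi> to \<alpha> and \<beta>. The
  condition then says that all forms agree on the two resulting sections, and forms separate vectors
  pointwise.\<close>

lemma sharp_relation_dual_iff:
  assumes \<pi>: "bivector A \<pi>" and \<pi>': "bivector A \<pi>'"
  shows "(\<beta>, \<alpha>) \<in> dual_relation A {(sharp_section A \<pi>' \<xi>, sharp_section A \<pi> \<xi>) |\<xi>. \<xi> \<in> dual_sections A}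
    \<longleftrightarrow> \<beta> \<in> dual_sections A \<and> \<alpha> \<in> dual_sections A \<and> sharp_section A \<pi>' \<alpha> = sharp_section A \<pi> \<beta>"
proof -
  have "(\<forall>\<xi>\<in>dual_sections A. pairing \<alpha> (sharp_section A \<pi>' \<xi>) = pairing \<beta> (sharp_section A \<pi> \<xi>))
    \<longleftrightarrow> sharp_section A \<pi>' \<alpha> = sharp_section A \<pi> \<beta>"
    if d: "\<alpha> \<in> dual_sections A" "\<beta> \<in> dual_sections A"
  proof -
    have eq: "pairing \<alpha> (sharp_section A \<pi>' \<xi>) = pairing \<beta> (sharp_section A \<pi> \<xi>) \<longleftrightarrow>
        (\<forall>x. \<xi> x (sharp_section A \<pi>' \<alpha> x) = \<xi> x (sharp_section A \<pi> \<beta> x))"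
      if \<xi>: "\<xi> \<in> dual_sections A" for \<xi>
      unfolding pairing_sharp_skew[OF \<pi>' \<xi> d(1)] pairing_sharp_skew[OF \<pi> \<xi> d(2)]
      by (simp add: fun_eq_iff pairing_apply)
    show ?thesis
    proof
      assume "\<forall>\<xi>\<in>dual_sections A. pairing \<alpha> (sharp_section A \<pi>' \<xi>) = pairing \<beta> (sharp_section A \<pi> \<xi>)"
      then have R: "\<xi> x (sharp_section A \<pi>' \<alpha> x) = \<xi> x (sharp_section A \<pi> \<beta> x)"
        if "\<xi> \<in> dual_sections A" for \<xi> x using eq that by blast
      show "sharp_section A \<pi>' \<alpha> = sharp_section A \<pi> \<beta>"
      proof
        fix x
        show "sharp_section A \<pi>' \<alpha> x = sharp_section A \<pi> \<beta> x"
        proof (rule fibre_eqI)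
          fix \<theta> assume "\<theta> \<in> dual_fibre A x"
          then obtain \<xi> where "\<xi> \<in> dual_sections A" "\<xi> x = \<theta>" by (rule dual_section_through)
          then show "\<theta> (sharp_section A \<pi>' \<alpha> x) = \<theta> (sharp_section A \<pi> \<beta> x)" using R by blast
        qed (intro section_in_fibre section_mapD section_map_sharp \<pi> \<pi>' d)+
      qed
    qed (use eq in simp)
  qed
  then show ?thesis unfolding dual_relation_def by blast
qed

text \<open>After skewness is applied, the unwanted terms of the mixed bracket fall into two halves:
  those containing P' \<alpha>' = P \<alpha> cancel against \<open>jac P P\<close> at \<alpha>,
  those containing P \<alpha>' = P' \<alpha>'' against \<open>jac P' P'\<close> at \<alpha>''. Only
  the terms pairing \<alpha>, \<alpha>' or \<alpha>'' with a bracket survive.\<close>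

lemma nijenhuis_expression_eq:
  assumes \<pi>: "bivector A \<pi>" and \<pi>': "bivector A \<pi>'"
    and d: "\<xi> \<in> dual_sections A" "\<eta> \<in> dual_sections A"
    and a: "\<alpha> \<in> dual_sections A" "\<alpha>' \<in> dual_sections A" "\<alpha>'' \<in> dual_sections A"
  defines "P \<equiv> sharp_section A \<pi>" and "P' \<equiv> sharp_section A \<pi>'"
  assumes eq: "P' \<alpha>' = P \<alpha>" "P' \<alpha>'' = P \<alpha>'"
  shows "pairing \<alpha> (bracket A (P \<xi>) (P \<eta>)) x
      - pairing \<alpha>' (\<lambda>y. bracket A (P \<xi>) (P' \<eta>) y + bracket A (P' \<xi>) (P \<eta>) y) x
      + pairing \<alpha>'' (bracket A (P' \<xi>) (P' \<eta>)) x =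
    jac P P \<xi> \<eta> \<alpha> x - schouten_form P P' \<xi> \<eta> \<alpha>' x + jac P' P' \<xi> \<eta> \<alpha>'' x"
proof -
  have s: "P \<theta> \<in> sections A" "P' \<theta> \<in> sections A" if "\<theta> \<in> dual_sections A" for \<theta>
    using that section_mapD[OF section_map_sharp] \<pi> \<pi>' by (auto simp: P_def P'_def)
  have sk: "anchor A x (X x) (pairing \<theta> (P \<xi>)) = - anchor A x (X x) (pairing \<xi> (P \<theta>))"
    "anchor A x (X x) (pairing \<theta> (P' \<xi>)) = - anchor A x (X x) (pairing \<xi> (P' \<theta>))"
    if "\<theta> \<in> dual_sections A" "X \<in> sections A" for \<theta> X
    unfolding pairing_sharp_skew[OF \<pi> d(1) that(1), folded P_def]
      pairing_sharp_skew[OF \<pi>' d(1) that(1), folded P'_def]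
    by (rule anchor_fun_minus[OF section_in_fibre[OF that(2)] pairing_smooth[OF d(1)]],
        rule s[OF that(1)])+
  note sk' = sk[OF a(1) s(1)[OF d(2)]] sk[OF a(2) s(1)[OF d(2)]] sk[OF a(2) s(2)[OF d(2)]]
    sk[OF a(3) s(2)[OF d(2)]]
  show ?thesis
    unfolding schouten_form_def jac_def jac_term_def sk' eq
      pairing_add[OF a(2) bracket_section[OF s(1)[OF d(1)] s(2)[OF d(2)]]
        bracket_section[OF s(2)[OF d(1)] s(1)[OF d(2)]]]
    by simp
qed

text \<open>Isolates the comparison of Poisson and Hamiltonian pairs: in both the mixed bracket has
  to vanish, and they differ only in which third arguments \<alpha>' are tested.\<close>

lemma nijenhuis_sharp_iff:
  assumes p: "poisson A \<pi>" "poisson A \<pi>'"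
  shows "nijenhuis_relation A {(sharp_section A \<pi>' \<xi>, sharp_section A \<pi> \<xi>) |\<xi>. \<xi> \<in> dual_sections A}
    \<longleftrightarrow> (\<forall>\<xi>\<in>dual_sections A. \<forall>\<eta>\<in>dual_sections A. \<forall>\<alpha>\<in>dual_sections A. \<forall>\<alpha>'\<in>dual_sections A.
      \<forall>\<alpha>''\<in>dual_sections A. sharp_section A \<pi>' \<alpha>' = sharp_section A \<pi> \<alpha> \<longrightarrow>
        sharp_section A \<pi>' \<alpha>'' = sharp_section A \<pi> \<alpha>' \<longrightarrow>
        (\<forall>x. schouten_form (sharp_section A \<pi>) (sharp_section A \<pi>') \<xi> \<eta> \<alpha>' x = 0))"
    (is "nijenhuis_relation A ?N \<longleftrightarrow> ?R")
proof -
  let ?P = "sharp_section A \<pi>" and ?P' = "sharp_section A \<pi>'"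
  have \<pi>: "bivector A \<pi>" and \<pi>': "bivector A \<pi>'" using p by (simp_all add: poisson_def)
  have N: "?N \<subseteq> sections A \<times> sections A"
    using section_mapD[OF section_map_sharp] \<pi> \<pi>' by auto
  have expr: "pairing \<alpha> (bracket A (?P \<xi>) (?P \<eta>)) x
      - pairing \<alpha>' (\<lambda>y. bracket A (?P \<xi>) (?P' \<eta>) y + bracket A (?P' \<xi>) (?P \<eta>) y) x
      + pairing \<alpha>'' (bracket A (?P' \<xi>) (?P' \<eta>)) x = - schouten_form ?P ?P' \<xi> \<eta> \<alpha>' x"
    if "\<xi> \<in> dual_sections A" "\<eta> \<in> dual_sections A"
      "\<alpha> \<in> dual_sections A" "\<alpha>' \<in> dual_sections A" "\<alpha>'' \<in> dual_sections A"
      "?P' \<alpha>' = ?P \<alpha>" "?P' \<alpha>'' = ?P \<alpha>'" for \<xi> \<eta> \<alpha> \<alpha>' \<alpha>'' x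
  proof -
    have "jac_sharp \<pi> \<xi> \<eta> \<alpha> x = 0" "jac_sharp \<pi>' \<xi> \<eta> \<alpha>'' x = 0"
      using p that unfolding poisson_iff_jac[OF \<pi>] poisson_iff_jac[OF \<pi>'] by blast+
    then show ?thesis using nijenhuis_expression_eq[OF \<pi> \<pi>' that, of x] by simp
  qed
  show ?thesis
  proof
    assume L: "nijenhuis_relation A ?N"
    show ?R
    proof (intro ballI impI allI)
      fix \<xi> \<eta> \<alpha> \<alpha>' \<alpha>'' x
      assume a: "\<xi> \<in> dual_sections A" "\<eta> \<in> dual_sections A"
        "\<alpha> \<in> dual_sections A" "\<alpha>' \<in> dual_sections A" "\<alpha>'' \<in> dual_sections A"
        "?P' \<alpha>' = ?P \<alpha>" "?P' \<alpha>'' = ?P \<alpha>'"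
      have "(?P' \<xi>, ?P \<xi>) \<in> ?N" "(?P' \<eta>, ?P \<eta>) \<in> ?N"
        "(\<alpha>, \<alpha>') \<in> dual_relation A ?N" "(\<alpha>', \<alpha>'') \<in> dual_relation A ?N"
        using a unfolding sharp_relation_dual_iff[OF \<pi> \<pi>'] by blast+
      then have "pairing \<alpha> (bracket A (?P \<xi>) (?P \<eta>)) x
          - pairing \<alpha>' (\<lambda>y. bracket A (?P \<xi>) (?P' \<eta>) y + bracket A (?P' \<xi>) (?P \<eta>) y) x
          + pairing \<alpha>'' (bracket A (?P' \<xi>) (?P' \<eta>)) x = 0"
        using L unfolding nijenhuis_relation_def by blast
      then show "schouten_form ?P ?P' \<xi> \<eta> \<alpha>' x = 0" unfolding expr[OF a] by simp
    qed
  next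
    assume R: ?R
    show "nijenhuis_relation A ?N"
      unfolding nijenhuis_relation_def
    proof (intro conjI N allI impI)
      fix u1 v1 u2 v2 \<alpha> \<alpha>' \<alpha>'' x
      assume H: "(u1, v1) \<in> ?N \<and> (u2, v2) \<in> ?N \<and>
       (\<alpha>, \<alpha>') \<in> dual_relation A ?N \<and> (\<alpha>', \<alpha>'') \<in> dual_relation A ?N"
      then obtain \<xi> \<eta> where x: "\<xi> \<in> dual_sections A" "u1 = ?P' \<xi>" "v1 = ?P \<xi>"
        "\<eta> \<in> dual_sections A" "u2 = ?P' \<eta>" "v2 = ?P \<eta>" by blast
      have a: "\<alpha> \<in> dual_sections A" "\<alpha>' \<in> dual_sections A" "\<alpha>'' \<in> dual_sections A"
        "?P' \<alpha>' = ?P \<alpha>" "?P' \<alpha>'' = ?P \<alpha>'"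
        using H unfolding sharp_relation_dual_iff[OF \<pi> \<pi>'] by blast+
      have "schouten_form ?P ?P' \<xi> \<eta> \<alpha>' x = 0" using R x a by blast
      then show "pairing \<alpha> (bracket A v1 v2) x
          - pairing \<alpha>' (\<lambda>y. bracket A v1 u2 y + bracket A u1 v2 y) x
          + pairing \<alpha>'' (bracket A u1 u2) x = 0"
        unfolding x expr[OF x(1,4) a] by simp
    qed
  qed
qed

section \<open>Sums of bivectors and Hamiltonian pairs\<close>

lemma bivector_sum_bivector:
  assumes \<pi>: "bivector A \<pi>" and \<pi>': "bivector A \<pi>'"
  shows "bivector A (\<lambda>x \<xi> \<eta>. \<pi> x \<xi> \<eta> + \<pi>' x \<xi> \<eta>)"
  unfolding bivector_def
proof (intro conjI allI ballI)
  fix x \<xi> \<xi>' \<eta> c assume d: "\<xi> \<in> dual_fibre A x" "\<xi>' \<in> dual_fibre A x" "\<eta> \<in> dual_fibre A x"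
  show "\<pi> x (\<lambda>v. \<xi> v + \<xi>' v) \<eta> + \<pi>' x (\<lambda>v. \<xi> v + \<xi>' v) \<eta> =
      \<pi> x \<xi> \<eta> + \<pi>' x \<xi> \<eta> + (\<pi> x \<xi>' \<eta> + \<pi>' x \<xi>' \<eta>)"
    using bivector_add[OF \<pi> d] bivector_add[OF \<pi>' d] by simp
  show "\<pi> x (\<lambda>v. c * \<xi> v) \<eta> + \<pi>' x (\<lambda>v. c * \<xi> v) \<eta> = c * (\<pi> x \<xi> \<eta> + \<pi>' x \<xi> \<eta>)"
    using bivector_scale[OF \<pi> d(1,3)] bivector_scale[OF \<pi>' d(1,3)] by (simp add: algebra_simps)
  show "\<pi> x \<xi> \<eta> + \<pi>' x \<xi> \<eta> = - (\<pi> x \<eta> \<xi> + \<pi>' x \<eta> \<xi>)"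
    using bivector_skew[OF \<pi> d(1,3)] bivector_skew[OF \<pi>' d(1,3)] by simp
qed (intro smooth_funs_add bivector_smooth \<pi> \<pi>')

lemma sharp_section_sum_bivector:
  assumes \<pi>: "bivector A \<pi>" and \<pi>': "bivector A \<pi>'" and \<xi>: "\<xi> \<in> dual_sections A"
  shows "sharp_section A (\<lambda>x \<xi> \<eta>. \<pi> x \<xi> \<eta> + \<pi>' x \<xi> \<eta>) \<xi> =
    (\<lambda>x. sharp_section A \<pi> \<xi> x + sharp_section A \<pi>' \<xi> x)"
proof
  fix x
  note \<xi>x = dual_section_in_dual_fibre[OF \<xi>, of x] and sum = bivector_sum_bivector[OF \<pi> \<pi>']
  note f = sharp_in_fibre[OF \<pi> \<xi>x] sharp_in_fibre[OF \<pi>' \<xi>x]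
  show "sharp_section A (\<lambda>x \<xi> \<eta>. \<pi> x \<xi> \<eta> + \<pi>' x \<xi> \<eta>) \<xi> x =
      sharp_section A \<pi> \<xi> x + sharp_section A \<pi>' \<xi> x"
    unfolding sharp_section_def
  proof (rule fibre_eqI[OF sharp_in_fibre[OF sum \<xi>x] fibre_intros(2)[OF f]])
    fix \<eta> assume \<eta>: "\<eta> \<in> dual_fibre A x"
    show "\<eta> (sharp A (\<lambda>x \<xi> \<eta>. \<pi> x \<xi> \<eta> + \<pi>' x \<xi> \<eta>) x (\<xi> x)) =
        \<eta> (sharp A \<pi> x (\<xi> x) + sharp A \<pi>' x (\<xi> x))"
      unfolding dual_add[OF \<eta> f] sharp_apply[OF sum \<xi>x \<eta>] sharp_apply[OF \<pi> \<xi>x \<eta>]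
        sharp_apply[OF \<pi>' \<xi>x \<eta>] ..
  qed
qed

text \<open>Polarization: the mixed terms in the expansion of the cyclic sum for P + P' are exactly
  the symmetrized sum.\<close>

lemma jac_sharp_sum:
  assumes \<pi>: "bivector A \<pi>" and \<pi>': "bivector A \<pi>'"
    and d: "\<xi> \<in> dual_sections A" "\<eta> \<in> dual_sections A" "\<zeta> \<in> dual_sections A"
  shows "jac_sharp (\<lambda>x \<xi> \<eta>. \<pi> x \<xi> \<eta> + \<pi>' x \<xi> \<eta>) \<xi> \<eta> \<zeta> x =
    jac_sharp \<pi> \<xi> \<eta> \<zeta> x + jac_sharp \<pi>' \<xi> \<eta> \<zeta> x
      + schouten_form (sharp_section A \<pi>) (sharp_section A \<pi>') \<xi> \<eta> \<zeta> x"
proof -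
  let ?P = "sharp_section A \<pi>" and ?P' = "sharp_section A \<pi>'"
  let ?Q = "\<lambda>\<xi> x. ?P \<xi> x + ?P' \<xi> x"
  note s = section_map_sharp[OF \<pi>] section_map_sharp[OF \<pi>']
  have t: "jac_term ?Q ?Q \<alpha> \<beta> \<gamma> x = jac_term ?P ?P \<alpha> \<beta> \<gamma> x + jac_term ?P ?P' \<alpha> \<beta> \<gamma> x
      + jac_term ?P' ?P \<alpha> \<beta> \<gamma> x + jac_term ?P' ?P' \<alpha> \<beta> \<gamma> x"
    if "\<alpha> \<in> dual_sections A" "\<beta> \<in> dual_sections A" "\<gamma> \<in> dual_sections A" for \<alpha> \<beta> \<gamma>
    unfolding jac_term_add_left[OF s section_map_add[OF s] that]
      jac_term_add_right[OF s(1) s that] jac_term_add_right[OF s(2) s that] by simp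
  have "jac_sharp (\<lambda>x \<xi> \<eta>. \<pi> x \<xi> \<eta> + \<pi>' x \<xi> \<eta>) \<xi> \<eta> \<zeta> x = jac ?Q ?Q \<xi> \<eta> \<zeta> x"
    using d by (simp add: jac_def jac_term_def sharp_section_sum_bivector[OF \<pi> \<pi>'])
  then show ?thesis
    by (simp add: jac_def schouten_form_def t d)
qed

lemma hamiltonian_pair_iff:
  assumes p: "poisson A \<pi>" "poisson A \<pi>'"
  shows "hamiltonian_pair A \<pi> \<pi>' \<longleftrightarrow>
    (\<forall>\<xi>\<in>dual_sections A. \<forall>\<eta>\<in>dual_sections A. \<forall>\<zeta>\<in>dual_sections A.
      \<forall>x. schouten_form (sharp_section A \<pi>) (sharp_section A \<pi>') \<xi> \<eta> \<zeta> x = 0)"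
proof -
  have \<pi>: "bivector A \<pi>" and \<pi>': "bivector A \<pi>'" using p by (simp_all add: poisson_def)
  have "jac_sharp (\<lambda>x \<xi> \<eta>. \<pi> x \<xi> \<eta> + \<pi>' x \<xi> \<eta>) \<xi> \<eta> \<zeta> x =
      schouten_form (sharp_section A \<pi>) (sharp_section A \<pi>') \<xi> \<eta> \<zeta> x"
    if d: "\<xi> \<in> dual_sections A" "\<eta> \<in> dual_sections A" "\<zeta> \<in> dual_sections A" for \<xi> \<eta> \<zeta> x
  proof -
    have "jac_sharp \<pi> \<xi> \<eta> \<zeta> x = 0" "jac_sharp \<pi>' \<xi> \<eta> \<zeta> x = 0"
      using p d unfolding poisson_iff_jac[OF \<pi>] poisson_iff_jac[OF \<pi>'] by blast+
    then show ?thesis using jac_sharp_sum[OF \<pi> \<pi>' d, of x] by simp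
  qed
  then show ?thesis
    unfolding hamiltonian_pair_def poisson_iff_jac[OF bivector_sum_bivector[OF \<pi> \<pi>']]
    using p by simp
qed

lemma hamiltonian_pair_imp_poisson_pair:
  assumes "hamiltonian_pair A \<pi> \<pi>'" shows "poisson_pair A \<pi> \<pi>'"
proof -
  have p: "poisson A \<pi>" "poisson A \<pi>'" using assms by (simp_all add: hamiltonian_pair_def)
  show ?thesis
    unfolding poisson_pair_def nijenhuis_sharp_iff[OF p]
    using p assms[unfolded hamiltonian_pair_iff[OF p]] by blast
qed

section \<open>Preimages under a non-degenerate sharp map\<close>

lemma det_smooth:
  assumes "\<And>y. B y \<in> carrier_mat n n"
    and "\<And>i j. i < n \<Longrightarrow> j < n \<Longrightarrow> (\<lambda>y. B y $$ (i, j)) \<in> smooth_funs A"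
  shows "(\<lambda>y. det (B y)) \<in> smooth_funs A"
proof -
  have prod: "(\<lambda>y. \<Prod>i\<in>I. B y $$ (i, p i)) \<in> smooth_funs A"
    if "finite I" "I \<subseteq> {0..<n}" "p permutes {0..<n}" for I p
    using that(1,2)
  proof (induction I rule: finite_induct)
    case empty
    show ?case using smooth_funs_const by simp
  next
    case (insert i I)
    then have "i < n" "p i < n" using permutes_in_image[OF that(3), of i] by auto
    then show ?case using insert assms(2) by (simp add: smooth_funs_mult)
  qed
  have "(\<lambda>y. det (B y)) = (\<lambda>y. \<Sum>p\<in>{p. p permutes {0..<n}}. signof p * (\<Prod>i\<in>{0..<n}. B y $$ (i, p i)))"
    using det_def'[OF assms(1)] by auto
  then show ?thesis by (auto intro!: smooth_funs_sum smooth_funs_mult smooth_funs_const prod)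
qed

text \<open>Entries of the adjugate are signed minors, that is, determinants of matrices whose
  entries are those of \<open>B y\<close> with shifted indices.\<close>

lemma adj_mat_smooth:
  assumes B: "\<And>y. B y \<in> carrier_mat n n"
    and sm: "\<And>i j. i < n \<Longrightarrow> j < n \<Longrightarrow> (\<lambda>y. B y $$ (i, j)) \<in> smooth_funs A"
    and ij: "i < n" "j < n"
  shows "(\<lambda>y. adj_mat (B y) $$ (i, j)) \<in> smooth_funs A"
proof -
  have "(\<lambda>y. det (mat_delete (B y) j i)) \<in> smooth_funs A"
  proof (rule det_smooth)
    show "mat_delete (B y) j i \<in> carrier_mat (n - 1) (n - 1)" for y by (rule mat_delete_carrier[OF B])
    fix i' j' assume i'j': "i' < n - 1" "j' < n - 1"
    have "(\<lambda>y. mat_delete (B y) j i $$ (i', j')) =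
        (\<lambda>y. B y $$ (if i' < j then i' else Suc i', if j' < i then j' else Suc j'))"
      using i'j' B by (auto simp: mat_delete_def carrier_matD[OF B])
    moreover have "(if i' < j then i' else Suc i') < n" "(if j' < i then j' else Suc j') < n"
      using i'j' by auto
    ultimately show "(\<lambda>y. mat_delete (B y) j i $$ (i', j')) \<in> smooth_funs A" using sm by simp
  qed
  then have "(\<lambda>y. (-1) ^ (j + i) * det (mat_delete (B y) j i)) \<in> smooth_funs A"
    by (intro smooth_funs_mult smooth_funs_const)
  moreover have "(\<lambda>y. adj_mat (B y) $$ (i, j)) = (\<lambda>y. (-1) ^ (j + i) * det (mat_delete (B y) j i))"
    using ij by (auto simp: adj_mat_def cofactor_def carrier_matD[OF B])
  ultimately show ?thesis by simp
qed

text \<open>Cramer's rule, cut off near \<open>x\<close>; keeping the factor \<open>D\<close> avoids dividing by the determinant.\<close>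

lemma sharp_invert_near:
  assumes \<pi>: "bivector A \<pi>" and nd: "non_degenerate A \<pi>"
  obtains D where "D \<in> smooth_funs A" "D x \<noteq> 0"
    "\<And>X. X \<in> sections A \<Longrightarrow> \<exists>\<alpha>\<in>dual_sections A. sharp_section A \<pi> \<alpha> = (\<lambda>y. D y *\<^sub>R X y)"
proof -
  let ?r = "fibre_dim A"
  obtain U E \<epsilon> where F: "open U" "x \<in> U"
    "\<And>i. i < ?r \<Longrightarrow> E i \<in> sections A" "\<And>i. i < ?r \<Longrightarrow> \<epsilon> i \<in> dual_sections A"
    "\<And>y i j. y \<in> U \<Longrightarrow> i < ?r \<Longrightarrow> j < ?r \<Longrightarrow> \<epsilon> i y (E j y) = (if i = j then 1 else 0)"
    "\<And>y v. y \<in> U \<Longrightarrow> v \<in> fibre A y \<Longrightarrow> (\<Sum>i<?r. \<epsilon> i y v *\<^sub>R E i y) = v"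
    by (rule frame_near[of x], rule that)
  obtain f K V where f: "f \<in> smooth_funs A" "K \<subseteq> U" "\<And>y. y \<notin> K \<Longrightarrow> f y = 0"
    "x \<in> V" "\<And>y. y \<in> V \<Longrightarrow> f y = 1"
    by (rule bump_function[OF F(1,2)], rule that)
  note \<epsilon> = dual_section_in_dual_fibre[OF F(4)]
  define m where "m i j y = \<pi> y (\<epsilon> i y) (\<epsilon> j y)" for i j y
  define B where "B y = mat ?r ?r (\<lambda>(i, j). m i j y)" for y
  have B: "B y \<in> carrier_mat ?r ?r" for y by (simp add: B_def)
  have Bij: "B y $$ (i, j) = m i j y" if "i < ?r" "j < ?r" for i j y using that by (simp add: B_def)
  have Bs: "(\<lambda>y. B y $$ (i, j)) \<in> smooth_funs A" if "i < ?r" "j < ?r" for i j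
    using bivector_smooth[OF \<pi> F(4)[OF that(1)] F(4)[OF that(2)]] by (simp add: Bij that m_def)
  \<comment> \<open>In the frame the sharp map multiplies the row of coefficients by
    \<open>B y\<close> from the right.\<close>
  have comp: "\<epsilon> j y (sharp A \<pi> y (\<lambda>v. \<Sum>i<?r. c i * \<epsilon> i y v)) = (\<Sum>i<?r. c i * m i j y)"
    if j: "j < ?r" for j y c
  proof -
    have "(\<lambda>v. \<Sum>i<?r. c i * \<epsilon> i y v) \<in> dual_fibre A y" using \<epsilon> by (intro dual_fibre_sum) simp
    then have "\<epsilon> j y (sharp A \<pi> y (\<lambda>v. \<Sum>i<?r. c i * \<epsilon> i y v)) = \<pi> y (\<lambda>v. \<Sum>i<?r. c i * \<epsilon> i y v) (\<epsilon> j y)"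
      by (rule sharp_apply[OF \<pi> _ \<epsilon>[OF j]])
    also have "\<dots> = (\<Sum>i<?r. c i * m i j y)"
      unfolding m_def by (rule bivector_sum_left[OF \<pi> _ \<epsilon>[OF j]]) (simp add: \<epsilon>)
    finally show ?thesis .
  qed
  have coord_eqI: "a = b" if "y \<in> U" "a \<in> fibre A y" "b \<in> fibre A y"
    "\<And>j. j < ?r \<Longrightarrow> \<epsilon> j y a = \<epsilon> j y b" for y a b
  proof -
    have "(\<Sum>i<?r. \<epsilon> i y a *\<^sub>R E i y) = (\<Sum>i<?r. \<epsilon> i y b *\<^sub>R E i y)" using that(4) by simp
    then show ?thesis using F(6)[OF that(1)] that(2,3) by metis
  qed
  \<comment> \<open>A kernel vector of the transpose is a row annihilated by \<open>B x\<close>,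
    that is, a non-zero covector with sharp image 0, against injectivity.\<close>
  have "det (B x) \<noteq> 0"
  proof
    assume "det (B x) = 0"
    then have "det (transpose_mat (B x)) = 0" using det_transpose[OF B] by metis
    then obtain v where v: "v \<in> carrier_vec ?r" "v \<noteq> 0\<^sub>v ?r" "transpose_mat (B x) *\<^sub>v v = 0\<^sub>v ?r"
      using det_0_iff_vec_prod_zero_field[of "transpose_mat (B x)" ?r] B by auto
    define \<xi> where "\<xi> = (\<lambda>w. \<Sum>i<?r. vec_index v i * \<epsilon> i x w)"
    have \<xi>: "\<xi> \<in> dual_fibre A x" unfolding \<xi>_def using \<epsilon> by (intro dual_fibre_sum) simp
    have s0: "sharp A \<pi> x (\<lambda>v. 0) = 0" using sharp_scale[OF \<pi> dual_fibre_0, of x 0] by simp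
    have "sharp A \<pi> x \<xi> = 0"
    proof (rule coord_eqI[OF F(2) sharp_in_fibre[OF \<pi> \<xi>] fibre_intros(1)])
      fix j assume j: "j < ?r"
      have "vec_index (transpose_mat (B x) *\<^sub>v v) j = (\<Sum>i<?r. m i j x * vec_index v i)"
        using j v(1) by (simp add: scalar_prod_def Bij atLeast0LessThan carrier_matD[OF B])
      then have "(\<Sum>i<?r. vec_index v i * m i j x) = 0" using v(3) j by (simp add: mult.commute)
      then show "\<epsilon> j x (sharp A \<pi> x \<xi>) = \<epsilon> j x 0"
        unfolding \<xi>_def comp[OF j] dual_0[OF \<epsilon>[OF j]] .
    qed
    moreover have "inj_on (sharp A \<pi> x) (dual_fibre A x)"
      using nd by (simp add: non_degenerate_def bij_betw_def)
    ultimately have \<xi>0: "\<xi> = (\<lambda>v. 0)" using s0 \<xi> dual_fibre_0 by (metis inj_onD)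
    have "vec_index v j = 0" if j: "j < ?r" for j
    proof -
      have "\<xi> (E j x) = (\<Sum>i<?r. if i = j then vec_index v i else 0)"
        unfolding \<xi>_def by (intro sum.cong refl) (simp add: F(5)[OF F(2) _ j])
      then show ?thesis using \<xi>0 j by simp
    qed
    then have "v = 0\<^sub>v ?r" using v(1) by (intro eq_vecI) auto
    then show False using v(2) by simp
  qed
  define D where "D y = f y * det (B y)" for y
  have Ds: "D \<in> smooth_funs A" unfolding D_def by (intro smooth_funs_mult f(1) det_smooth[OF B Bs])
  have Dx: "D x \<noteq> 0" using \<open>det (B x) \<noteq> 0\<close> f(4,5) by (simp add: D_def)
  have "\<exists>\<alpha>\<in>dual_sections A. sharp_section A \<pi> \<alpha> = (\<lambda>y. D y *\<^sub>R X y)" if X: "X \<in> sections A" for X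
  proof -
    \<comment> \<open>The row of coordinates of \<open>X\<close> times the adjugate, cut off by
      \<open>f\<close>. Multiplying it by \<open>B y\<close> gives f det(B) = D times the
      coordinates. All factors are globally smooth.\<close>
    define a where "a i y = f y * (\<Sum>k<?r. pairing (\<epsilon> k) X y * adj_mat (B y) $$ (k, i))" for i y
    define \<alpha> where "\<alpha> y = (\<lambda>v. \<Sum>i<?r. a i y * \<epsilon> i y v)" for y
    have "a i \<in> smooth_funs A" if i: "i < ?r" for i
      unfolding a_def using i
      by (intro smooth_funs_mult smooth_funs_sum f(1) pairing_smooth X F(4) adj_mat_smooth[OF B Bs]) simp_all
    then have \<alpha>: "\<alpha> \<in> dual_sections A"
      unfolding \<alpha>_def using F(4) by (intro dual_sections_sum dual_sections_scale) simp_all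
    note \<alpha>y = dual_section_in_dual_fibre[OF \<alpha>]
    have "sharp_section A \<pi> \<alpha> y = D y *\<^sub>R X y" for y
    proof (cases "y \<in> U")
      case True
      show ?thesis
        unfolding sharp_section_def
      proof (rule coord_eqI[OF True sharp_in_fibre[OF \<pi> \<alpha>y] fibre_intros(3)[OF section_in_fibre[OF X]]])
        fix j assume j: "j < ?r"
        have adj: "(\<Sum>i<?r. adj_mat (B y) $$ (k, i) * m i j y) = (if k = j then det (B y) else 0)"
          if k: "k < ?r" for k
        proof -
          have "(adj_mat (B y) * B y) $$ (k, j) = (\<Sum>i<?r. adj_mat (B y) $$ (k, i) * m i j y)"
            using j k B[of y] adj_mat(1)[OF B, of y]
            by (simp add: scalar_prod_def Bij atLeast0LessThan)
          then show ?thesis using adj_mat(3)[OF B, of y] j k by (cases "k = j") simp_all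
        qed
        have "\<epsilon> j y (sharp A \<pi> y (\<alpha> y)) = (\<Sum>i<?r. a i y * m i j y)"
          unfolding \<alpha>_def by (rule comp[OF j])
        also have "\<dots> = (\<Sum>i<?r. \<Sum>k<?r. f y * pairing (\<epsilon> k) X y * (adj_mat (B y) $$ (k, i) * m i j y))"
          by (simp add: a_def sum_distrib_left sum_distrib_right mult.assoc)
        also have "\<dots> = (\<Sum>k<?r. \<Sum>i<?r. f y * pairing (\<epsilon> k) X y * (adj_mat (B y) $$ (k, i) * m i j y))"
          by (rule sum.swap)
        also have "\<dots> = (\<Sum>k<?r. f y * pairing (\<epsilon> k) X y * (if k = j then det (B y) else 0))"
          unfolding sum_distrib_left[symmetric] by (intro sum.cong refl) (simp add: adj)
        also have "\<dots> = (\<Sum>k<?r. if k = j then f y * pairing (\<epsilon> k) X y * det (B y) else 0)"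
          by (intro sum.cong refl) simp
        also have "\<dots> = D y * \<epsilon> j y (X y)" using j by (simp add: D_def pairing_apply)
        also have "\<dots> = \<epsilon> j y (D y *\<^sub>R X y)"
          by (rule dual_scale[OF \<epsilon>[OF j] section_in_fibre[OF X], symmetric])
        finally show "\<epsilon> j y (sharp A \<pi> y (\<alpha> y)) = \<epsilon> j y (D y *\<^sub>R X y)" .
      qed
    next
      \<comment> \<open>Outside \<open>U\<close> the frame expansions are lost, but the cutoff makes
        both sides 0.\<close>
      case False
      then have "f y = 0" using f(2,3) by blast
      then have "\<alpha> y = (\<lambda>v. 0)" "D y = 0" by (simp_all add: \<alpha>_def a_def D_def)
      then show ?thesis
        using sharp_scale[OF \<pi> dual_fibre_0, of y 0] by (simp add: sharp_section_def)
    qed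
    then show ?thesis using \<alpha> by auto
  qed
  then show thesis using that Ds Dx by blast
qed

lemma sharp_section_scale:
  assumes "bivector A \<pi>" "\<xi> \<in> dual_sections A"
  shows "sharp_section A \<pi> (\<lambda>x v. f x * \<xi> x v) = (\<lambda>x. f x *\<^sub>R sharp_section A \<pi> \<xi> x)"
  unfolding sharp_section_def
  using sharp_scale[OF assms(1) dual_section_in_dual_fibre[OF assms(2)]] by simp

section \<open>From Poisson pairs to Hamiltonian pairs\<close>

lemma poisson_pair_imp_hamiltonian_pair:
  assumes pp: "poisson_pair A \<pi> \<pi>'" and nd: "non_degenerate A \<pi>" "non_degenerate A \<pi>'"
  shows "hamiltonian_pair A \<pi> \<pi>'"
proof -
  let ?P = "sharp_section A \<pi>" and ?P' = "sharp_section A \<pi>'"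
  have p: "poisson A \<pi>" "poisson A \<pi>'" using pp by (simp_all add: poisson_pair_def)
  have \<pi>: "bivector A \<pi>" and \<pi>': "bivector A \<pi>'" using p by (simp_all add: poisson_def)
  have N: "schouten_form ?P ?P' \<xi> \<eta> \<alpha>' x = 0"
    if "\<xi> \<in> dual_sections A" "\<eta> \<in> dual_sections A" "\<alpha> \<in> dual_sections A" "\<alpha>' \<in> dual_sections A"
      "\<alpha>'' \<in> dual_sections A" "?P' \<alpha>' = ?P \<alpha>" "?P' \<alpha>'' = ?P \<alpha>'" for \<xi> \<eta> \<alpha> \<alpha>' \<alpha>'' x
    using pp that unfolding poisson_pair_def nijenhuis_sharp_iff[OF p] by blast
  show ?thesis
    unfolding hamiltonian_pair_iff[OF p]
  proof (intro ballI allI)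
    fix \<xi> \<eta> \<zeta> x
    assume d: "\<xi> \<in> dual_sections A" "\<eta> \<in> dual_sections A" "\<zeta> \<in> dual_sections A"
    obtain D where D: "D \<in> smooth_funs A" "D x \<noteq> 0"
      "\<And>X. X \<in> sections A \<Longrightarrow> \<exists>\<alpha>\<in>dual_sections A. ?P \<alpha> = (\<lambda>y. D y *\<^sub>R X y)"
      by (rule sharp_invert_near[OF \<pi> nd(1), of x], rule that)
    obtain D' where D': "D' \<in> smooth_funs A" "D' x \<noteq> 0"
      "\<And>X. X \<in> sections A \<Longrightarrow> \<exists>\<alpha>\<in>dual_sections A. ?P' \<alpha> = (\<lambda>y. D' y *\<^sub>R X y)"
      by (rule sharp_invert_near[OF \<pi>' nd(2), of x], rule that)
    \<comment> \<open>Normalized by a constant so that the product with \<open>D y * D' y\<close>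
      takes the prescribed value at \<open>x\<close>.\<close>
    define \<theta> where "\<theta> = (\<lambda>y v. inverse (D x * D' x) * \<zeta> y v)"
    have \<theta>: "\<theta> \<in> dual_sections A"
      unfolding \<theta>_def by (rule dual_sections_scale[OF smooth_funs_const d(3)])
    have DD: "(\<lambda>y. D y * D' y) \<in> smooth_funs A" by (rule smooth_funs_mult[OF D(1) D'(1)])
    \<comment> \<open>The double factor makes both neighbouring equations solvable: P' \<alpha>' is
      D times a section, hence an image under P, and P \<alpha>' is D' times a section, hence an
      image under P'.\<close>
    define \<alpha>' where "\<alpha>' = (\<lambda>y v. (D y * D' y) * \<theta> y v)"
    have \<alpha>': "\<alpha>' \<in> dual_sections A" unfolding \<alpha>'_def by (rule dual_sections_scale[OF DD \<theta>])
    have \<alpha>'x: "\<alpha>' x = \<zeta> x" using D(2) D'(2) by (auto simp: \<alpha>'_def \<theta>_def field_simps)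
    obtain \<alpha> where \<alpha>: "\<alpha> \<in> dual_sections A" "?P \<alpha> = (\<lambda>y. D y *\<^sub>R (D' y *\<^sub>R ?P' \<theta> y))"
      using D(3)[OF sections_scale[OF D'(1) section_mapD[OF section_map_sharp[OF \<pi>'] \<theta>]]] by blast
    obtain \<alpha>'' where \<alpha>'': "\<alpha>'' \<in> dual_sections A" "?P' \<alpha>'' = (\<lambda>y. D' y *\<^sub>R (D y *\<^sub>R ?P \<theta> y))"
      using D'(3)[OF sections_scale[OF D(1) section_mapD[OF section_map_sharp[OF \<pi>] \<theta>]]] by blast
    have "?P' \<alpha>' = ?P \<alpha>" "?P' \<alpha>'' = ?P \<alpha>'"
      unfolding \<alpha>'_def sharp_section_scale[OF \<pi> \<theta>] sharp_section_scale[OF \<pi>' \<theta>] \<alpha>(2) \<alpha>''(2)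
      by (simp_all add: mult.commute)
    then have "schouten_form ?P ?P' \<xi> \<eta> \<alpha>' x = 0" by (rule N[OF d(1,2) \<alpha>(1) \<alpha>' \<alpha>''(1)])
    \<comment> \<open>The forms \<alpha>' and \<zeta> agree only at \<open>x\<close>; rewriting
      through \<open>schouten\<close>, whose arguments are covectors at \<open>x\<close>, shows that
      this is enough.\<close>
    then show "schouten_form ?P ?P' \<xi> \<eta> \<zeta> x = 0"
      unfolding schouten_eq[OF \<pi> \<pi>' d, symmetric] schouten_eq[OF \<pi> \<pi>' d(1,2) \<alpha>', symmetric] \<alpha>'x .
  qed
qed

end

theorem theorem3p2:
  fixes A :: "('m::{t2_space,second_countable_topology}, 'e::euclidean_space, 'v::real_vector) algebroid"
    and \<pi> \<pi>' :: "'m \<Rightarrow> ('v \<Rightarrow> real) \<Rightarrow> ('v \<Rightarrow> real) \<Rightarrow> real"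
  assumes "lie_algebroid A" and "bivector A \<pi>" and "bivector A \<pi>'"
  shows "(poisson_pair A \<pi> \<pi>' \<longleftrightarrow> dirac_pair A (bivector_graph A \<pi>) (bivector_graph A \<pi>')) \<and>
    (hamiltonian_pair A \<pi> \<pi>' \<longrightarrow> dirac_pair A (bivector_graph A \<pi>) (bivector_graph A \<pi>')) \<and>
    (dirac_pair A (bivector_graph A \<pi>) (bivector_graph A \<pi>') \<and>
       non_degenerate A \<pi> \<and> non_degenerate A \<pi>' \<longrightarrow> hamiltonian_pair A \<pi> \<pi>')"
proof -
  interpret lie_algd A by unfold_locales (rule assms(1))
  show ?thesis
    using dirac_pair_graphs_iff_poisson_pair[OF assms(2,3)] hamiltonian_pair_imp_poisson_pair[of \<pi> \<pi>']
      poisson_pair_imp_hamiltonian_pair[of \<pi> \<pi>'] by blast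
qed

end
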